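(* Let $p:\mathbb Z^2\to\hat{\mathbb C}$ be an orthogonal circle pattern, and consider the square lattice with face weights $a_{i,j}=p_{i,[i+j]_2}$, $(i,j)\in\mathbb Z^2$. Then, for all $i\in\mathbb Z$ and $j\ge1$, $$p_{i,j}=Y\bigl(A_{j-1}[p_{i,[j]_2}],a\bigr),$$ where $A_{j-1}[p_{i,[j]_2}]$ denotes the Aztec diamond $A_{j-1}(i,v)$ centered at any face $(i,v)$ with $[i+v]_2=[j]_2$ (the choice of $v$ does not matter since $a$ is invariant under translation by $(0,2)$).
   Context: $\hat{\mathbb C}=\mathbb C\cup\{\infty\}$ is identified with $\mathbb{CP}^1$, with the usual arithmetic; $[n]_q\in\{0,\dots,q-1\}$ is the residue of $n$ modulo $q$. A (square grid) circle pattern is a map $p:\mathbb Z^2\to\hat{\mathbb C}$ such that for all $(i,j)$ there is a circle $c_{i,j}$ (Euclidean circle or line) containing $p_{i,j},p_{i+1,j},p_{i+1,j+1},p_{i,j+1}$. It is orthogonal if adjacent circles ($c_{i,j}$ and $c_{i+1,j}$; $c_{i,j}$ and $c_{i,j+1}$) intersect orthogonally. Ratio function of oriented dimers. Consider the square lattice whose faces are the unit squares centered at the points of $\mathbb Z^2$, face $(i,j)$ carrying the weight $a_{i,j}$. For $k\ge1$, the Aztec diamond $A_k(i,j)$ is the subgraph formed by the vertices and edges of its internal faces, which are the faces $(i',j')$ with $|i'-i|+|j'-j|<k$; its open faces are the $(i',j')$ with $|i'-i|+|j'-j|=k$; $F$ is the set of all internal and open faces. The graph is bipartite. A Kasteleyn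 orientation is a skew-symmetric function $\varphi$ from directed edges to $\{-1,1\}$ such that for every internal face $f$, $\prod_{wb\in\partial f}\varphi_{(w,b)}=-1$ (product over the four boundary edges, each directed from white to black). An oriented dimer configuration $\vec{M}$ is a set of directed edges whose undirected version is a perfect matching (each matched edge carrying exactly one direction). Its weight is $\prod_{\vec e\in\vec M}\varphi_{\vec e}\,a_{f(\vec e)}$, where $f(\vec e)\in F$ is the face to the right of $\vec e$. $Z(A,a,\varphi)$ is the sum of the weights of all oriented dimer configurations of $A$, and $Y(A,a)=\bigl(\prod_{f\in F}a_f\bigr)\frac{Z(A,a^{-1},\varphi)}{Z(A,a,\varphi)}$, where $a^{-1}$ denotes the inverse face weights; this does not depend on $\varphi$. For size $0$, $Y(A_0(i,j),a)=a_{i,j}$. $Y$ is regarded as a rational function of the face weights. Standing assumption: the data are generic, so that all expressions are well defined. *)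

theory Defs
  imports "HOL-Analysis.Analysis"
begin

section \<open>The Riemann sphere and its circles\<close>

datatype riemann_sphere = Finite complex | Infty

text \<open>Homogeneous coordinates on the complex projective line: \<open>Finite z\<close> is \<open>[z : 1]\<close>
  and \<open>Infty\<close> is \<open>[1 : 0]\<close>. The function \<open>from_hcoords\<close> is only meaningful away from \<open>(0, 0)\<close>.\<close>

fun hcoords :: "riemann_sphere \<Rightarrow> complex \<times> complex" where
  "hcoords (Finite z) = (z, 1)"
| "hcoords Infty = (1, 0)"

definition from_hcoords :: "complex \<times> complex \<Rightarrow> riemann_sphere" where
  "from_hcoords u = (if snd u = 0 then Infty else Finite (fst u / snd u))"

text \<open>\<open>Circle c r\<close> has centre \<open>c\<close> and radius \<open>r\<close>; \<open>Line z d\<close> passes through \<open>z\<close> with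
  direction \<open>d\<close>, and through infinity.\<close>

datatype gcircle = Circle complex real | Line complex complex

fun proper_gcircle :: "gcircle \<Rightarrow> bool" where
  "proper_gcircle (Circle c r) \<longleftrightarrow> r > 0"
| "proper_gcircle (Line z d) \<longleftrightarrow> d \<noteq> 0"

fun gcircle_points :: "gcircle \<Rightarrow> riemann_sphere set" where
  "gcircle_points (Circle c r) = Finite ` sphere c r"
| "gcircle_points (Line z d) = insert Infty {Finite (z + of_real t * d) | t. True}"

fun tangent_direction :: "gcircle \<Rightarrow> complex \<Rightarrow> complex" where
  "tangent_direction (Circle c r) z = \<i> * (z - c)"
| "tangent_direction (Line z0 d) z = d"

text \<open>Two orthogonal generalized circles always meet at a finite point, so intersections at
  infinity need not be considered.\<close>

definition orthogonal_gcircles :: "gcircle \<Rightarrow> gcircle \<Rightarrow> bool" where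
  "orthogonal_gcircles C D \<longleftrightarrow>
     (\<exists>z. Finite z \<in> gcircle_points C \<inter> gcircle_points D) \<and>
     (\<forall>z. Finite z \<in> gcircle_points C \<inter> gcircle_points D \<longrightarrow>
        inner (tangent_direction C z) (tangent_direction D z) = 0)"


section \<open>Square grid circle patterns\<close>

definition circles_of_pattern :: "(int \<times> int \<Rightarrow> riemann_sphere) \<Rightarrow> (int \<times> int \<Rightarrow> gcircle) \<Rightarrow> bool" where
  "circles_of_pattern p c \<longleftrightarrow>
     (\<forall>i j. proper_gcircle (c (i, j)) \<and>
            {p (i, j), p (i + 1, j), p (i + 1, j + 1), p (i, j + 1)} \<subseteq> gcircle_points (c (i, j)))"

definition circle_pattern :: "(int \<times> int \<Rightarrow> riemann_sphere) \<Rightarrow> bool" where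
  "circle_pattern p \<longleftrightarrow> (\<exists>c. circles_of_pattern p c)"

definition orthogonal_circle_pattern :: "(int \<times> int \<Rightarrow> riemann_sphere) \<Rightarrow> bool" where
  "orthogonal_circle_pattern p \<longleftrightarrow>
     (\<exists>c. circles_of_pattern p c \<and>
          (\<forall>i j. orthogonal_gcircles (c (i, j)) (c (i + 1, j)) \<and>
                 orthogonal_gcircles (c (i, j)) (c (i, j + 1))))"

text \<open>Genericity of a pattern. Without it, a pattern may be folded back onto itself along a row
  (\<open>p (i, n + 1) = p (i, n)\<close> for all \<open>i\<close>) and is then no longer determined by two
  consecutive rows.\<close>

definition nondegenerate_pattern :: "(int \<times> int \<Rightarrow> riemann_sphere) \<Rightarrow> bool" where
  "nondegenerate_pattern p \<longleftrightarrow> (\<forall>i j. p (i, j) \<noteq> p (i + 1, j) \<and> p (i, j) \<noteq> p (i, j + 1))"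


section \<open>Aztec diamonds\<close>

text \<open>The face \<open>(i, j)\<close> is the unit square centred at the point \<open>(i, j)\<close> of the plane. The
  vertex \<open>(m, n)\<close> is the point \<open>(m - 1/2, n - 1/2)\<close> of the plane, so that it is the
  bottom left corner of the face with the same indices.\<close>

type_synonym face = "int \<times> int"
type_synonym vertex = "int \<times> int"
type_synonym dedge = "vertex \<times> vertex"

fun face_vertices :: "face \<Rightarrow> vertex set" where
  "face_vertices (i, j) = {(i, j), (i + 1, j), (i + 1, j + 1), (i, j + 1)}"

fun face_edges :: "face \<Rightarrow> vertex set set" where
  "face_edges (i, j) =
     {{(i, j), (i + 1, j)}, {(i + 1, j), (i + 1, j + 1)},
      {(i + 1, j + 1), (i, j + 1)}, {(i, j + 1), (i, j)}}"

fun face_dist :: "face \<Rightarrow> face \<Rightarrow> int" where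
  "face_dist (i, j) (i', j') = \<bar>i' - i\<bar> + \<bar>j' - j\<bar>"

definition internal_faces :: "nat \<Rightarrow> face \<Rightarrow> face set" where
  "internal_faces k c = {f. face_dist c f < int k}"

definition open_faces :: "nat \<Rightarrow> face \<Rightarrow> face set" where
  "open_faces k c = {f. face_dist c f = int k}"

definition aztec_faces :: "nat \<Rightarrow> face \<Rightarrow> face set" where
  "aztec_faces k c = internal_faces k c \<union> open_faces k c"

definition aztec_vertices :: "nat \<Rightarrow> face \<Rightarrow> vertex set" where
  "aztec_vertices k c = (\<Union>f\<in>internal_faces k c. face_vertices f)"

definition aztec_edges :: "nat \<Rightarrow> face \<Rightarrow> vertex set set" where
  "aztec_edges k c = (\<Union>f\<in>internal_faces k c. face_edges f)"

definition undirected :: "dedge \<Rightarrow> vertex set" where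
  "undirected e = {fst e, snd e}"

definition aztec_dedges :: "nat \<Rightarrow> face \<Rightarrow> dedge set" where
  "aztec_dedges k c = {e. undirected e \<in> aztec_edges k c}"

text \<open>The face to the right of a directed edge between neighbouring vertices; the four cases
  are the directions east, west, north and (otherwise) south.\<close>

fun right_face :: "dedge \<Rightarrow> face" where
  "right_face ((m, n), v) =
     (if v = (m + 1, n) then (m, n - 1)
      else if v = (m - 1, n) then (m - 1, n)
      else if v = (m, n + 1) then (m, n)
      else (m - 1, n - 1))"

fun white :: "vertex \<Rightarrow> bool" where
  "white (m, n) \<longleftrightarrow> even (m + n)"


section \<open>Oriented dimers and the ratio function\<close>

definition kasteleyn_orientation :: "nat \<Rightarrow> face \<Rightarrow> (dedge \<Rightarrow> int) \<Rightarrow> bool" where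
  "kasteleyn_orientation k c \<phi> \<longleftrightarrow>
     (\<forall>u v. (u, v) \<in> aztec_dedges k c \<longrightarrow> \<phi> (u, v) \<in> {-1, 1} \<and> \<phi> (v, u) = - \<phi> (u, v)) \<and>
     (\<forall>f\<in>internal_faces k c. (\<Prod>e | undirected e \<in> face_edges f \<and> white (fst e). \<phi> e) = -1)"

definition perfect_matching :: "nat \<Rightarrow> face \<Rightarrow> vertex set set \<Rightarrow> bool" where
  "perfect_matching k c N \<longleftrightarrow>
     N \<subseteq> aztec_edges k c \<and> (\<forall>v\<in>aztec_vertices k c. \<exists>!e. e \<in> N \<and> v \<in> e)"

definition oriented_dimer :: "nat \<Rightarrow> face \<Rightarrow> dedge set \<Rightarrow> bool" where
  "oriented_dimer k c M \<longleftrightarrow>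
     M \<subseteq> aztec_dedges k c \<and> perfect_matching k c (undirected ` M) \<and> inj_on undirected M"

definition partition_function ::
    "nat \<Rightarrow> face \<Rightarrow> (dedge \<Rightarrow> int) \<Rightarrow> (face \<Rightarrow> complex) \<Rightarrow> complex" where
  "partition_function k c \<phi> b =
     (\<Sum>M | oriented_dimer k c M. \<Prod>e\<in>M. of_int (\<phi> e) * b (right_face e))"

definition ratio_formula ::
    "nat \<Rightarrow> face \<Rightarrow> (dedge \<Rightarrow> int) \<Rightarrow> (face \<Rightarrow> complex) \<Rightarrow> complex" where
  "ratio_formula k c \<phi> b =
     (\<Prod>f\<in>aztec_faces k c. b f) *
     (partition_function k c \<phi> (\<lambda>f. inverse (b f)) / partition_function k c \<phi> b)"

definition formula_domain :: "nat \<Rightarrow> face \<Rightarrow> (dedge \<Rightarrow> int) \<Rightarrow> (face \<Rightarrow> complex) set" where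
  "formula_domain k c \<phi> =
     {b. (\<forall>f\<in>aztec_faces k c. b f \<noteq> 0) \<and> partition_function k c \<phi> b \<noteq> 0}"

text \<open>A polynomial in variables indexed by a finite set \<open>F\<close>, of degree at most \<open>d f\<close> in the
  variable of \<open>f\<close>, is given by its coefficients \<open>\<alpha> m\<close>, where \<open>m\<close> ranges over the exponent
  vectors. It is evaluated here as a multihomogeneous polynomial in the homogeneous
  coordinates of its arguments; at finite arguments this is ordinary evaluation.\<close>

definition multihom_eval ::
    "'f set \<Rightarrow> ('f \<Rightarrow> nat) \<Rightarrow> (('f \<Rightarrow> nat) \<Rightarrow> complex) \<Rightarrow> ('f \<Rightarrow> riemann_sphere) \<Rightarrow> complex" where
  "multihom_eval F d \<alpha> x =
     (\<Sum>m\<in>(\<Pi>\<^sub>E f\<in>F. {..d f}). \<alpha> m *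
        (\<Prod>f\<in>F. fst (hcoords (x f)) ^ m f * snd (hcoords (x f)) ^ (d f - m f)))"

text \<open>The rational function given by the formula \<open>R\<close> on the domain \<open>D\<close> is regular at the
  point \<open>x\<close> of the product of projective lines, with value \<open>w\<close>: some way of writing it as a
  fraction of polynomials of the same multidegree is not \<open>0/0\<close> at \<open>x\<close>, and equals \<open>w\<close>
  there. As for any rational function, the value at a regular point does not depend on the
  fraction when \<open>D\<close> is Zariski dense.\<close>

definition rational_value ::
    "'f set \<Rightarrow> ('f \<Rightarrow> complex) set \<Rightarrow> (('f \<Rightarrow> complex) \<Rightarrow> complex) \<Rightarrow>
     ('f \<Rightarrow> riemann_sphere) \<Rightarrow> riemann_sphere \<Rightarrow> bool" where
  "rational_value F D R x w \<longleftrightarrow>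
     (\<exists>d \<alpha> \<beta>.
        (\<forall>b\<in>D. multihom_eval F d \<beta> (Finite \<circ> b) * R b = multihom_eval F d \<alpha> (Finite \<circ> b)) \<and>
        (multihom_eval F d \<alpha> x, multihom_eval F d \<beta> x) \<noteq> (0, 0) \<and>
        w = from_hcoords (multihom_eval F d \<alpha> x, multihom_eval F d \<beta> x))"

text \<open>The formula for \<open>Y\<close> is used as the definition of a rational function, which is then
  evaluated at weights in the Riemann sphere. Evaluating the formula literally would not do: for
  instance, a sum over dimers with an infinite weight has several infinite terms.\<close>

definition ratio_function ::
    "nat \<Rightarrow> face \<Rightarrow> (dedge \<Rightarrow> int) \<Rightarrow> (face \<Rightarrow> riemann_sphere) \<Rightarrow> riemann_sphere" where
  "ratio_function k c \<phi> a =
     (if k = 0 then a c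
      else (THE w. rational_value (aztec_faces k c) (formula_domain k c \<phi>) (ratio_formula k c \<phi>) a w))"

end

theory Submission
  imports Defs
begin

text \<open>Summing over the orientations of a fixed perfect matching turns \<open>Z\<close> into a signed dimer
  partition function with edge weights \<open>b f - b g\<close>. Urban renewal at every other face of the Aztec diamond of size \<open>n + 1\<close> produces the diamond of size \<open>n\<close>, where, after a
  gauge transformation, the edge weights are again differences of face weights: those at the renewed
  faces have been replaced by the solution of the dSKP equation. The extra factors cancel in the
  ratio, so \<open>Y\<close> of size \<open>n + 1\<close> is \<open>Y\<close> of size \<open>n\<close> composed with this update.

  Sending a point of an orthogonal circle pattern to infinity turns the four circles through it into
  the sides of a rectangle whose vertices are the four neighbours. Equality of the midpoints of the
  diagonals is the dSKP equation in which one opposite pair is equal to the point, so one update moves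
  the initial data one row up. For nondegenerate patterns the update is regular at the pattern, and
  a composition of regular rational maps is regular.\<close>


section \<open>Multihomogeneous polynomials\<close>

text \<open>At the pattern, the formula for \<open>Y\<close> can be meaningless: weights may be
  infinite, and numerator and denominator may vanish together. So two facts about the rational
  function are needed: some fraction representing it is not 0/0 at the pattern (existence of the
  value), and all such fractions agree there (uniqueness). Both are proved with polynomials in
  homogeneous coordinates, for which infinity is an ordinary point and a change of representative
  only multiplies numerator and denominator by a common factor.

  Urban renewal divides by gauge factors and by dSKP denominators, so it gives the recursion only
  off their zero sets, whereas a fraction must be valid on all of \<open>formula_domain\<close>.
  Continuity along lines closes this gap. Density and the choice of these lines both rest on one
  explicit point where nothing vanishes: weights affine in the position, which dSKP leaves fixed.

  The Kasteleyn condition enters through a sign only: it makes the two terms in the dimer sum of a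
  four-cycle combine into the dSKP denominator.\<close>

definition monomial_at ::
    "'f set \<Rightarrow> ('f \<Rightarrow> nat) \<Rightarrow> ('f \<Rightarrow> nat) \<Rightarrow> ('f \<Rightarrow> complex \<times> complex) \<Rightarrow> complex" where
  "monomial_at F d m u = (\<Prod>f\<in>F. fst (u f) ^ m f * snd (u f) ^ (d f - m f))"

text \<open>Hiding the coefficients lets closure properties be stated for functions. Each monomial
  has exact degree \<open>d f\<close> in the pair \<open>u f\<close>, and \<open>u f\<close> may be
  any pair, including \<open>(0, 0)\<close>.\<close>

definition multihom ::
    "'f set \<Rightarrow> ('f \<Rightarrow> nat) \<Rightarrow> (('f \<Rightarrow> complex \<times> complex) \<Rightarrow> complex) \<Rightarrow> bool" where
  "multihom F d g \<longleftrightarrow> (\<exists>\<alpha>. \<forall>u. g u = (\<Sum>m\<in>(\<Pi>\<^sub>E f\<in>F. {..d f}). \<alpha> m * monomial_at F d m u))"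

lemma multihomE:
  assumes "multihom F d g"
  obtains \<alpha> where "\<And>u. g u = (\<Sum>m\<in>(\<Pi>\<^sub>E f\<in>F. {..d f}). \<alpha> m * monomial_at F d m u)"
  using assms unfolding multihom_def by blast

lemma multihom_eval_conv:
  "multihom_eval F d \<alpha> x = (\<Sum>m\<in>(\<Pi>\<^sub>E f\<in>F. {..d f}). \<alpha> m * monomial_at F d m (hcoords \<circ> x))"
  by (simp add: multihom_eval_def monomial_at_def)

lemma multihom_multihom_eval:
  obtains g where "multihom F d g" "\<And>x. multihom_eval F d \<alpha> x = g (hcoords \<circ> x)"
  by (rule that [of "\<lambda>u. (\<Sum>m\<in>(\<Pi>\<^sub>E f\<in>F. {..d f}). \<alpha> m * monomial_at F d m u)"])
     (auto simp: multihom_def multihom_eval_conv)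

lemma multihom_eval_of_multihom:
  assumes "multihom F d g"
  obtains \<alpha> where "\<And>x. multihom_eval F d \<alpha> x = g (hcoords \<circ> x)"
proof -
  obtain \<alpha> where "\<And>u. g u = (\<Sum>m\<in>(\<Pi>\<^sub>E f\<in>F. {..d f}). \<alpha> m * monomial_at F d m u)"
    using multihomE [OF assms] by blast
  then show ?thesis by (intro that [of \<alpha>]) (simp add: multihom_eval_conv)
qed

section \<open>Closure under sums, products and substitution\<close>

lemma finite_exponents: "finite F \<Longrightarrow> finite (\<Pi>\<^sub>E f\<in>F. {..d f :: nat})"
  by (rule finite_PiE) auto

lemma multihom_monomial:
  assumes "finite F" "m \<in> (\<Pi>\<^sub>E f\<in>F. {..d f})"
  shows "multihom F d (monomial_at F d m)"
proof -
  have "monomial_at F d m u = (\<Sum>m'\<in>(\<Pi>\<^sub>E f\<in>F. {..d f}). (if m' = m then 1 else 0) * monomial_at F d m' u)" for u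
  proof -
    have "(\<Sum>m'\<in>(\<Pi>\<^sub>E f\<in>F. {..d f}). (if m' = m then 1 else 0) * monomial_at F d m' u) =
        (\<Sum>m'\<in>(\<Pi>\<^sub>E f\<in>F. {..d f}). if m' = m then monomial_at F d m' u else 0)"
      by (intro sum.cong) auto
    also have "\<dots> = monomial_at F d m u"
      by (subst sum.delta [OF finite_exponents [OF assms(1)]]) (simp only: assms(2) if_True)
    finally show ?thesis by simp
  qed
  then show ?thesis
    unfolding multihom_def by (intro exI [of _ "\<lambda>m'. if m' = m then 1 else 0"] allI)
qed

lemma multihom_add:
  assumes "multihom F d g" "multihom F d h"
  shows "multihom F d (\<lambda>u. g u + h u)"
proof -
  obtain \<alpha> where g': "\<And>u. g u = (\<Sum>m\<in>(\<Pi>\<^sub>E f\<in>F. {..d f}). \<alpha> m * monomial_at F d m u)"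
    using multihomE [OF assms(1)] by blast
  obtain \<beta> where h': "\<And>u. h u = (\<Sum>m\<in>(\<Pi>\<^sub>E f\<in>F. {..d f}). \<beta> m * monomial_at F d m u)"
    using multihomE [OF assms(2)] by blast
  show ?thesis
    unfolding multihom_def
    by (intro exI [of _ "\<lambda>m. \<alpha> m + \<beta> m"]) (simp add: g' h' sum.distrib distrib_right)
qed

lemma multihom_scale:
  assumes "multihom F d g"
  shows "multihom F d (\<lambda>u. k * g u)"
proof -
  obtain \<alpha> where g': "\<And>u. g u = (\<Sum>m\<in>(\<Pi>\<^sub>E f\<in>F. {..d f}). \<alpha> m * monomial_at F d m u)"
    using multihomE [OF assms] by blast
  show ?thesis
    unfolding multihom_def
    by (intro exI [of _ "\<lambda>m. k * \<alpha> m"]) (simp add: g' sum_distrib_left mult.assoc)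
qed

lemma multihom_diff:
  assumes "multihom F d g" "multihom F d h"
  shows "multihom F d (\<lambda>u. g u - h u)"
  using multihom_add [OF assms(1) multihom_scale [OF assms(2), of "-1"]] by simp

lemma multihom_zero: "multihom F d (\<lambda>u. 0)"
  unfolding multihom_def by (rule exI [of _ "\<lambda>_. 0"]) simp

lemma multihom_sum:
  assumes "\<And>i. i \<in> I \<Longrightarrow> multihom F d (g i)"
  shows "multihom F d (\<lambda>u. \<Sum>i\<in>I. g i u)"
  using assms
proof (induction I rule: infinite_finite_induct)
  case (insert i I)
  then show ?case using multihom_add [of F d "g i" "\<lambda>u. \<Sum>i\<in>I. g i u"] by simp
qed (auto simp: multihom_zero)

lemma multihom_mult:
  assumes F: "finite F" and g: "multihom F d g" and h: "multihom F e h"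
  shows "multihom F (\<lambda>f. d f + e f) (\<lambda>u. g u * h u)"
proof -
  obtain \<alpha> where g': "\<And>u. g u = (\<Sum>m\<in>(\<Pi>\<^sub>E f\<in>F. {..d f}). \<alpha> m * monomial_at F d m u)"
    using multihomE [OF g] by blast
  obtain \<beta> where h': "\<And>u. h u = (\<Sum>m\<in>(\<Pi>\<^sub>E f\<in>F. {..e f}). \<beta> m * monomial_at F e m u)"
    using multihomE [OF h] by blast
  have mono: "monomial_at F d m u * monomial_at F e m' u =
      monomial_at F (\<lambda>f. d f + e f) (\<lambda>f\<in>F. m f + m' f) u"
    if "m \<in> (\<Pi>\<^sub>E f\<in>F. {..d f})" "m' \<in> (\<Pi>\<^sub>E f\<in>F. {..e f})" for m m' u
    unfolding monomial_at_def prod.distrib [symmetric]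
  proof (rule prod.cong)
    fix f assume "f \<in> F"
    with that have "m f \<le> d f" "m' f \<le> e f" by auto
    then have "d f + e f - (m f + m' f) = (d f - m f) + (e f - m' f)" by simp
    with \<open>f \<in> F\<close> show "fst (u f) ^ m f * snd (u f) ^ (d f - m f) *
        (fst (u f) ^ m' f * snd (u f) ^ (e f - m' f)) =
      fst (u f) ^ (\<lambda>f\<in>F. m f + m' f) f * snd (u f) ^ (d f + e f - (\<lambda>f\<in>F. m f + m' f) f)"
      by (simp add: power_add mult_ac)
  qed simp
  have "(\<lambda>u. g u * h u) = (\<lambda>u. \<Sum>m\<in>(\<Pi>\<^sub>E f\<in>F. {..d f}). \<Sum>m'\<in>(\<Pi>\<^sub>E f\<in>F. {..e f}).
      (\<alpha> m * \<beta> m') * monomial_at F (\<lambda>f. d f + e f) (\<lambda>f\<in>F. m f + m' f) u)"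
    unfolding g' h' sum_product
    by (intro ext sum.cong refl) (simp add: mono [symmetric] mult_ac)
  moreover have "multihom F (\<lambda>f. d f + e f) \<dots>"
    by (intro multihom_sum multihom_scale multihom_monomial F)
       (fastforce simp: PiE_iff intro: add_mono)
  ultimately show ?thesis by simp
qed

lemma multihom_const:
  assumes "finite F"
  shows "multihom F (\<lambda>_. 0) (\<lambda>_. k)"
proof -
  have "multihom F (\<lambda>_. 0) (\<lambda>u. k * monomial_at F (\<lambda>_. 0) (\<lambda>f\<in>F. 0) u)"
    by (intro multihom_scale multihom_monomial assms) auto
  then show ?thesis by (simp add: monomial_at_def)
qed

lemma multihom_power:
  assumes "finite F" "multihom F d g"
  shows "multihom F (\<lambda>f. n * d f) (\<lambda>u. g u ^ n)"
proof (induction n)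
  case 0
  then show ?case using multihom_const [OF assms(1), of 1] by simp
next
  case (Suc n)
  from multihom_mult [OF assms(1) assms(2) this] show ?case by simp
qed

lemma multihom_prod:
  assumes "finite F" "\<And>i. i \<in> I \<Longrightarrow> multihom F (d i) (g i)"
  shows "multihom F (\<lambda>f. \<Sum>i\<in>I. d i f) (\<lambda>u. \<Prod>i\<in>I. g i u)"
  using assms(2)
proof (induction I rule: infinite_finite_induct)
  case (insert i I)
  then show ?case
    using multihom_mult [OF assms(1), of "d i" "g i" "\<lambda>f. \<Sum>i\<in>I. d i f" "\<lambda>u. \<Prod>i\<in>I. g i u"] by simp
qed (auto simp: multihom_const assms(1))

lemma multihom_fst:
  assumes "finite F" "f \<in> F"
  shows "multihom F (\<lambda>f'. of_bool (f' = f)) (\<lambda>u. fst (u f))"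
proof -
  have "multihom F (\<lambda>f'. of_bool (f' = f)) (monomial_at F (\<lambda>f'. of_bool (f' = f)) (\<lambda>f'\<in>F. of_bool (f' = f)))"
    by (intro multihom_monomial assms) auto
  also have "monomial_at F (\<lambda>f'. of_bool (f' = f)) (\<lambda>f'\<in>F. of_bool (f' = f)) =
      (\<lambda>u. \<Prod>f'\<in>F. if f' = f then fst (u f') else 1)"
    unfolding monomial_at_def by (intro ext prod.cong) auto
  finally show ?thesis using assms by (simp add: prod.delta)
qed

lemma multihom_snd:
  assumes "finite F" "f \<in> F"
  shows "multihom F (\<lambda>f'. of_bool (f' = f)) (\<lambda>u. snd (u f))"
proof -
  have "multihom F (\<lambda>f'. of_bool (f' = f)) (monomial_at F (\<lambda>f'. of_bool (f' = f)) (\<lambda>f'\<in>F. 0))"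
    by (intro multihom_monomial assms) auto
  also have "monomial_at F (\<lambda>f'. of_bool (f' = f)) (\<lambda>f'\<in>F. 0) =
      (\<lambda>u. \<Prod>f'\<in>F. if f' = f then snd (u f') else 1)"
    unfolding monomial_at_def by (intro ext prod.cong) auto
  finally show ?thesis using assms by (simp add: prod.delta)
qed

text \<open>The two coordinates substituted at \<open>f\<close> share the multidegree
  \<open>e f\<close>, so a monomial of degree \<open>d f\<close> in that pair acquires
  \<open>d f * e f\<close>, however its exponents are split between them.\<close>

lemma multihom_compose:
  assumes F: "finite F" and g: "multihom F' d g"
    and h: "\<And>f. f \<in> F' \<Longrightarrow> multihom F (e f) (\<lambda>u. fst (h u f))"
      "\<And>f. f \<in> F' \<Longrightarrow> multihom F (e f) (\<lambda>u. snd (h u f))"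
  shows "multihom F (\<lambda>x. \<Sum>f\<in>F'. d f * e f x) (\<lambda>u. g (h u))"
proof -
  obtain \<alpha> where
    g': "\<And>u. g u = (\<Sum>m\<in>(\<Pi>\<^sub>E f\<in>F'. {..d f}). \<alpha> m * monomial_at F' d m u)"
    using multihomE [OF g] by blast
  have "multihom F (\<lambda>x. \<Sum>f\<in>F'. d f * e f x) (\<lambda>u. monomial_at F' d m (h u))"
    if m: "m \<in> (\<Pi>\<^sub>E f\<in>F'. {..d f})" for m
    unfolding monomial_at_def
  proof (rule multihom_prod [OF F])
    fix f assume f: "f \<in> F'"
    with m have "m f \<le> d f" by auto
    then have "(\<lambda>x. d f * e f x) = (\<lambda>x. m f * e f x + (d f - m f) * e f x)"
      by (simp add: fun_eq_iff add_mult_distrib [symmetric])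
    then show "multihom F (\<lambda>x. d f * e f x) (\<lambda>u. fst (h u f) ^ m f * snd (h u f) ^ (d f - m f))"
      by (simp add: multihom_mult multihom_power F h f)
  qed
  then show ?thesis
    unfolding g' by (intro multihom_sum multihom_scale)
qed

text \<open>The factor depends on \<open>d\<close> but not on \<open>g\<close>. Rescaling by nonzero
  factors therefore changes a pair of polynomials of the same multidegree only projectively.\<close>

lemma multihom_scale_args:
  assumes "multihom F d g"
    and "\<And>f. f \<in> F \<Longrightarrow> fst (u f) = k f * fst (v f)" "\<And>f. f \<in> F \<Longrightarrow> snd (u f) = k f * snd (v f)"
  shows "g u = (\<Prod>f\<in>F. k f ^ d f) * g v"
proof -
  obtain \<alpha> where
    g': "\<And>u. g u = (\<Sum>m\<in>(\<Pi>\<^sub>E f\<in>F. {..d f}). \<alpha> m * monomial_at F d m u)"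
    using multihomE [OF assms(1)] by blast
  have "monomial_at F d m u = (\<Prod>f\<in>F. k f ^ d f) * monomial_at F d m v"
    if "m \<in> (\<Pi>\<^sub>E f\<in>F. {..d f})" for m
    unfolding monomial_at_def prod.distrib [symmetric]
  proof (rule prod.cong)
    fix f assume f: "f \<in> F"
    with that have "m f \<le> d f" by auto
    then have "k f ^ d f = k f ^ m f * k f ^ (d f - m f)" by (simp flip: power_add)
    then show "fst (u f) ^ m f * snd (u f) ^ (d f - m f) =
        k f ^ d f * (fst (v f) ^ m f * snd (v f) ^ (d f - m f))"
      by (simp add: assms f power_mult_distrib mult_ac)
  qed simp
  then show ?thesis
    unfolding g' by (simp add: sum_distrib_left mult_ac)
qed

lemma multihom_continuous:
  assumes "multihom F d g"
    and "\<And>f. f \<in> F \<Longrightarrow> ((\<lambda>t. fst (u t f)) \<longlongrightarrow> fst (v f)) G"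
      "\<And>f. f \<in> F \<Longrightarrow> ((\<lambda>t. snd (u t f)) \<longlongrightarrow> snd (v f)) G"
  shows "((\<lambda>t. g (u t)) \<longlongrightarrow> g v) G"
proof -
  obtain \<alpha> where
    g': "\<And>u. g u = (\<Sum>m\<in>(\<Pi>\<^sub>E f\<in>F. {..d f}). \<alpha> m * monomial_at F d m u)"
    using multihomE [OF assms(1)] by blast
  show ?thesis
    unfolding g' monomial_at_def by (intro tendsto_intros assms)
qed

section \<open>Restriction to lines and Zariski density\<close>

lemma multihom_along_line:
  assumes "multihom F d g"
  obtains P where "\<And>t. poly P t = g (\<lambda>f. (fst (u f) + t * fst (v f), snd (u f) + t * snd (v f)))"
proof -
  obtain \<alpha> where
    g': "\<And>u. g u = (\<Sum>m\<in>(\<Pi>\<^sub>E f\<in>F. {..d f}). \<alpha> m * monomial_at F d m u)"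
    using multihomE [OF assms] by blast
  let ?P = "\<Sum>m\<in>(\<Pi>\<^sub>E f\<in>F. {..d f}). smult (\<alpha> m)
    (\<Prod>f\<in>F. [:fst (u f), fst (v f):] ^ m f * [:snd (u f), snd (v f):] ^ (d f - m f))"
  show ?thesis
    by (rule that [of ?P]) (simp add: g' monomial_at_def poly_sum poly_prod)
qed

text \<open>The roots are bounded while \<open>1 / s\<close> tends to infinity. The parameter
  \<open>1 / s\<close> is used because the far end of a line is what corresponds to small
  \<open>s\<close> in the arguments below.\<close>

lemma eventually_poly_inverse_nonzero:
  fixes P :: "complex poly"
  assumes "P \<noteq> 0"
  shows "\<forall>\<^sub>F s in at 0. poly P (1 / s) \<noteq> 0"
proof -
  from assms have "finite {t. poly P t = 0}" by (rule poly_roots_finite)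
  from finite_imp_bounded [OF this] obtain B where B: "\<And>t. poly P t = 0 \<Longrightarrow> norm t \<le> B"
    unfolding bounded_iff by blast
  have "filterlim (\<lambda>s. 1 / s :: complex) at_infinity (at 0)"
    using filterlim_inverse_at_infinity by (simp add: inverse_eq_divide [symmetric])
  then have "\<forall>\<^sub>F s :: complex in at 0. \<bar>B\<bar> + 1 \<le> norm (1 / s)"
    unfolding filterlim_at_infinity [OF order_refl] by simp
  then show ?thesis
  proof eventually_elim
    case (elim s)
    show ?case using B [of "1 / s"] elim by auto
  qed
qed

lemma poly_eventually_zero_imp_zero:
  fixes P :: "complex poly"
  assumes "\<forall>\<^sub>F s in at 0. poly P (1 / s) = 0"
  shows "P = 0"
proof (rule ccontr)
  assume "P \<noteq> 0"
  then have "\<forall>\<^sub>F s :: complex in at 0. poly P (1 / s) \<noteq> 0" by (rule eventually_poly_inverse_nonzero)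
  with assms have "\<forall>\<^sub>F s :: complex in at 0. False" by eventually_elim simp
  then show False by simp
qed

text \<open>The hypothesis \<open>nhd\<close> says that \<open>D\<close> contains a neighbourhood of
  \<open>b0\<close>, seen through convergent families. On the line from \<open>v\<close> in the
  direction \<open>(b0, 1)\<close>, points far out are projectively close to \<open>b0\<close>, so
  \<open>q\<close> vanishes there. Its restriction to the line is a polynomial, hence zero, and at
  parameter 0 it takes the value \<open>q v\<close>.\<close>

lemma multihom_vanishing:
  assumes F: "finite F" and q: "multihom F d q"
    and zero: "\<And>b. b \<in> D \<Longrightarrow> q (\<lambda>f. (b f, 1)) = 0"
    and nhd: "\<And>c :: complex \<Rightarrow> 'f \<Rightarrow> complex. (\<And>f. f \<in> F \<Longrightarrow> ((\<lambda>s. c s f) \<longlongrightarrow> b0 f) (at 0)) \<Longrightarrow>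
      \<forall>\<^sub>F s in at 0. c s \<in> D"
  shows "q v = 0"
proof -
  obtain P where P: "\<And>t. poly P t = q (\<lambda>f. (fst (v f) + t * b0 f, snd (v f) + t * 1))"
    using multihom_along_line [OF q, of v "\<lambda>f. (b0 f, 1)"] by auto
  \<comment> \<open>Affine coordinate of the point of the line at parameter \<open>1 / s\<close>,
    after multiplying both homogeneous coordinates by \<open>s\<close>.\<close>
  define c where "c s f = (s * fst (v f) + b0 f) / (s * snd (v f) + 1)" for s f
  have "((\<lambda>s. c s f) \<longlongrightarrow> (0 * fst (v f) + b0 f) / (0 * snd (v f) + 1)) (at 0)" for f
    unfolding c_def by (intro tendsto_intros) simp
  then have "\<forall>\<^sub>F s in at 0. c s \<in> D" by (intro nhd) simp
  moreover have "\<forall>\<^sub>F s in at 0. \<forall>f\<in>F. s * snd (v f) + 1 \<noteq> 0"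
  proof (subst eventually_ball_finite_distrib [OF F], safe)
    fix f
    have "((\<lambda>s. s * snd (v f) + 1) \<longlongrightarrow> 0 * snd (v f) + 1) (at 0)" by (intro tendsto_intros)
    then show "\<forall>\<^sub>F s in at 0. s * snd (v f) + 1 \<noteq> 0"
      by (rule tendsto_imp_eventually_ne) simp
  qed
  moreover have "\<forall>\<^sub>F s :: complex in at 0. s \<noteq> 0" by (simp add: eventually_at_filter)
  ultimately have "\<forall>\<^sub>F s in at 0. poly P (1 / s) = 0"
  proof eventually_elim
    case (elim s)
    have "fst (v f) + 1 / s * b0 f = (snd (v f) + 1 / s) * c s f" if "f \<in> F" for f
    proof -
      have "snd (v f) + 1 / s = (s * snd (v f) + 1) / s" "fst (v f) + 1 / s * b0 f = (s * fst (v f) + b0 f) / s"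
        using elim(3) by (simp_all add: field_simps)
      then show ?thesis using elim(2) that by (simp add: c_def)
    qed
    then have "poly P (1 / s) = (\<Prod>f\<in>F. (snd (v f) + 1 / s) ^ d f) * q (\<lambda>f. (c s f, 1))"
      unfolding P by (intro multihom_scale_args [OF q]) auto
    with zero elim(1) show ?case by simp
  qed
  then have "P = 0" by (rule poly_eventually_zero_imp_zero)
  with P [of 0] show ?thesis by simp
qed

section \<open>Uniqueness of the value of a rational function\<close>

lemma from_hcoords_eqI:
  assumes "u \<noteq> (0, 0)" "v \<noteq> (0, 0)" "fst u * snd v = snd u * fst v"
  shows "from_hcoords u = from_hcoords v"
  using assms by (cases u; cases v) (auto simp: from_hcoords_def frac_eq_eq)

lemma from_hcoords_scale:
  "k \<noteq> 0 \<Longrightarrow> from_hcoords (k * x, k * y) = from_hcoords (x, y)"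
  by (simp add: from_hcoords_def)

lemma from_hcoords_hcoords [simp]: "from_hcoords (hcoords x) = x"
  by (cases x) (auto simp: from_hcoords_def)

lemma hcoords_nonzero: "hcoords x \<noteq> (0, 0)"
  by (cases x) auto

text \<open>Cross-multiplication: \<open>A * B' - B * A'\<close> vanishes on \<open>D\<close>, where
  both fractions represent \<open>R\<close>, and hence everywhere. At \<open>x\<close> this says
  that two nonzero pairs are proportional.\<close>

lemma rational_value_unique:
  assumes F: "finite F"
    and nhd: "\<And>c :: complex \<Rightarrow> 'f \<Rightarrow> complex. (\<And>f. f \<in> F \<Longrightarrow> ((\<lambda>s. c s f) \<longlongrightarrow> b0 f) (at 0)) \<Longrightarrow>
      \<forall>\<^sub>F s in at 0. c s \<in> D"
    and w: "rational_value F D R x w" and w': "rational_value F D R x w'"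
  shows "w = w'"
proof -
  from w obtain d \<alpha> \<beta> where
    eq: "\<And>b. b \<in> D \<Longrightarrow> multihom_eval F d \<beta> (Finite \<circ> b) * R b = multihom_eval F d \<alpha> (Finite \<circ> b)" and
    nz: "(multihom_eval F d \<alpha> x, multihom_eval F d \<beta> x) \<noteq> (0, 0)" and
    wv: "w = from_hcoords (multihom_eval F d \<alpha> x, multihom_eval F d \<beta> x)"
    unfolding rational_value_def by blast
  from w' obtain d' \<alpha>' \<beta>' where
    eq': "\<And>b. b \<in> D \<Longrightarrow> multihom_eval F d' \<beta>' (Finite \<circ> b) * R b = multihom_eval F d' \<alpha>' (Finite \<circ> b)" and
    nz': "(multihom_eval F d' \<alpha>' x, multihom_eval F d' \<beta>' x) \<noteq> (0, 0)" and
    wv': "w' = from_hcoords (multihom_eval F d' \<alpha>' x, multihom_eval F d' \<beta>' x)"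
    unfolding rational_value_def by blast
  obtain A where A: "multihom F d A" "\<And>x. multihom_eval F d \<alpha> x = A (hcoords \<circ> x)"
    using multihom_multihom_eval [of F d \<alpha>] by blast
  obtain B where B: "multihom F d B" "\<And>x. multihom_eval F d \<beta> x = B (hcoords \<circ> x)"
    using multihom_multihom_eval [of F d \<beta>] by blast
  obtain A' where A': "multihom F d' A'" "\<And>x. multihom_eval F d' \<alpha>' x = A' (hcoords \<circ> x)"
    using multihom_multihom_eval [of F d' \<alpha>'] by blast
  obtain B' where B': "multihom F d' B'" "\<And>x. multihom_eval F d' \<beta>' x = B' (hcoords \<circ> x)"
    using multihom_multihom_eval [of F d' \<beta>'] by blast
  have "A (hcoords \<circ> x) * B' (hcoords \<circ> x) - B (hcoords \<circ> x) * A' (hcoords \<circ> x) = 0"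
  proof (rule multihom_vanishing [OF F _ _ nhd])
    show "multihom F (\<lambda>f. d f + d' f) (\<lambda>u. A u * B' u - B u * A' u)"
      by (intro multihom_diff multihom_mult F A B A' B')
    fix b assume b: "b \<in> D"
    have "hcoords \<circ> (Finite \<circ> b) = (\<lambda>f. (b f, 1))" by auto
    then have "B (\<lambda>f. (b f, 1)) * R b = A (\<lambda>f. (b f, 1))" "B' (\<lambda>f. (b f, 1)) * R b = A' (\<lambda>f. (b f, 1))"
      using eq [OF b] eq' [OF b] by (simp_all only: A(2) B(2) A'(2) B'(2))
    from this [symmetric] show "A (\<lambda>f. (b f, 1)) * B' (\<lambda>f. (b f, 1)) - B (\<lambda>f. (b f, 1)) * A' (\<lambda>f. (b f, 1)) = 0"
      by (simp only: mult_ac diff_self)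
  qed
  then show ?thesis
    unfolding wv wv' using nz nz' by (intro from_hcoords_eqI) (auto simp: A B A' B')
qed


section \<open>Dimer sums and urban renewal\<close>

text \<open>The covered set \<open>U\<close> is a parameter, so that a piece of a graph can be
  summed separately for each set of vertices that it is to cover.\<close>

definition matchings :: "'v set set \<Rightarrow> 'v set \<Rightarrow> 'v set set set" where
  "matchings E U = {N. N \<subseteq> E \<and> disjoint N \<and> \<Union>N = U}"

definition dimer_sum :: "'v set set \<Rightarrow> 'v set \<Rightarrow> ('v set \<Rightarrow> complex) \<Rightarrow> complex" where
  "dimer_sum E U \<kappa> = (\<Sum>N\<in>matchings E U. \<Prod>e\<in>N. \<kappa> e)"

lemma finite_matchings: "finite E \<Longrightarrow> finite (matchings E U)"
  by (rule finite_subset [of _ "Pow E"]) (auto simp: matchings_def)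

lemma dimer_sum_cong:
  assumes "\<And>e. e \<in> E \<Longrightarrow> e \<subseteq> U \<Longrightarrow> \<kappa> e = \<kappa>' e"
  shows "dimer_sum E U \<kappa> = dimer_sum E U \<kappa>'"
  unfolding dimer_sum_def
  by (intro sum.cong prod.cong refl assms) (auto simp: matchings_def)

text \<open>A matching uses every vertex of \<open>U\<close> once, so its edges collect the same
  gauge factor whichever matching it is.\<close>

lemma dimer_sum_gauge:
  assumes "finite U"
  shows "dimer_sum E U (\<lambda>e. \<kappa> e * (\<Prod>v\<in>e. g v)) = dimer_sum E U \<kappa> * (\<Prod>v\<in>U. g v)"
  unfolding dimer_sum_def sum_distrib_right prod.distrib
proof (rule sum.cong)
  fix N assume "N \<in> matchings E U"
  then have N: "disjoint N" "\<Union>N = U" by (auto simp: matchings_def)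
  then have fin: "\<forall>e\<in>N. finite e" using assms Union_upper finite_subset by metis
  have "prod g U = (\<Prod>e\<in>N. \<Prod>v\<in>e. g v)"
    using prod.Union_disjoint [of N g] fin N by (simp add: disjoint_def)
  then show "prod \<kappa> N * (\<Prod>e\<in>N. prod g e) = prod \<kappa> N * prod g U" by simp
qed simp

text \<open>\<open>S c\<close> is the set of vertices covered by edges of the cell \<open>c\<close>.
  Different cells may share vertices; disjointness means that no vertex is covered from two
  cells.\<close>

definition cell_states :: "'c set \<Rightarrow> ('c \<Rightarrow> 'v set) \<Rightarrow> 'v set \<Rightarrow> ('c \<Rightarrow> 'v set) set" where
  "cell_states C V U =
     {S \<in> (\<Pi>\<^sub>E c\<in>C. Pow (V c)). disjoint_family_on S C \<and> (\<Union>c\<in>C. S c) = U}"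

lemma finite_cell_states:
  assumes "finite C" "\<And>c. c \<in> C \<Longrightarrow> finite (V c)"
  shows "finite (cell_states C V U)"
  by (rule finite_subset [of _ "\<Pi>\<^sub>E c\<in>C. Pow (V c)"])
     (auto simp: cell_states_def intro!: finite_PiE assms)

text \<open>Every edge lies in exactly one cell, so a matching splits into its traces on the cells.
  These interact only through the vertices they cover: once all \<open>S c\<close> are fixed, the
  sum factorises.\<close>

lemma dimer_sum_cells:
  assumes fin: "finite C" "\<And>c. c \<in> C \<Longrightarrow> finite (E c)" "\<And>c. c \<in> C \<Longrightarrow> finite (V c)"
    and EV: "\<And>c e. c \<in> C \<Longrightarrow> e \<in> E c \<Longrightarrow> e \<subseteq> V c \<and> e \<noteq> {}"
    and disj: "disjoint_family_on E C"
  shows "dimer_sum (\<Union>c\<in>C. E c) U \<kappa> = (\<Sum>S\<in>cell_states C V U. \<Prod>c\<in>C. dimer_sum (E c) (S c) \<kappa>)"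
proof -
  let ?H = "\<lambda>S. \<Pi>\<^sub>E c\<in>C. matchings (E c) (S c)"
  have "(\<Sum>S\<in>cell_states C V U. \<Prod>c\<in>C. dimer_sum (E c) (S c) \<kappa>) =
      (\<Sum>S\<in>cell_states C V U. \<Sum>h\<in>?H S. \<Prod>c\<in>C. \<Prod>e\<in>h c. \<kappa> e)"
    unfolding dimer_sum_def by (intro sum.cong refl prod_sum_PiE fin finite_matchings)
  also have "\<dots> = (\<Sum>(S, h)\<in>Sigma (cell_states C V U) ?H. \<Prod>c\<in>C. \<Prod>e\<in>h c. \<kappa> e)"
    by (intro sum.Sigma ballI finite_cell_states finite_PiE finite_matchings fin)
  also have "\<dots> = dimer_sum (\<Union>c\<in>C. E c) U \<kappa>"
    unfolding dimer_sum_def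
  proof (rule sum.reindex_bij_witness
      [where j = "\<lambda>(S, h). \<Union>c\<in>C. h c" and i = "\<lambda>N. (\<lambda>c\<in>C. \<Union>(N \<inter> E c), \<lambda>c\<in>C. N \<inter> E c)"])
    fix a assume a: "a \<in> Sigma (cell_states C V U) ?H"
    obtain S h where a_eq: "a = (S, h)" by force
    have S: "S \<in> (\<Pi>\<^sub>E c\<in>C. Pow (V c))" "disjoint_family_on S C" "(\<Union>c\<in>C. S c) = U"
      and h: "h \<in> ?H S"
      using a by (auto simp: a_eq cell_states_def)
    have h': "h c \<subseteq> E c" "disjoint (h c)" "\<Union>(h c) = S c" if "c \<in> C" for c
      using h that by (auto simp: matchings_def)
    have int: "(\<Union>c\<in>C. h c) \<inter> E c = h c" if "c \<in> C" for c
      using that disj h'(1) unfolding disjoint_family_on_def by fast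
    have "(\<lambda>c\<in>C. \<Union>((\<Union>c\<in>C. h c) \<inter> E c)) = S"
      using S(1) by (intro extensionalityI [of _ C]) (auto simp: int h' PiE_def)
    moreover have "(\<lambda>c\<in>C. (\<Union>c\<in>C. h c) \<inter> E c) = h"
      using h by (intro extensionalityI [of _ C]) (auto simp: int PiE_def)
    ultimately show "(\<lambda>N. (\<lambda>c\<in>C. \<Union>(N \<inter> E c), \<lambda>c\<in>C. N \<inter> E c)) ((\<lambda>(S, h). \<Union>c\<in>C. h c) a) = a"
      by (simp add: a_eq)
    have "disjoint (\<Union>c\<in>C. h c)"
      unfolding disjoint_def
    proof (intro ballI impI)
      fix e e' assume ee: "e \<in> (\<Union>c\<in>C. h c)" "e' \<in> (\<Union>c\<in>C. h c)" "e \<noteq> e'"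
      then obtain c c' where c: "c \<in> C" "e \<in> h c" "c' \<in> C" "e' \<in> h c'" by auto
      show "e \<inter> e' = {}"
      proof (cases "c = c'")
        case True
        with c ee h'(2) show ?thesis by (auto simp: disjoint_def)
      next
        case False
        with S(2) c have "S c \<inter> S c' = {}" by (auto simp: disjoint_family_on_def)
        with c h'(3) show ?thesis by fast
      qed
    qed
    then show "(\<lambda>(S, h). \<Union>c\<in>C. h c) a \<in> matchings (\<Union>c\<in>C. E c) U"
      using h' S(3) by (fastforce simp: a_eq matchings_def)
    show "prod \<kappa> ((\<lambda>(S, h). \<Union>c\<in>C. h c) a) = (case a of (S, h) \<Rightarrow> \<Prod>c\<in>C. prod \<kappa> (h c))"
    proof -
      have "h c \<inter> h c' = {}" if "c \<in> C" "c' \<in> C" "c \<noteq> c'" for c c'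
        using that disj h'(1) unfolding disjoint_family_on_def by fast
      moreover have "finite (h c)" if "c \<in> C" for c
        using finite_subset [OF h'(1) [OF that] fin(2) [OF that]] .
      ultimately show ?thesis
        using fin(1) by (simp add: a_eq prod.UNION_disjoint)
    qed
  next
    fix N assume "N \<in> matchings (\<Union>c\<in>C. E c) U"
    then have N: "N \<subseteq> (\<Union>c\<in>C. E c)" "disjoint N" "\<Union>N = U" by (auto simp: matchings_def)
    show "(\<lambda>(S, h). \<Union>c\<in>C. h c) (\<lambda>c\<in>C. \<Union>(N \<inter> E c), \<lambda>c\<in>C. N \<inter> E c) = N"
      using N(1) by auto
    have "\<Union>(N \<inter> E c) \<inter> \<Union>(N \<inter> E c') = {}" if "c \<in> C" "c' \<in> C" "c \<noteq> c'" for c c'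
    proof -
      have "e \<inter> e' = {}" if "e \<in> N \<inter> E c" "e' \<in> N \<inter> E c'" for e e'
      proof -
        have "e \<noteq> e'" using disj that \<open>c \<in> C\<close> \<open>c' \<in> C\<close> \<open>c \<noteq> c'\<close>
          by (auto simp: disjoint_family_on_def)
        with N(2) that show ?thesis by (auto simp: disjoint_def)
      qed
      then show ?thesis by fast
    qed
    moreover have "(\<Union>c\<in>C. \<Union>(N \<inter> E c)) = U"
      unfolding N(3) [symmetric] using N(1) by blast
    ultimately have "(\<lambda>c\<in>C. \<Union>(N \<inter> E c)) \<in> cell_states C V U"
      using EV by (fastforce simp: cell_states_def disjoint_family_on_def)
    moreover have "(\<lambda>c\<in>C. N \<inter> E c) \<in> ?H (\<lambda>c\<in>C. \<Union>(N \<inter> E c))"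
      using N(2) by (auto simp: matchings_def disjoint_def)
    ultimately show "(\<lambda>c\<in>C. \<Union>(N \<inter> E c), \<lambda>c\<in>C. N \<inter> E c) \<in> Sigma (cell_states C V U) ?H"
      by simp
  qed
  finally show ?thesis by simp
qed

text \<open>In this counting form, complementation inside the cells becomes subtraction of
  cardinalities.\<close>

lemma cell_states_iff_card:
  assumes "finite C"
  shows "S \<in> cell_states C V U \<longleftrightarrow> S \<in> (\<Pi>\<^sub>E c\<in>C. Pow (V c)) \<and>
    (\<forall>v. card {c \<in> C. v \<in> S c} = of_bool (v \<in> U))"
proof -
  have "(disjoint_family_on S C \<and> (\<Union>c\<in>C. S c) = U) \<longleftrightarrow>
      (\<forall>v. card {c \<in> C. v \<in> S c} = of_bool (v \<in> U))" (is "?L \<longleftrightarrow> ?R")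
  proof
    assume L: ?L
    show ?R
    proof
      fix v
      show "card {c \<in> C. v \<in> S c} = of_bool (v \<in> U)"
      proof (cases "v \<in> U")
        case True
        with L obtain c where c: "c \<in> C" "v \<in> S c" by auto
        with L have "{c \<in> C. v \<in> S c} = {c}" by (auto simp: disjoint_family_on_def)
        with True show ?thesis by simp
      next
        case False
        with L have empty: "{c \<in> C. v \<in> S c} = {}" by auto
        show ?thesis unfolding empty using False by simp
      qed
    qed
  next
    assume R: ?R
    have "S c \<inter> S c' = {}" if "c \<in> C" "c' \<in> C" "c \<noteq> c'" for c c'
    proof (rule ccontr)
      assume "S c \<inter> S c' \<noteq> {}"
      then obtain v where "v \<in> S c" "v \<in> S c'" by auto
      with that have "{c, c'} \<subseteq> {c \<in> C. v \<in> S c}" by auto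
      then have "card {c, c'} \<le> card {c \<in> C. v \<in> S c}" using assms by (intro card_mono) auto
      with that R show False by (auto split: if_splits simp: of_bool_def)
    qed
    moreover have "v \<in> (\<Union>c\<in>C. S c) \<longleftrightarrow> v \<in> U" for v
    proof -
      have "v \<in> (\<Union>c\<in>C. S c) \<longleftrightarrow> {c \<in> C. v \<in> S c} \<noteq> {}" by auto
      also have "\<dots> \<longleftrightarrow> card {c \<in> C. v \<in> S c} \<noteq> 0" using assms by (subst card_0_eq) auto
      finally show ?thesis using R by (auto simp: of_bool_def)
    qed
    ultimately show ?L by (auto simp: disjoint_family_on_def)
  qed
  then show ?thesis by (auto simp: cell_states_def)
qed

text \<open>Complementing the set of vertices that each cell covers: a vertex in two cells stays
  covered once, a vertex in one cell becomes uncovered.\<close>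

lemma sum_cell_states_complement:
  fixes W W' :: "'c \<Rightarrow> 'v set \<Rightarrow> complex"
  assumes fin: "finite C"
    and mult: "\<And>v. card {c \<in> C. v \<in> V c} = of_bool (v \<in> U) + of_bool (v \<in> U')"
    and W: "\<And>c S. c \<in> C \<Longrightarrow> S \<subseteq> V c \<Longrightarrow> W c S = K c * W' c (V c - S)"
  shows "(\<Sum>S\<in>cell_states C V U. \<Prod>c\<in>C. W c (S c)) =
    (\<Prod>c\<in>C. K c) * (\<Sum>S\<in>cell_states C V U'. \<Prod>c\<in>C. W' c (S c))"
proof -
  have compl: "(\<lambda>c\<in>C. V c - S c) \<in> cell_states C V U2"
    if S: "S \<in> cell_states C V U1"
      and m: "\<And>v. card {c \<in> C. v \<in> V c} = of_bool (v \<in> U1) + of_bool (v \<in> U2)" for S U1 U2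
  proof -
    have S': "S \<in> (\<Pi>\<^sub>E c\<in>C. Pow (V c))" "\<And>v. card {c \<in> C. v \<in> S c} = of_bool (v \<in> U1)"
      using S by (auto simp: cell_states_iff_card [OF fin])
    have "card {c \<in> C. v \<in> (\<lambda>c\<in>C. V c - S c) c} = of_bool (v \<in> U2)" for v
    proof -
      have "{c \<in> C. v \<in> (\<lambda>c\<in>C. V c - S c) c} = {c \<in> C. v \<in> V c} - {c \<in> C. v \<in> S c}"
        by auto
      also have "card \<dots> = card {c \<in> C. v \<in> V c} - card {c \<in> C. v \<in> S c}"
        using S'(1) fin by (intro card_Diff_subset) auto
      finally show ?thesis by (simp add: m S')
    qed
    then show ?thesis by (auto simp: cell_states_iff_card [OF fin])
  qed
  have invol: "(\<lambda>c\<in>C. V c - (\<lambda>c\<in>C. V c - S c) c) = S" if "S \<in> cell_states C V U1" for S U1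
    using that by (intro extensionalityI [of _ C]) (auto simp: cell_states_def PiE_def Pi_def)
  show ?thesis
    unfolding sum_distrib_left
  proof (rule sum.reindex_bij_witness
      [where i = "\<lambda>S. \<lambda>c\<in>C. V c - S c" and j = "\<lambda>S. \<lambda>c\<in>C. V c - S c"])
    fix S assume S: "S \<in> cell_states C V U"
    have "(\<Prod>c\<in>C. W c (S c)) = (\<Prod>c\<in>C. K c * W' c (V c - S c))"
      using S by (intro prod.cong refl W) (auto simp: cell_states_def)
    then show "(\<Prod>c\<in>C. K c) * (\<Prod>c\<in>C. W' c ((\<lambda>c\<in>C. V c - S c) c)) = (\<Prod>c\<in>C. W c (S c))"
      by (simp add: prod.distrib)
  next
    fix S assume S: "S \<in> cell_states C V U"
    show "(\<lambda>c\<in>C. V c - (\<lambda>c\<in>C. V c - S c) c) = S" by (rule invol [OF S])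
    show "(\<lambda>c\<in>C. V c - S c) \<in> cell_states C V U'" by (rule compl [OF S mult])
  next
    fix S assume S: "S \<in> cell_states C V U'"
    show "(\<lambda>c\<in>C. V c - (\<lambda>c\<in>C. V c - S c) c) = S" by (rule invol [OF S])
    have "card {c \<in> C. v \<in> V c} = of_bool (v \<in> U') + of_bool (v \<in> U)" for v
      by (simp only: mult add.commute)
    then show "(\<lambda>c\<in>C. V c - S c) \<in> cell_states C V U" by (rule compl [OF S])
  qed
qed

section \<open>A single four-cycle\<close>

lemma disjoint_subsets_four_cycle:
  assumes "e1 \<inter> e2 \<noteq> {}" "e2 \<inter> e3 \<noteq> {}" "e3 \<inter> e4 \<noteq> {}" "e4 \<inter> e1 \<noteq> {}"
    and "e1 \<inter> e3 = {}" "e2 \<inter> e4 = {}" and "e1 \<noteq> e2" "e2 \<noteq> e3" "e3 \<noteq> e4" "e4 \<noteq> e1"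
  shows "{N. N \<subseteq> {e1, e2, e3, e4} \<and> disjoint N} =
    {{}, {e1}, {e2}, {e3}, {e4}, {e1, e3}, {e2, e4}}" (is "?L = ?R")
proof (rule subset_antisym)
  show "?L \<subseteq> ?R"
  proof
    fix N assume "N \<in> ?L"
    then have N: "N \<subseteq> {e1, e2, e3, e4}" and "disjoint N" by auto
    then have not_both: "\<not> (e \<in> N \<and> e' \<in> N)" if "e \<inter> e' \<noteq> {}" "e \<noteq> e'" for e e'
      using that unfolding disjoint_def by blast
    have nb: "\<not> (e1 \<in> N \<and> e2 \<in> N)" "\<not> (e2 \<in> N \<and> e3 \<in> N)"
      "\<not> (e3 \<in> N \<and> e4 \<in> N)" "\<not> (e4 \<in> N \<and> e1 \<in> N)"
      using not_both assms(1-4,7-10) by blast+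
    have eq: "N = (if e1 \<in> N then insert e1 else id) ((if e2 \<in> N then insert e2 else id)
        ((if e3 \<in> N then insert e3 else id) ((if e4 \<in> N then insert e4 else id) {})))"
      using N by auto
    have "\<not> (p \<and> q) \<Longrightarrow> \<not> (q \<and> r) \<Longrightarrow> \<not> (r \<and> s) \<Longrightarrow> \<not> (s \<and> p) \<Longrightarrow>
      (if p then insert e1 else id) ((if q then insert e2 else id)
        ((if r then insert e3 else id) ((if s then insert e4 else id) {}))) \<in> ?R"
      for p q r s
      by (cases p; cases q; cases r; cases s) simp_all
    from this [OF nb] show "N \<in> ?R" unfolding eq [symmetric] .
  qed
  have "disjoint {}" "\<And>e. disjoint {e}" "disjoint {e1, e3}" "disjoint {e2, e4}"
    using assms(5,6) by (simp_all add: disjoint_def Int_commute)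
  then show "?R \<subseteq> ?L" by simp
qed

text \<open>Of the seven matchings of a four-cycle, only the two perfect ones cover the same set,
  which gives the two-term weight. Sets covered by no matching, such as two opposite corners, get
  the value 0.\<close>

lemma dimer_sum_four_cycle:
  assumes "distinct [a, b, c, d]"
  shows "dimer_sum {{a, b}, {b, c}, {c, d}, {d, a}} S \<kappa> =
    of_bool (S = {}) + of_bool (S = {a, b}) * \<kappa> {a, b} + of_bool (S = {b, c}) * \<kappa> {b, c} +
    of_bool (S = {c, d}) * \<kappa> {c, d} + of_bool (S = {d, a}) * \<kappa> {d, a} +
    of_bool (S = {a, b, c, d}) * (\<kappa> {a, b} * \<kappa> {c, d} + \<kappa> {b, c} * \<kappa> {d, a})"
proof -
  obtain e1 e2 e3 e4 where e: "e1 = {a, b}" "e2 = {b, c}" "e3 = {c, d}" "e4 = {d, a}" by blast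
  have ne: "e1 \<noteq> e2" "e1 \<noteq> e3" "e1 \<noteq> e4" "e2 \<noteq> e3" "e2 \<noteq> e4" "e3 \<noteq> e4"
    using assms by (auto simp: e doubleton_eq_iff)
  have un: "e1 \<union> e3 = {a, b, c, d}" "e2 \<union> e4 = {a, b, c, d}" by (auto simp: e)
  have subs: "{N. N \<subseteq> {e1, e2, e3, e4} \<and> disjoint N} =
      {{}, {e1}, {e2}, {e3}, {e4}, {e1, e3}, {e2, e4}}"
    by (rule disjoint_subsets_four_cycle) (use assms ne in \<open>auto simp: e\<close>)
  have ne2: "{e1} \<noteq> {e1, e3}" "{e1} \<noteq> {e2, e4}" "{e2} \<noteq> {e1, e3}" "{e2} \<noteq> {e2, e4}"
    "{e3} \<noteq> {e1, e3}" "{e3} \<noteq> {e2, e4}" "{e4} \<noteq> {e1, e3}" "{e4} \<noteq> {e2, e4}" "{e1, e3} \<noteq> {e2, e4}"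
    using ne by (auto simp: doubleton_eq_iff)
  have "dimer_sum {e1, e2, e3, e4} S \<kappa> =
      (\<Sum>N\<in>{N. N \<subseteq> {e1, e2, e3, e4} \<and> disjoint N}. of_bool (S = \<Union>N) * prod \<kappa> N)"
    unfolding dimer_sum_def matchings_def
    by (rule sum.mono_neutral_cong_left) auto
  also have "\<dots> = of_bool (S = {}) + of_bool (S = e1) * \<kappa> e1 + of_bool (S = e2) * \<kappa> e2 +
      of_bool (S = e3) * \<kappa> e3 + of_bool (S = e4) * \<kappa> e4 +
      of_bool (S = {a, b, c, d}) * (\<kappa> e1 * \<kappa> e3 + \<kappa> e2 * \<kappa> e4)"
  proof -
    have "sum g {{}, {e1}, {e2}, {e3}, {e4}, {e1, e3}, {e2, e4}} = g {} + (g {e1} + (g {e2} + (g {e3} +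
        (g {e4} + (g {e1, e3} + g {e2, e4})))))" for g :: "'a set set \<Rightarrow> complex"
    proof -
      have "{} \<notin> {{e1}, {e2}, {e3}, {e4}, {e1, e3}, {e2, e4}}"
        "{e1} \<notin> {{e2}, {e3}, {e4}, {e1, e3}, {e2, e4}}" "{e2} \<notin> {{e3}, {e4}, {e1, e3}, {e2, e4}}"
        "{e3} \<notin> {{e4}, {e1, e3}, {e2, e4}}" "{e4} \<notin> {{e1, e3}, {e2, e4}}" "{e1, e3} \<notin> {{e2, e4}}"
        using ne ne2 by (simp_all add: doubleton_eq_iff)
      then show ?thesis by (simp only: sum.insert finite.intros sum.empty empty_iff add_0_right simp_thms)
    qed
    moreover have "\<Union>{e1, e3} = {a, b, c, d}" "\<Union>{e2, e4} = {a, b, c, d}"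
      "prod \<kappa> {e1, e3} = \<kappa> e1 * \<kappa> e3" "prod \<kappa> {e2, e4} = \<kappa> e2 * \<kappa> e4"
      by (simp_all only: Union_insert Union_empty Un_empty_right un prod.insert finite.intros
        insert_iff empty_iff ne prod.empty mult_1_right simp_thms)
    ultimately show ?thesis
      unfolding subs
      by (simp only: Union_empty prod.empty mult_1_right Union_insert Un_empty_right
        prod.insert finite.intros empty_iff not_False_eq_True distrib_left add.assoc)
  qed
  finally show ?thesis unfolding e .
qed

text \<open>The local move of urban renewal. Complementation exchanges an edge with the opposite
  one, hence the exchanged weights. It also exchanges the empty and the full set, of weights 1 and
  \<Delta>; division by \<Delta> makes the new full weight \<open>1 / \<Delta>\<close>.\<close>

lemma dimer_sum_four_cycle_complement:
  assumes dist: "distinct [a, b, c, d]" and V: "V = {a, b, c, d}" and S: "S \<subseteq> V"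
    and \<Delta>: "\<Delta> = \<kappa> {a, b} * \<kappa> {c, d} + \<kappa> {b, c} * \<kappa> {d, a}" "\<Delta> \<noteq> 0"
    and \<kappa>': "\<kappa>' {a, b} = \<kappa> {c, d} / \<Delta>" "\<kappa>' {c, d} = \<kappa> {a, b} / \<Delta>"
      "\<kappa>' {b, c} = \<kappa> {d, a} / \<Delta>" "\<kappa>' {d, a} = \<kappa> {b, c} / \<Delta>"
  shows "dimer_sum {{a, b}, {b, c}, {c, d}, {d, a}} S \<kappa> =
    \<Delta> * dimer_sum {{a, b}, {b, c}, {c, d}, {d, a}} (V - S) \<kappa>'"
proof -
  have compl: "V - S = T \<longleftrightarrow> S = T'" if "T \<subseteq> V" "V - T = T'" for T T'
    using S that by blast
  have *: "V - S = {} \<longleftrightarrow> S = {a, b, c, d}" "V - S = {a, b} \<longleftrightarrow> S = {c, d}"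
    "V - S = {c, d} \<longleftrightarrow> S = {a, b}" "V - S = {b, c} \<longleftrightarrow> S = {d, a}" "V - S = {d, a} \<longleftrightarrow> S = {b, c}"
    "V - S = {a, b, c, d} \<longleftrightarrow> S = {}"
    by (rule compl; use dist in \<open>auto simp: V\<close>)+
  have "\<Delta> * (\<kappa>' {a, b} * \<kappa>' {c, d} + \<kappa>' {b, c} * \<kappa>' {d, a}) =
      (\<kappa> {a, b} * \<kappa> {c, d} + \<kappa> {b, c} * \<kappa> {d, a}) / \<Delta>"
    using \<Delta>(2) by (simp add: \<kappa>' field_simps)
  also have "\<dots> = 1" using \<Delta> by simp
  finally show ?thesis
    unfolding dimer_sum_four_cycle [OF dist] *
    using \<Delta>(2) by (simp add: distrib_left \<kappa>' \<Delta>(1) [symmetric] mult.left_commute [of \<Delta>])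
qed


section \<open>Combinatorics of the Aztec diamond\<close>

definition hedge :: "int \<Rightarrow> int \<Rightarrow> vertex set" where
  "hedge m q = {(m, q), (m + 1, q)}"

definition vedge :: "int \<Rightarrow> int \<Rightarrow> vertex set" where
  "vedge m q = {(m, q), (m, q + 1)}"

lemma face_edges_conv:
  "face_edges (i, j) = {hedge i j, vedge (i + 1) j, hedge i (j + 1), vedge i j}"
  by (simp add: hedge_def vedge_def insert_commute face_edges.simps)

declare face_edges.simps [simp del]

lemma hedge_eq_iff [simp]: "hedge m q = hedge m' q' \<longleftrightarrow> m = m' \<and> q = q'"
  by (auto simp: hedge_def doubleton_eq_iff)

lemma vedge_eq_iff [simp]: "vedge m q = vedge m' q' \<longleftrightarrow> m = m' \<and> q = q'"
  by (auto simp: vedge_def doubleton_eq_iff)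

lemma hedge_neq_vedge [simp]: "hedge m q \<noteq> vedge m' q'" "vedge m' q' \<noteq> hedge m q"
  by (auto simp: hedge_def vedge_def doubleton_eq_iff)

lemma hedge_in_face_edges: "hedge m q \<in> face_edges (a, b) \<longleftrightarrow> m = a \<and> (q = b \<or> q = b + 1)"
  by (auto simp: face_edges_conv)

lemma vedge_in_face_edges: "vedge m q \<in> face_edges (a, b) \<longleftrightarrow> q = b \<and> (m = a \<or> m = a + 1)"
  by (auto simp: face_edges_conv)

lemma face_edgeE:
  assumes "e \<in> face_edges f"
  obtains m q where "e = hedge m q" | m q where "e = vedge m q"
  using assms by (cases f) (auto simp: face_edges_conv)

lemma face_edges_nonempty: "e \<in> face_edges f \<Longrightarrow> e \<noteq> {}"
  by (erule face_edgeE) (auto simp: hedge_def vedge_def)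

lemma finite_face_edges [simp]: "finite (face_edges f)"
  by (cases f) (simp add: face_edges_conv)

lemma face_edges_subset: "e \<in> face_edges f \<Longrightarrow> e \<subseteq> face_vertices f"
  by (cases f) (auto simp: face_edges.simps)

lemma in_face_vertices:
  "(m, q) \<in> face_vertices f \<longleftrightarrow> f \<in> {(m, q), (m - 1, q), (m - 1, q - 1), (m, q - 1)}"
  by (cases f) auto

lemma hedge_in_aztec_edges:
  "hedge m q \<in> aztec_edges k c \<longleftrightarrow>
     face_dist c (m, q) < int k \<or> face_dist c (m, q - 1) < int k"
proof
  assume "hedge m q \<in> aztec_edges k c"
  then obtain a b where "face_dist c (a, b) < int k" "hedge m q \<in> face_edges (a, b)"
    by (auto simp: aztec_edges_def internal_faces_def)
  then show "face_dist c (m, q) < int k \<or> face_dist c (m, q - 1) < int k"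
    by (auto simp: hedge_in_face_edges)
next
  have "hedge m q \<in> face_edges (m, q)" "hedge m q \<in> face_edges (m, q - 1)"
    by (auto simp: hedge_in_face_edges)
  then show "face_dist c (m, q) < int k \<or> face_dist c (m, q - 1) < int k \<Longrightarrow> hedge m q \<in> aztec_edges k c"
    unfolding aztec_edges_def internal_faces_def by blast
qed

lemma vedge_in_aztec_edges:
  "vedge m q \<in> aztec_edges k c \<longleftrightarrow>
     face_dist c (m, q) < int k \<or> face_dist c (m - 1, q) < int k"
proof
  assume "vedge m q \<in> aztec_edges k c"
  then obtain a b where "face_dist c (a, b) < int k" "vedge m q \<in> face_edges (a, b)"
    by (auto simp: aztec_edges_def internal_faces_def)
  then show "face_dist c (m, q) < int k \<or> face_dist c (m - 1, q) < int k"
    by (auto simp: vedge_in_face_edges)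
next
  have "vedge m q \<in> face_edges (m, q)" "vedge m q \<in> face_edges (m - 1, q)"
    by (auto simp: vedge_in_face_edges)
  then show "face_dist c (m, q) < int k \<or> face_dist c (m - 1, q) < int k \<Longrightarrow> vedge m q \<in> aztec_edges k c"
    unfolding aztec_edges_def internal_faces_def by blast
qed

lemma aztec_edgeE:
  assumes "e \<in> aztec_edges k c"
  obtains m q where "e = hedge m q" | m q where "e = vedge m q"
  using assms unfolding aztec_edges_def by (auto elim: face_edgeE)

lemma in_aztec_vertices:
  "(m, q) \<in> aztec_vertices k c \<longleftrightarrow>
     (\<exists>f\<in>{(m, q), (m - 1, q), (m - 1, q - 1), (m, q - 1)}. face_dist c f < int k)"
  unfolding aztec_vertices_def internal_faces_def by (auto simp: in_face_vertices simp del: face_vertices.simps)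

lemma aztec_edges_subset: "e \<in> aztec_edges k c \<Longrightarrow> e \<subseteq> aztec_vertices k c"
  unfolding aztec_edges_def aztec_vertices_def using face_edges_subset by blast

lemma aztec_faces_conv: "aztec_faces k c = {f. face_dist c f \<le> int k}"
  by (auto simp: aztec_faces_def internal_faces_def open_faces_def)

lemma finite_aztec_faces: "finite (aztec_faces k c)"
proof (cases c)
  case (Pair i j)
  have "aztec_faces k c \<subseteq> {i - int k..i + int k} \<times> {j - int k..j + int k}"
    by (auto simp: aztec_faces_conv Pair)
  then show ?thesis by (rule finite_subset) simp
qed

lemma finite_internal_faces: "finite (internal_faces k c)"
  by (rule finite_subset [OF _ finite_aztec_faces [of k c]]) (auto simp: aztec_faces_def)

lemma finite_aztec_edges: "finite (aztec_edges k c)"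
  unfolding aztec_edges_def by (auto simp: finite_internal_faces)

lemma finite_aztec_vertices: "finite (aztec_vertices k c)"
  unfolding aztec_vertices_def by (auto simp: finite_internal_faces)

section \<open>Arithmetic of the distance to the centre\<close>

lemma abs_pred_cases: "\<bar>x - 1\<bar> = \<bar>x\<bar> + 1 \<or> \<bar>x - 1\<bar> = \<bar>x\<bar> - (1 :: int)"
  by linarith

lemma abs_parity:
  fixes x y n :: int
  assumes "odd (x + y + n)" shows "\<bar>x\<bar> + \<bar>y\<bar> \<noteq> n"
proof
  assume "\<bar>x\<bar> + \<bar>y\<bar> = n"
  then have "even (\<bar>x\<bar> + \<bar>y\<bar> + n)" by simp
  with assms show False by auto
qed

lemma of_bool_add_of_bool: "of_bool P + of_bool Q = (of_bool (P \<or> Q) + of_bool (P \<and> Q) :: nat)"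
  by (simp add: of_bool_def)

text \<open>\<open>a + b\<close> and \<open>a' + b'\<close> are the distances of the two diagonally
  opposite cells at a vertex, the mixed sums those of its other two faces; the excluded values come
  from parity. Some face is within distance \<open>n\<close> iff one of the two cells is, and some
  face is closer than \<open>n\<close> iff both cells are within \<open>n\<close>.\<close>

lemma corner_count:
  fixes a a' b b' n :: int
  assumes "a' = a + 1 \<or> a' = a - 1" "b' = b + 1 \<or> b' = b - 1"
    and "a + b \<noteq> n - 1" "a' + b' \<noteq> n - 1" "a' + b \<noteq> n" "a + b' \<noteq> n"
  shows "of_bool (a + b \<le> n) + of_bool (a' + b' \<le> n) = (of_bool (a + b \<le> n \<or>
   a' + b \<le> n \<or> a' + b' \<le> n \<or> a + b' \<le> n) + of_bool (a + b < n \<or>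
   a' + b < n \<or> a' + b' < n \<or> a + b' < n) :: nat)"
proof -
  have "a + b \<le> n \<or> a' + b' \<le> n \<longleftrightarrow> a + b \<le> n \<or> a' + b \<le> n \<or> a' + b' \<le> n \<or> a + b' \<le> n"
    using assms by linarith
  moreover have "a + b \<le> n \<and> a' + b' \<le> n \<longleftrightarrow> a + b < n \<or> a' + b < n \<or> a' + b' < n \<or> a + b' < n"
    using assms by linarith
  ultimately show ?thesis by (simp only: of_bool_add_of_bool [of "a + b \<le> n"])
qed

lemma corner_count_even:
  fixes x y n :: int
  assumes "even (x + y + n)"
  shows "of_bool (\<bar>x\<bar> + \<bar>y\<bar> \<le> n) + of_bool (\<bar>x - 1\<bar> + \<bar>y - 1\<bar> \<le> n) = (of_bool (\<bar>x\<bar> + \<bar>y\<bar> \<le> n \<or>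
   \<bar>x - 1\<bar> + \<bar>y\<bar> \<le> n \<or> \<bar>x - 1\<bar> + \<bar>y - 1\<bar> \<le> n \<or> \<bar>x\<bar> + \<bar>y - 1\<bar> \<le> n) + of_bool (\<bar>x\<bar> + \<bar>y\<bar> < n \<or>
   \<bar>x - 1\<bar> + \<bar>y\<bar> < n \<or> \<bar>x - 1\<bar> + \<bar>y - 1\<bar> < n \<or> \<bar>x\<bar> + \<bar>y - 1\<bar> < n) :: nat)"
proof -
  have "\<bar>x\<bar> + \<bar>y\<bar> \<noteq> n - 1" "\<bar>x - 1\<bar> + \<bar>y - 1\<bar> \<noteq> n - 1" "\<bar>x - 1\<bar> + \<bar>y\<bar> \<noteq> n" "\<bar>x\<bar> + \<bar>y - 1\<bar> \<noteq> n"
    by (rule abs_parity; use assms in presburger)+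
  then show ?thesis by (intro corner_count abs_pred_cases)
qed

lemma corner_count_odd:
  fixes x y n :: int
  assumes "odd (x + y + n)"
  shows "of_bool (\<bar>x - 1\<bar> + \<bar>y\<bar> \<le> n) + of_bool (\<bar>x\<bar> + \<bar>y - 1\<bar> \<le> n) = (of_bool (\<bar>x\<bar> + \<bar>y\<bar> \<le> n \<or>
   \<bar>x - 1\<bar> + \<bar>y\<bar> \<le> n \<or> \<bar>x - 1\<bar> + \<bar>y - 1\<bar> \<le> n \<or> \<bar>x\<bar> + \<bar>y - 1\<bar> \<le> n) + of_bool (\<bar>x\<bar> + \<bar>y\<bar> < n \<or>
   \<bar>x - 1\<bar> + \<bar>y\<bar> < n \<or> \<bar>x - 1\<bar> + \<bar>y - 1\<bar> < n \<or> \<bar>x\<bar> + \<bar>y - 1\<bar> < n) :: nat)"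
proof -
  have "\<bar>x\<bar> + \<bar>y\<bar> \<noteq> n" "\<bar>x - 1\<bar> + \<bar>y - 1\<bar> \<noteq> n" "\<bar>x - 1\<bar> + \<bar>y\<bar> \<noteq> n - 1" "\<bar>x\<bar> + \<bar>y - 1\<bar> \<noteq> n - 1"
    by (rule abs_parity; use assms in presburger)+
  then have "of_bool (\<bar>x - 1\<bar> + \<bar>y\<bar> \<le> n) + of_bool (\<bar>x\<bar> + \<bar>y - 1\<bar> \<le> n) = (of_bool (\<bar>x - 1\<bar> + \<bar>y\<bar> \<le> n \<or>
    \<bar>x\<bar> + \<bar>y\<bar> \<le> n \<or> \<bar>x\<bar> + \<bar>y - 1\<bar> \<le> n \<or> \<bar>x - 1\<bar> + \<bar>y - 1\<bar> \<le> n) + of_bool (\<bar>x - 1\<bar> + \<bar>y\<bar> < n \<or>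
    \<bar>x\<bar> + \<bar>y\<bar> < n \<or> \<bar>x\<bar> + \<bar>y - 1\<bar> < n \<or> \<bar>x - 1\<bar> + \<bar>y - 1\<bar> < n) :: nat)"
    by (intro corner_count abs_pred_cases) linarith
  then show ?thesis by (simp only: disj_commute disj_left_commute)
qed

text \<open>A face of the wrong parity within distance \<open>n\<close> is even within
  \<open>n - 1\<close>, so its neighbours are within \<open>n\<close>.\<close>

lemma abs_step:
  fixes x y y' n :: int
  assumes "even (x + y + n)" "\<bar>x\<bar> + \<bar>y'\<bar> \<le> n" "y' = y - 1 \<or> y' = y + 1"
  shows "\<bar>x\<bar> + \<bar>y\<bar> \<le> n"
proof -
  have "odd (x + y' + n)" using assms(1,3) by auto
  from abs_parity [OF this] assms(2,3) show ?thesis by linarith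
qed

text \<open>Convexity of the diamond: one of the outer columns \<open>x - 1\<close>,
  \<open>x + 1\<close> is at least as far from the centre as the middle column \<open>x\<close>, so
  a nearby face in it yields one in the middle column.\<close>

lemma edge_corners:
  fixes x y n :: int
  assumes "\<bar>x\<bar> + \<bar>y\<bar> < n \<or> \<bar>x - 1\<bar> + \<bar>y\<bar> < n \<or> \<bar>x - 1\<bar> + \<bar>y - 1\<bar> < n \<or> \<bar>x\<bar> + \<bar>y - 1\<bar> < n"
   and "\<bar>x + 1\<bar> + \<bar>y\<bar> < n \<or> \<bar>x\<bar> + \<bar>y\<bar> < n \<or> \<bar>x\<bar> + \<bar>y - 1\<bar> < n \<or> \<bar>x + 1\<bar> + \<bar>y - 1\<bar> < n"
  shows "\<bar>x\<bar> + \<bar>y\<bar> < n \<or> \<bar>x\<bar> + \<bar>y - 1\<bar> < n"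
proof -
  have "\<bar>x\<bar> \<le> \<bar>x - 1\<bar> \<or> \<bar>x\<bar> \<le> \<bar>x + 1\<bar>" by linarith
  with assms show ?thesis by linarith
qed
text \<open>The edges of the diamond of size \<open>n + 1\<close> are partitioned by every other internal face,
  starting from the outermost ones.\<close>

definition cells :: "nat \<Rightarrow> face \<Rightarrow> face set" where
  "cells n c = {f. face_dist c f \<le> int n \<and> even (face_dist c f + int n)}"

section \<open>The cells of the diamond of size \<open>n + 1\<close>\<close>

lemma face_dist_rel: "face_dist (i, j) (i + x, j + y) = \<bar>x\<bar> + \<bar>y\<bar>"
  by simp

lemma in_cells: "(i + x, j + y) \<in> cells n (i, j) \<longleftrightarrow> \<bar>x\<bar> + \<bar>y\<bar> \<le> int n \<and> even (x + y + int n)"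
  unfolding cells_def by auto

lemma relative_coords:
  fixes m q i j :: int
  obtains x y where "m = i + x" "q = j + y"
  using that [of "m - i" "q - j"] by simp

lemmas shift_assoc = add_diff_eq [symmetric] add.assoc

lemma cells_subset: "cells n c \<subseteq> aztec_faces n c"
  by (auto simp: cells_def aztec_faces_conv)

lemma finite_cells: "finite (cells n c)"
  using cells_subset finite_aztec_faces by (rule finite_subset)

text \<open>Exactly one of the two faces along an edge has the parity of the cells, and it is
  internal as soon as the other one is.\<close>

lemma aztec_edges_Suc: "aztec_edges (Suc n) c = (\<Union>f\<in>cells n c. face_edges f)"
proof -
  obtain i j where c: "c = (i, j)" by force
  have H: "hedge m q \<in> aztec_edges (Suc n) c \<longleftrightarrow> (\<exists>f\<in>cells n c. hedge m q \<in> face_edges f)" for m q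
  proof -
    obtain x y where xy: "m = i + x" "q = j + y" by (rule relative_coords)
    have "(\<exists>f\<in>cells n c. hedge m q \<in> face_edges f) \<longleftrightarrow> (m, q) \<in> cells n c \<or> (m, q - 1) \<in> cells n c"
      by (auto simp: Bex_def hedge_in_face_edges)
    also have "\<dots> \<longleftrightarrow> \<bar>x\<bar> + \<bar>y\<bar> \<le> int n \<or> \<bar>x\<bar> + \<bar>y - 1\<bar> \<le> int n"
      using abs_step [of x y "int n" "y - 1"] abs_step [of x "y - 1" "int n" y]
      unfolding c xy shift_assoc unfolding in_cells by auto
    also have "\<dots> \<longleftrightarrow> hedge m q \<in> aztec_edges (Suc n) c"
      unfolding hedge_in_aztec_edges c xy shift_assoc face_dist_rel by auto
    finally show ?thesis by simp
  qed
  have V: "vedge m q \<in> aztec_edges (Suc n) c \<longleftrightarrow> (\<exists>f\<in>cells n c. vedge m q \<in> face_edges f)" for m q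
  proof -
    obtain x y where xy: "m = i + x" "q = j + y" by (rule relative_coords)
    have "(\<exists>f\<in>cells n c. vedge m q \<in> face_edges f) \<longleftrightarrow> (m, q) \<in> cells n c \<or> (m - 1, q) \<in> cells n c"
      by (auto simp: Bex_def vedge_in_face_edges)
    also have "\<dots> \<longleftrightarrow> \<bar>x\<bar> + \<bar>y\<bar> \<le> int n \<or> \<bar>x - 1\<bar> + \<bar>y\<bar> \<le> int n"
      using abs_step [of y x "int n" "x - 1"] abs_step [of y "x - 1" "int n" x]
      unfolding c xy shift_assoc unfolding in_cells by (auto simp: add.commute)
    also have "\<dots> \<longleftrightarrow> vedge m q \<in> aztec_edges (Suc n) c"
      unfolding vedge_in_aztec_edges c xy shift_assoc face_dist_rel by auto
    finally show ?thesis by simp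
  qed
  show ?thesis
  proof (rule set_eqI)
    fix e
    show "e \<in> aztec_edges (Suc n) c \<longleftrightarrow> e \<in> (\<Union>f\<in>cells n c. face_edges f)"
    proof (cases "(\<exists>m q. e = hedge m q) \<or> (\<exists>m q. e = vedge m q)")
      case True
      then show ?thesis using H V by auto
    next
      case False
      then show ?thesis by (auto elim: aztec_edgeE face_edgeE)
    qed
  qed
qed

lemma disjoint_cells: "disjoint_family_on face_edges (cells n c)"
  unfolding disjoint_family_on_def
proof (intro ballI impI)
  fix f f' assume f: "f \<in> cells n c" "f' \<in> cells n c" "f \<noteq> f'"
  obtain i j a b a' b' where eq: "c = (i, j)" "f = (a, b)" "f' = (a', b')" by (metis prod.exhaust)
  have par: "even (a + b + (i + j + int n))" "even (a' + b' + (i + j + int n))"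
    using f in_cells [of i "a - i" j "b - j" n] in_cells [of i "a' - i" j "b' - j" n]
    by (auto simp: eq)
  show "face_edges f \<inter> face_edges f' = {}"
  proof (rule ccontr)
    assume "face_edges f \<inter> face_edges f' \<noteq> {}"
    then obtain e where e: "e \<in> face_edges f" "e \<in> face_edges f'" by blast
    from e(1) show False
    proof (rule face_edgeE)
      fix m q assume "e = hedge m q"
      with e have "m = a \<and> (q = b \<or> q = b + 1)" "m = a' \<and> (q = b' \<or> q = b' + 1)"
        by (auto simp: eq hedge_in_face_edges)
      with par f(3) show False unfolding eq by auto
    next
      fix m q assume "e = vedge m q"
      with e have "q = b \<and> (m = a \<or> m = a + 1)" "q = b' \<and> (m = a' \<or> m = a' + 1)"
        by (auto simp: eq vedge_in_face_edges)
      with par f(3) show False unfolding eq by auto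
    qed
  qed
qed

lemma card_filter_conv_sum: "finite A \<Longrightarrow> card {x \<in> A. P x} = (\<Sum>x\<in>A. of_bool (P x))"
  by (simp add: sum_of_bool_eq Int_def)

text \<open>Two diagonally opposite faces at a vertex have the parity of the cells. Both are cells
  if the vertex belongs to the smaller diamond, and only one is if it lies in the outer layer. This
  is the multiplicity that \<open>sum_cell_states_complement\<close> asks for.\<close>

lemma card_cells_at_vertex:
  "card {f \<in> cells n c. v \<in> face_vertices f} =
     of_bool (v \<in> aztec_vertices (Suc n) c) + of_bool (v \<in> aztec_vertices n c)"
proof -
  obtain i j m q where eq: "c = (i, j)" "v = (m, q)" by (metis prod.exhaust)
  obtain x y where xy: "m = i + x" "q = j + y" by (rule relative_coords)
  have "{f \<in> cells n c. v \<in> face_vertices f} =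
      {f \<in> {(m, q), (m - 1, q), (m - 1, q - 1), (m, q - 1)}. f \<in> cells n c}"
    unfolding eq(2) in_face_vertices by blast
  also have "card \<dots> = of_bool ((m, q) \<in> cells n c) + (of_bool ((m - 1, q) \<in> cells n c) +
      (of_bool ((m - 1, q - 1) \<in> cells n c) + of_bool ((m, q - 1) \<in> cells n c)))"
    by (subst card_filter_conv_sum) simp_all
  also have "\<dots> = of_bool (v \<in> aztec_vertices (Suc n) c) + of_bool (v \<in> aztec_vertices n c)"
  proof -
    have 1: "v \<in> aztec_vertices (Suc n) c \<longleftrightarrow> \<bar>x\<bar> + \<bar>y\<bar> \<le> int n \<or>
        \<bar>x - 1\<bar> + \<bar>y\<bar> \<le> int n \<or> \<bar>x - 1\<bar> + \<bar>y - 1\<bar> \<le> int n \<or> \<bar>x\<bar> + \<bar>y - 1\<bar> \<le> int n"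
      unfolding eq in_aztec_vertices xy shift_assoc bex_simps face_dist_rel by auto
    have 2: "v \<in> aztec_vertices n c \<longleftrightarrow> \<bar>x\<bar> + \<bar>y\<bar> < int n \<or>
        \<bar>x - 1\<bar> + \<bar>y\<bar> < int n \<or> \<bar>x - 1\<bar> + \<bar>y - 1\<bar> < int n \<or> \<bar>x\<bar> + \<bar>y - 1\<bar> < int n"
      unfolding eq in_aztec_vertices xy shift_assoc bex_simps face_dist_rel by auto
    show ?thesis
    proof (cases "even (x + y + int n)")
      case True
      then have "odd (x - 1 + y + int n)" "odd (x + (y - 1) + int n)" "even (x - 1 + (y - 1) + int n)"
        by presburger+
      with True have "(i + x, j + y) \<in> cells n (i, j) \<longleftrightarrow> \<bar>x\<bar> + \<bar>y\<bar> \<le> int n"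
        "(i + (x - 1), j + (y - 1)) \<in> cells n (i, j) \<longleftrightarrow> \<bar>x - 1\<bar> + \<bar>y - 1\<bar> \<le> int n"
        "(i + (x - 1), j + y) \<in> cells n (i, j) \<longleftrightarrow> False" "(i + x, j + (y - 1)) \<in> cells n (i, j) \<longleftrightarrow> False"
        unfolding in_cells by blast+
      then show ?thesis
        unfolding 1 2 corner_count_even [OF True, symmetric]
        unfolding eq xy shift_assoc
        by (simp only: of_bool_eq add_0_left add_0_right)
    next
      case False
      then have "even (x - 1 + y + int n)" "even (x + (y - 1) + int n)" "odd (x - 1 + (y - 1) + int n)"
        by presburger+
      with False have "(i + (x - 1), j + y) \<in> cells n (i, j) \<longleftrightarrow> \<bar>x - 1\<bar> + \<bar>y\<bar> \<le> int n"
        "(i + x, j + (y - 1)) \<in> cells n (i, j) \<longleftrightarrow> \<bar>x\<bar> + \<bar>y - 1\<bar> \<le> int n"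
        "(i + x, j + y) \<in> cells n (i, j) \<longleftrightarrow> False" "(i + (x - 1), j + (y - 1)) \<in> cells n (i, j) \<longleftrightarrow> False"
        unfolding in_cells by blast+
      then show ?thesis
        unfolding 1 2 corner_count_odd [OF False, symmetric]
        unfolding eq xy shift_assoc
        by (simp only: of_bool_eq add_0_left add_0_right)
    qed
  qed
  finally show ?thesis .
qed

text \<open>After complementation the edges are still those of the larger diamond while only the
  vertices of the smaller one are covered. An edge with both ends there already belongs to the
  smaller diamond.\<close>

lemma matchings_aztec_Suc:
  "matchings (aztec_edges (Suc n) c) (aztec_vertices n c) =
   matchings (aztec_edges n c) (aztec_vertices n c)"
proof -
  obtain i j where c: "c = (i, j)" by force
  have sub: "e \<in> aztec_edges n c"
    if e: "e \<in> aztec_edges (Suc n) c" "e \<subseteq> aztec_vertices n c" for e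
    using e(1)
  proof (rule aztec_edgeE)
    fix m q assume eq: "e = hedge m q"
    obtain x y where xy: "m = i + x" "q = j + y" by (rule relative_coords)
    have "(m, q) \<in> aztec_vertices n c" "(m + 1, q) \<in> aztec_vertices n c"
      using e(2) by (auto simp: eq hedge_def)
    then show ?thesis
      using edge_corners [of x y "int n"]
      unfolding eq hedge_in_aztec_edges in_aztec_vertices c add_diff_cancel xy shift_assoc bex_simps face_dist_rel
      by auto
  next
    fix m q assume eq: "e = vedge m q"
    obtain x y where xy: "m = i + x" "q = j + y" by (rule relative_coords)
    have "(m, q) \<in> aztec_vertices n c" "(m, q + 1) \<in> aztec_vertices n c"
      using e(2) by (auto simp: eq vedge_def)
    then show ?thesis
      using edge_corners [of y x "int n"]
      unfolding eq vedge_in_aztec_edges in_aztec_vertices c add_diff_cancel xy shift_assoc bex_simps face_dist_rel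
      by (auto simp: add.commute)
  qed
  have "aztec_edges n c \<subseteq> aztec_edges (Suc n) c"
    unfolding aztec_edges_def internal_faces_def by (rule UN_mono) auto
  with sub show ?thesis by (fastforce simp: matchings_def)
qed


section \<open>Renewal of the face weights\<close>

definition edge_weight :: "(dedge \<Rightarrow> int) \<Rightarrow> (face \<Rightarrow> complex) \<Rightarrow> vertex set \<Rightarrow> complex" where
  "edge_weight \<phi> b e = (\<Sum>d | undirected d = e. of_int (\<phi> d) * b (right_face d))"

lemma undirected_eq_hedge:
  "undirected d = hedge m q \<longleftrightarrow> d = ((m, q), (m + 1, q)) \<or> d = ((m + 1, q), (m, q))"
  by (cases d) (auto simp: undirected_def hedge_def doubleton_eq_iff)

lemma undirected_eq_vedge:
  "undirected d = vedge m q \<longleftrightarrow> d = ((m, q), (m, q + 1)) \<or> d = ((m, q + 1), (m, q))"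
  by (cases d) (auto simp: undirected_def vedge_def doubleton_eq_iff)

lemma dedges_hedge: "{d. undirected d = hedge m q} = {((m, q), (m + 1, q)), ((m + 1, q), (m, q))}"
  unfolding undirected_eq_hedge by blast

lemma dedges_vedge: "{d. undirected d = vedge m q} = {((m, q), (m, q + 1)), ((m, q + 1), (m, q))}"
  unfolding undirected_eq_vedge by blast

lemma perfect_matching_iff:
  "perfect_matching k c N \<longleftrightarrow> N \<in> matchings (aztec_edges k c) (aztec_vertices k c)"
proof
  assume pm: "perfect_matching k c N"
  then have sub: "N \<subseteq> aztec_edges k c" and uniq: "\<And>v. v \<in> aztec_vertices k c \<Longrightarrow> \<exists>!e. e \<in> N \<and> v \<in> e"
    by (auto simp: perfect_matching_def)
  have "e \<inter> e' = {}" if "e \<in> N" "e' \<in> N" "e \<noteq> e'" for e e'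
    using that uniq aztec_edges_subset sub by blast
  then have "disjoint N" by (simp add: disjoint_def)
  moreover have "\<Union>N = aztec_vertices k c"
    using uniq aztec_edges_subset sub by blast
  ultimately show "N \<in> matchings (aztec_edges k c) (aztec_vertices k c)"
    using sub by (simp add: matchings_def)
next
  assume "N \<in> matchings (aztec_edges k c) (aztec_vertices k c)"
  then have sub: "N \<subseteq> aztec_edges k c" and dis: "disjoint N" and un: "\<Union>N = aztec_vertices k c"
    by (auto simp: matchings_def)
  have "\<exists>!e. e \<in> N \<and> v \<in> e" if "v \<in> aztec_vertices k c" for v
    using that dis unfolding un [symmetric] disjoint_def by blast
  with sub show "perfect_matching k c N" by (simp add: perfect_matching_def)
qed

text \<open>Expanding the product of the two-term sums gives choice functions picking a direction
  for each matched edge. The image of such a function is the oriented configuration, and injectivity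
  of \<open>undirected\<close> recovers the function from it.\<close>

lemma partition_function_conv:
  "partition_function k c \<phi> b = dimer_sum (aztec_edges k c) (aztec_vertices k c) (edge_weight \<phi> b)"
proof -
  let ?\<N> = "matchings (aztec_edges k c) (aztec_vertices k c)"
  let ?O = "\<lambda>N. \<Pi>\<^sub>E e\<in>N. {d. undirected d = e}"
  have fin\<N>: "finite ?\<N>" by (intro finite_matchings finite_aztec_edges)
  have finN: "finite N" if "N \<in> ?\<N>" for N
    using that finite_subset [OF _ finite_aztec_edges, of N k c] by (simp add: matchings_def)
  have find: "finite {d. undirected d = e}" if "e \<in> N" "N \<in> ?\<N>" for e N
  proof -
    have "e \<in> aztec_edges k c" using that by (auto simp: matchings_def)
    then show ?thesis by (rule aztec_edgeE) (simp_all add: dedges_hedge dedges_vedge)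
  qed
  have "dimer_sum (aztec_edges k c) (aztec_vertices k c) (edge_weight \<phi> b) =
      (\<Sum>N\<in>?\<N>. \<Sum>h\<in>?O N. \<Prod>e\<in>N. of_int (\<phi> (h e)) * b (right_face (h e)))"
    unfolding dimer_sum_def edge_weight_def
    by (intro sum.cong refl prod_sum_PiE finN find)
  also have "\<dots> = (\<Sum>(N, h)\<in>Sigma ?\<N> ?O. \<Prod>e\<in>N. of_int (\<phi> (h e)) * b (right_face (h e)))"
    by (intro sum.Sigma ballI fin\<N> finite_PiE finN find)
  also have "\<dots> = partition_function k c \<phi> b"
    unfolding partition_function_def
  proof (rule sum.reindex_bij_witness
      [where j = "\<lambda>(N, h). h ` N" and i = "\<lambda>M. (undirected ` M, \<lambda>e\<in>undirected ` M. inv_into M undirected e)"])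
    fix a assume "a \<in> Sigma ?\<N> ?O"
    then obtain N h where a: "a = (N, h)" and N: "N \<in> ?\<N>" and h: "h \<in> ?O N" by auto
    have und: "undirected (h e) = e" if "e \<in> N" for e using h that by auto
    have img: "undirected ` h ` N = N" by (auto simp: und image_image)
    have inj: "inj_on undirected (h ` N)" by (rule inj_on_inverseI [of _ h]) (metis imageE und)
    have "(\<lambda>e\<in>N. inv_into (h ` N) undirected e) = h"
    proof (rule extensionalityI [of _ N])
      fix e assume "e \<in> N"
      then show "(\<lambda>e\<in>N. inv_into (h ` N) undirected e) e = h e"
        using inv_into_f_f [OF inj, of "h e"] by (simp add: und)
    qed (use h in \<open>auto simp: PiE_def\<close>)
    then show "(\<lambda>M. (undirected ` M, \<lambda>e\<in>undirected ` M. inv_into M undirected e)) ((\<lambda>(N, h). h ` N) a) = a"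
      by (simp add: a img)
    have "h ` N \<subseteq> aztec_dedges k c"
      using N und by (auto simp: aztec_dedges_def matchings_def)
    then show "(\<lambda>(N, h). h ` N) a \<in> {M. oriented_dimer k c M}"
      using N inj by (simp add: a oriented_dimer_def perfect_matching_iff img)
    have "inj_on h N" using und by (metis inj_onI)
    then show "(\<Prod>e\<in>(\<lambda>(N, h). h ` N) a. of_int (\<phi> e) * b (right_face e)) =
        (case a of (N, h) \<Rightarrow> \<Prod>e\<in>N. of_int (\<phi> (h e)) * b (right_face (h e)))"
      by (simp add: a prod.reindex)
  next
    fix M assume "M \<in> {M. oriented_dimer k c M}"
    then have M: "undirected ` M \<in> ?\<N>" "inj_on undirected M"
      by (auto simp: oriented_dimer_def perfect_matching_iff)
    show "(\<lambda>(N, h). h ` N) (undirected ` M, \<lambda>e\<in>undirected ` M. inv_into M undirected e) = M"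
      using M(2) by (simp add: image_image)
    show "(undirected ` M, \<lambda>e\<in>undirected ` M. inv_into M undirected e) \<in> Sigma ?\<N> ?O"
      using M by auto
  qed
  finally show ?thesis by simp
qed

lemma edge_weight_hedge:
  assumes "\<phi> ((m + 1, q), (m, q)) = - \<phi> ((m, q), (m + 1, q))"
  shows "edge_weight \<phi> b (hedge m q) = of_int (\<phi> ((m, q), (m + 1, q))) * (b (m, q - 1) - b (m, q))"
  unfolding edge_weight_def dedges_hedge using assms by (simp add: algebra_simps)

lemma edge_weight_vedge:
  assumes "\<phi> ((m, q + 1), (m, q)) = - \<phi> ((m, q), (m, q + 1))"
  shows "edge_weight \<phi> b (vedge m q) = of_int (\<phi> ((m, q), (m, q + 1))) * (b (m, q) - b (m - 1, q))"
  unfolding edge_weight_def dedges_vedge using assms by (simp add: algebra_simps)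

text \<open>\<open>dskp_num / dskp_den\<close> is the solution \<open>X\<close> of the dSKP equation whose other five
  entries are \<open>c\<close> (opposite to \<open>X\<close>) and the two opposite pairs \<open>e\<close>, \<open>w\<close> and \<open>n\<close>, \<open>s\<close>.\<close>

definition dskp_num :: "complex \<Rightarrow> complex \<Rightarrow> complex \<Rightarrow> complex \<Rightarrow> complex \<Rightarrow> complex" where
  "dskp_num c e w n s = (n + s) * e * w - (e + w) * n * s + c * (n * s - e * w)"

definition dskp_den :: "complex \<Rightarrow> complex \<Rightarrow> complex \<Rightarrow> complex \<Rightarrow> complex \<Rightarrow> complex" where
  "dskp_den c e w n s = c * (n + s - e - w) + e * w - n * s"

text \<open>These factorisations turn the new edge weights into old ones: in \<open>X - n\<close>,
  the factor \<open>c - s\<close> belongs to the opposite edge of the cell, and \<open>e - n\<close>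
  and \<open>w - n\<close> are, up to sign, gauge factors at the two ends of the edge.\<close>

lemma dskp_diff:
  assumes "dskp_den c e w n s \<noteq> 0"
  defines "X \<equiv> dskp_num c e w n s / dskp_den c e w n s"
  shows "X - e = (c - w) * (n - e) * (s - e) / dskp_den c e w n s"
    and "X - w = (c - e) * (n - w) * (s - w) / dskp_den c e w n s"
    and "X - n = - ((c - s) * (e - n) * (w - n)) / dskp_den c e w n s"
    and "X - s = - ((c - n) * (e - s) * (w - s)) / dskp_den c e w n s"
proof -
  let ?N = "dskp_num c e w n s" and ?D = "dskp_den c e w n s"
  have "?N - e * ?D = (c - w) * (n - e) * (s - e)" "?N - w * ?D = (c - e) * (n - w) * (s - w)"
    "?N - n * ?D = - ((c - s) * (e - n) * (w - n))" "?N - s * ?D = - ((c - n) * (e - s) * (w - s))"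
    unfolding dskp_num_def dskp_den_def by algebra+
  moreover have "X - t = (?N - t * ?D) / ?D" for t
    using assms(1) by (simp add: X_def diff_divide_distrib)
  ultimately show "X - e = (c - w) * (n - e) * (s - e) / ?D" "X - w = (c - e) * (n - w) * (s - w) / ?D"
    "X - n = - ((c - s) * (e - n) * (w - n)) / ?D" "X - s = - ((c - n) * (e - s) * (w - s)) / ?D"
    by simp_all
qed

fun num_at :: "(face \<Rightarrow> complex) \<Rightarrow> face \<Rightarrow> complex" where
  "num_at b (i, j) = dskp_num (b (i, j)) (b (i + 1, j)) (b (i - 1, j)) (b (i, j + 1)) (b (i, j - 1))"

fun den_at :: "(face \<Rightarrow> complex) \<Rightarrow> face \<Rightarrow> complex" where
  "den_at b (i, j) = dskp_den (b (i, j)) (b (i + 1, j)) (b (i - 1, j)) (b (i, j + 1)) (b (i, j - 1))"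

definition update_weights :: "nat \<Rightarrow> face \<Rightarrow> (face \<Rightarrow> complex) \<Rightarrow> face \<Rightarrow> complex" where
  "update_weights n c b f = (if f \<in> cells n c then num_at b f / den_at b f else b f)"

text \<open>Up to sign, the difference of the weights of the two faces around a vertex that are not
  updated. These are the gauge factors that turn the edge weights produced by urban renewal into
  differences of face weights.\<close>

fun vertex_gauge :: "nat \<Rightarrow> face \<Rightarrow> (face \<Rightarrow> complex) \<Rightarrow> vertex \<Rightarrow> complex" where
  "vertex_gauge n c b (m, q) = (if even m then 1 else -1) *
     (if even (face_dist c (m, q) + int n) then b (m - 1, q) - b (m, q - 1)
      else b (m - 1, q - 1) - b (m, q))"

text \<open>The sign by which the dimer sum over the full cell differs from the dSKP
  denominator.\<close>

fun cell_sign :: "(dedge \<Rightarrow> int) \<Rightarrow> face \<Rightarrow> int" where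
  "cell_sign \<phi> (i, j) = \<phi> ((i, j), (i + 1, j)) * \<phi> ((i, j + 1), (i + 1, j + 1))"

lemma parity_face_dist: "even (face_dist (i, j) (a, b)) \<longleftrightarrow> even (i + j + a + b)"
  by auto

text \<open>Passing from the directions white to black to the directions east and north reverses two
  of the four edges, whatever the colour of the corner \<open>(i, j)\<close>, so the product remains
  -1.\<close>

lemma kasteleyn_face:
  assumes K: "kasteleyn_orientation k c \<phi>" and f: "(i, j) \<in> internal_faces k c"
  defines "H \<equiv> \<phi> ((i, j), (i + 1, j))" and "H' \<equiv> \<phi> ((i, j + 1), (i + 1, j + 1))"
    and "V \<equiv> \<phi> ((i, j), (i, j + 1))" and "V' \<equiv> \<phi> ((i + 1, j), (i + 1, j + 1))"
  shows "H \<in> {-1, 1}" "H' \<in> {-1, 1}" "V \<in> {-1, 1}" "V' \<in> {-1, 1}"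
    and "\<phi> ((i + 1, j), (i, j)) = - H" "\<phi> ((i + 1, j + 1), (i, j + 1)) = - H'"
    "\<phi> ((i, j + 1), (i, j)) = - V" "\<phi> ((i + 1, j + 1), (i + 1, j)) = - V'"
    and "H * H' * V * V' = -1"
proof -
  have skew: "\<phi> (u, v) \<in> {-1, 1}" "\<phi> (v, u) = - \<phi> (u, v)" if "{u, v} \<in> face_edges (i, j)" for u v
  proof -
    have "(u, v) \<in> aztec_dedges k c"
      using that f by (auto simp: aztec_dedges_def undirected_def aztec_edges_def)
    with K show "\<phi> (u, v) \<in> {-1, 1}" "\<phi> (v, u) = - \<phi> (u, v)"
      unfolding kasteleyn_orientation_def by blast+
  qed
  have edges: "{(i, j), (i + 1, j)} \<in> face_edges (i, j)" "{(i, j + 1), (i + 1, j + 1)} \<in> face_edges (i, j)"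
    "{(i, j), (i, j + 1)} \<in> face_edges (i, j)" "{(i + 1, j), (i + 1, j + 1)} \<in> face_edges (i, j)"
    by (simp_all add: hedge_in_face_edges [unfolded hedge_def] vedge_in_face_edges [unfolded vedge_def])
  show signs: "H \<in> {-1, 1}" "H' \<in> {-1, 1}" "V \<in> {-1, 1}" "V' \<in> {-1, 1}"
    unfolding H_def H'_def V_def V'_def by (fact edges [THEN skew(1)])+
  show skews: "\<phi> ((i + 1, j), (i, j)) = - H" "\<phi> ((i + 1, j + 1), (i, j + 1)) = - H'"
    "\<phi> ((i, j + 1), (i, j)) = - V" "\<phi> ((i + 1, j + 1), (i + 1, j)) = - V'"
    unfolding H_def H'_def V_def V'_def by (fact edges [THEN skew(2)])+
  have undirected_iff: "undirected e \<in> face_edges (i, j) \<longleftrightarrow>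
      e = ((i, j), (i + 1, j)) \<or> e = ((i + 1, j), (i, j)) \<or>
      e = ((i + 1, j), (i + 1, j + 1)) \<or> e = ((i + 1, j + 1), (i + 1, j)) \<or>
      e = ((i, j + 1), (i + 1, j + 1)) \<or> e = ((i + 1, j + 1), (i, j + 1)) \<or>
      e = ((i, j), (i, j + 1)) \<or> e = ((i, j + 1), (i, j))" for e
    by (simp only: face_edges_conv insert_iff empty_iff undirected_eq_hedge undirected_eq_vedge
      disj_assoc simp_thms)
  have "(\<Prod>e | undirected e \<in> face_edges (i, j) \<and> white (fst e). \<phi> e) = H * H' * V * V'"
  proof (cases "even (i + j)")
    case True
    then have w: "white (i, j)" "white (i + 1, j + 1)" "\<not> white (i + 1, j)" "\<not> white (i, j + 1)" by auto
    have "{e. undirected e \<in> face_edges (i, j) \<and> white (fst e)} =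
        {((i, j), (i + 1, j)), ((i + 1, j + 1), (i, j + 1)), ((i, j), (i, j + 1)), ((i + 1, j + 1), (i + 1, j))}"
      unfolding undirected_iff using w by (auto simp del: white.simps)
    then show ?thesis by (simp add: skews flip: H_def V_def)
  next
    case False
    then have w: "\<not> white (i, j)" "\<not> white (i + 1, j + 1)" "white (i + 1, j)" "white (i, j + 1)" by auto
    have "{e. undirected e \<in> face_edges (i, j) \<and> white (fst e)} =
        {((i + 1, j), (i, j)), ((i, j + 1), (i + 1, j + 1)), ((i, j + 1), (i, j)), ((i + 1, j), (i + 1, j + 1))}"
      unfolding undirected_iff using w by (auto simp del: white.simps)
    then show ?thesis by (simp add: skews flip: H'_def V'_def)
  qed
  moreover have "(\<Prod>e | undirected e \<in> face_edges (i, j) \<and> white (fst e). \<phi> e) = -1"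
    using K f unfolding kasteleyn_orientation_def by blast
  ultimately show "H * H' * V * V' = -1" by simp
qed


text \<open>The sign \<open>s\<close> cancels on every edge, which has two ends. It is kept free
  because inverting all face weights makes the gauge factors change sign, and that case is covered
  by \<open>s = -1\<close>.\<close>

lemma urban_renewal:
  assumes K: "kasteleyn_orientation (Suc n) c \<phi>"
    and den: "\<And>f. f \<in> cells n c \<Longrightarrow> den_at b f \<noteq> 0"
    and gauge: "\<And>v. v \<in> aztec_vertices (Suc n) c \<Longrightarrow> vertex_gauge n c b v \<noteq> 0"
    and s: "s * s = 1"
  shows "partition_function (Suc n) c \<phi> b * (\<Prod>v\<in>aztec_vertices n c. s * vertex_gauge n c b v) =
    (\<Prod>f\<in>cells n c. of_int (cell_sign \<phi> f) * den_at b f) * partition_function n c \<phi> (update_weights n c b)"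
proof -
  let ?g = "\<lambda>v. s * vertex_gauge n c b v"
  let ?w = "edge_weight \<phi> b" and ?w' = "edge_weight \<phi> (update_weights n c b)"
  let ?\<kappa> = "\<lambda>e. ?w' e / (\<Prod>v\<in>e. ?g v)"
  let ?K = "\<lambda>f. of_int (cell_sign \<phi> f) * den_at b f :: complex"
  \<comment> \<open>The weights \<open>?\<kappa>\<close> are the edge weights of the updated faces
    with the gauge removed. On one cell they turn out to be the opposite old weights divided by the
    full weight \<open>?K f\<close>.\<close>
  have cell: "dimer_sum (face_edges f) S ?w = ?K f * dimer_sum (face_edges f) (face_vertices f - S) ?\<kappa>"
    if f: "f \<in> cells n c" and S: "S \<subseteq> face_vertices f" for f S
  proof -
    obtain i j where ij: "f = (i, j)" by force
    obtain i0 j0 where c: "c = (i0, j0)" by force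
    have par: "even (i0 + j0 + i + j + int n)"
      using f unfolding ij c cells_def mem_Collect_eq even_add parity_face_dist by blast
    have internal: "(i, j) \<in> internal_faces (Suc n) c"
      using f by (auto simp: ij cells_def internal_faces_def)
    define H H' V V' where phi: "H = \<phi> ((i, j), (i + 1, j))" "H' = \<phi> ((i, j + 1), (i + 1, j + 1))"
      "V = \<phi> ((i, j), (i, j + 1))" "V' = \<phi> ((i + 1, j), (i + 1, j + 1))"
    note kf = kasteleyn_face [OF K internal, folded phi]
    define h h' v v' :: complex where hv: "h = of_int H" "h' = of_int H'" "v = of_int V" "v' = of_int V'"
    define C E W N T where b: "C = b (i, j)" "E = b (i + 1, j)" "W = b (i - 1, j)" "N = b (i, j + 1)"
      "T = b (i, j - 1)"
    define X where "X = update_weights n c b (i, j)"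
    define D where "D = dskp_den C E W N T"
    have D: "D \<noteq> 0" using den [OF f] by (simp add: ij b D_def)
    have X: "X = dskp_num C E W N T / dskp_den C E W N T"
      using f by (simp add: X_def update_weights_def ij b)
    note diff = dskp_diff [of C E W N T, folded X D_def, OF D]
    \<comment> \<open>The neighbours of a cell have the other parity and keep their weights, so in
      the four new edge weights only the centre is replaced, by \<open>X\<close>.\<close>
    have not_cell: "(i + 1, j) \<notin> cells n c" "(i - 1, j) \<notin> cells n c"
      "(i, j + 1) \<notin> cells n c" "(i, j - 1) \<notin> cells n c"
      using par unfolding cells_def c mem_Collect_eq even_add parity_face_dist by auto
    have w: "?w (hedge i j) = h * (T - C)" "?w (hedge i (j + 1)) = h' * (C - N)"
      "?w (vedge i j) = v * (C - W)" "?w (vedge (i + 1) j) = v' * (E - C)"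
      using edge_weight_hedge [of \<phi> i j b] edge_weight_hedge [of \<phi> i "j + 1" b]
        edge_weight_vedge [of \<phi> i j b] edge_weight_vedge [of \<phi> "i + 1" j b] kf
      by (simp_all add: b phi hv)
    have w': "?w' (hedge i j) = h * (T - X)" "?w' (hedge i (j + 1)) = h' * (X - N)"
      "?w' (vedge i j) = v * (X - W)" "?w' (vedge (i + 1) j) = v' * (E - X)"
      using edge_weight_hedge [of \<phi> i j "update_weights n c b"] edge_weight_hedge [of \<phi> i "j + 1" "update_weights n c b"]
        edge_weight_vedge [of \<phi> i j "update_weights n c b"] edge_weight_vedge [of \<phi> "i + 1" j "update_weights n c b"] kf
      by (simp_all add: b phi hv X_def not_cell update_weights_def [of n c b "(i + 1, j)"]
          update_weights_def [of n c b "(i - 1, j)"] update_weights_def [of n c b "(i, j + 1)"] update_weights_def [of n c b "(i, j - 1)"])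
    \<comment> \<open>A horizontal edge joins columns of opposite parity, so the signs at its two
      ends multiply to -1; on a vertical edge they multiply to 1. These are the signs demanded by
      \<open>dskp_diff\<close>.\<close>
    define sg :: complex where "sg = (if even i then 1 else -1)"
    have sg: "sg * sg = 1" by (simp add: sg_def)
    have g: "vertex_gauge n c b (i, j) = sg * (W - T)" "vertex_gauge n c b (i + 1, j) = - sg * (T - E)"
      "vertex_gauge n c b (i + 1, j + 1) = - sg * (N - E)" "vertex_gauge n c b (i, j + 1) = sg * (W - N)"
      using par unfolding vertex_gauge.simps c even_add [of "face_dist (i0, j0) _"] parity_face_dist
      by (auto simp: sg_def b)
    have "face_vertices f \<subseteq> aztec_vertices (Suc n) c"
      using internal unfolding aztec_vertices_def ij by blast
    then have ne: "W - T \<noteq> 0" "T - E \<noteq> 0" "N - E \<noteq> 0" "W - N \<noteq> 0"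
      using gauge [of "(i, j)"] gauge [of "(i + 1, j)"] gauge [of "(i + 1, j + 1)"] gauge [of "(i, j + 1)"]
      unfolding g by (auto simp: ij)
    have gg: "(\<Prod>v\<in>hedge i j. ?g v) = - ((W - T) * (T - E))"
      "(\<Prod>v\<in>hedge i (j + 1). ?g v) = - ((W - N) * (N - E))"
      "(\<Prod>v\<in>vedge i j. ?g v) = (W - T) * (W - N)"
      "(\<Prod>v\<in>vedge (i + 1) j. ?g v) = (T - E) * (N - E)"
      using s sg by (simp_all add: hedge_def vedge_def g del: vertex_gauge.simps) algebra+
    let ?\<Delta> = "?w (hedge i j) * ?w (hedge i (j + 1)) + ?w (vedge (i + 1) j) * ?w (vedge i j)"
    have HV: "v * v' = - (h * h')" "h * h = 1" "h' * h' = 1" "v * v = 1" "v' * v' = 1"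
      using kf by (auto simp: hv)
    \<comment> \<open>By the Kasteleyn condition \<open>v * v'\<close> is minus
      \<open>h * h'\<close>; the sum over the two perfect matchings becomes a difference, in which
      the squares of \<open>C\<close> cancel.\<close>
    have \<Delta>: "?\<Delta> = h * h' * D"
    proof -
      have "?\<Delta> = h * h' * ((T - C) * (C - N)) + v * v' * ((E - C) * (C - W))"
        unfolding w by (simp only: mult_ac)
      also have "\<dots> = h * h' * D" unfolding HV by (simp add: D_def dskp_den_def algebra_simps)
      finally show ?thesis .
    qed
    have \<Delta>_ne: "?\<Delta> \<noteq> 0" unfolding \<Delta> using D HV by auto
    have tx: "T - X = (C - N) * (E - T) * (W - T) / D" "X - N = - ((C - T) * (E - N) * (W - N)) / D"
      "X - W = (C - E) * (N - W) * (T - W) / D" "E - X = - ((C - W) * (N - E) * (T - E)) / D"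
      using diff by (simp_all add: minus_diff_eq [of X, symmetric] del: minus_diff_eq)
    have "?w' (hedge i j) = h * (C - N) / D * (\<Prod>v\<in>hedge i j. ?g v)"
      "?w' (hedge i (j + 1)) = h' * (T - C) / D * (\<Prod>v\<in>hedge i (j + 1). ?g v)"
      "?w' (vedge (i + 1) j) = v' * (W - C) / D * (\<Prod>v\<in>vedge (i + 1) j. ?g v)"
      "?w' (vedge i j) = v * (C - E) / D * (\<Prod>v\<in>vedge i j. ?g v)"
      unfolding w' gg tx by (simp_all only: times_divide_eq_left times_divide_eq_right) (simp_all add: algebra_simps)
    then have "?\<kappa> (hedge i j) = h * (C - N) / D" "?\<kappa> (hedge i (j + 1)) = h' * (T - C) / D"
      "?\<kappa> (vedge (i + 1) j) = v' * (W - C) / D" "?\<kappa> (vedge i j) = v * (C - E) / D"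
      using ne unfolding gg by simp_all
    moreover have "h * (C - N) / D = ?w (hedge i (j + 1)) / ?\<Delta>" "h' * (T - C) / D = ?w (hedge i j) / ?\<Delta>"
      "v' * (W - C) / D = ?w (vedge i j) / ?\<Delta>" "v * (C - E) / D = ?w (vedge (i + 1) j) / ?\<Delta>"
      unfolding frac_eq_eq [OF D \<Delta>_ne] unfolding \<Delta> unfolding w using HV by algebra+
    ultimately have \<kappa>: "?\<kappa> (hedge i j) = ?w (hedge i (j + 1)) / ?\<Delta>" "?\<kappa> (hedge i (j + 1)) = ?w (hedge i j) / ?\<Delta>"
      "?\<kappa> (vedge (i + 1) j) = ?w (vedge i j) / ?\<Delta>" "?\<kappa> (vedge i j) = ?w (vedge (i + 1) j) / ?\<Delta>"
      by (simp_all only:)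
    have "of_int (cell_sign \<phi> f) = h * h'" by (simp add: ij phi hv)
    then have Kf: "?K f = ?\<Delta>" unfolding \<Delta> by (simp add: ij D_def b)
    show ?thesis
      unfolding Kf
      using dimer_sum_four_cycle_complement [of "(i, j)" "(i + 1, j)" "(i + 1, j + 1)" "(i, j + 1)"
        "face_vertices f" S ?\<Delta> ?w ?\<kappa>] \<Delta>_ne \<kappa> S
      by (simp add: ij face_edges.simps hedge_def vedge_def insert_commute)
  qed
  have EV: "finite (face_edges f)" "finite (face_vertices f)" for f
    by (cases f; simp)+
  have "partition_function (Suc n) c \<phi> b =
      (\<Sum>S\<in>cell_states (cells n c) face_vertices (aztec_vertices (Suc n) c).
        \<Prod>f\<in>cells n c. dimer_sum (face_edges f) (S f) ?w)"
    unfolding partition_function_conv aztec_edges_Suc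
    by (intro dimer_sum_cells finite_cells EV disjoint_cells conjI face_edges_subset face_edges_nonempty)
  also have "\<dots> = (\<Prod>f\<in>cells n c. ?K f) *
      (\<Sum>S\<in>cell_states (cells n c) face_vertices (aztec_vertices n c).
        \<Prod>f\<in>cells n c. dimer_sum (face_edges f) (S f) ?\<kappa>)"
    by (intro sum_cell_states_complement finite_cells card_cells_at_vertex cell)
  also have "(\<Sum>S\<in>cell_states (cells n c) face_vertices (aztec_vertices n c).
        \<Prod>f\<in>cells n c. dimer_sum (face_edges f) (S f) ?\<kappa>) =
      dimer_sum (aztec_edges (Suc n) c) (aztec_vertices n c) ?\<kappa>"
    unfolding aztec_edges_Suc
    by (intro dimer_sum_cells [symmetric] finite_cells EV disjoint_cells conjI face_edges_subset face_edges_nonempty)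
  finally have Z: "partition_function (Suc n) c \<phi> b = (\<Prod>f\<in>cells n c. ?K f) *
      dimer_sum (aztec_edges n c) (aztec_vertices n c) ?\<kappa>"
    by (simp only: dimer_sum_def matchings_aztec_Suc)
  \<comment> \<open>Putting the gauge back turns \<open>?\<kappa>\<close> into the edge weights of
    the updated faces.\<close>
  have "dimer_sum (aztec_edges n c) (aztec_vertices n c) ?\<kappa> * (\<Prod>v\<in>aztec_vertices n c. ?g v) =
      dimer_sum (aztec_edges n c) (aztec_vertices n c) (\<lambda>e. ?\<kappa> e * (\<Prod>v\<in>e. ?g v))"
    by (rule dimer_sum_gauge [symmetric]) (rule finite_aztec_vertices)
  also have "\<dots> = partition_function n c \<phi> (update_weights n c b)"
    unfolding partition_function_conv
  proof (rule dimer_sum_cong)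
    fix e assume e: "e \<in> aztec_edges n c" "e \<subseteq> aztec_vertices n c"
    have "aztec_vertices n c \<subseteq> aztec_vertices (Suc n) c"
      unfolding aztec_vertices_def internal_faces_def by (rule UN_mono) auto
    with e(2) finite_aztec_vertices [of n c] gauge s have "(\<Prod>v\<in>e. ?g v) \<noteq> 0"
      by (subst prod_zero_iff) (auto simp: finite_subset simp del: vertex_gauge.simps)
    then show "?\<kappa> e * (\<Prod>v\<in>e. ?g v) = ?w' e" by simp
  qed
  finally show ?thesis unfolding Z by (simp only: mult.assoc)
qed


section \<open>Recursion for the ratio formula\<close>

text \<open>Inside, both sides are 1 + 4. At distance \<open>n + 1\<close> a face off the axes has
  one vertex in the smaller diamond and two neighbouring cells, a face on an axis none and one. The
  bound \<open>n \<ge> 0\<close> excludes the centre from the second case.\<close>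

lemma boundary_count:
  fixes x y n :: int
  defines "P \<equiv> \<lambda>x y. \<bar>x\<bar> + \<bar>y\<bar> < n \<or> \<bar>x - 1\<bar> + \<bar>y\<bar> < n \<or> \<bar>x - 1\<bar> + \<bar>y - 1\<bar> < n \<or> \<bar>x\<bar> + \<bar>y - 1\<bar> < n"
  assumes "odd (x + y + n)" "\<bar>x\<bar> + \<bar>y\<bar> \<le> n + 1" "n \<ge> 0"
  shows "1 + (of_bool (P x y) + (of_bool (P (x + 1) y) + (of_bool (P (x + 1) (y + 1)) + of_bool (P x (y + 1))))) =
    of_bool (\<bar>x\<bar> + \<bar>y\<bar> \<le> n) + (of_bool (\<bar>x + 1\<bar> + \<bar>y\<bar> \<le> n) + (of_bool (\<bar>x - 1\<bar> + \<bar>y\<bar> \<le> n) +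
      (of_bool (\<bar>x\<bar> + \<bar>y + 1\<bar> \<le> n) + of_bool (\<bar>x\<bar> + \<bar>y - 1\<bar> \<le> n))) :: nat)"
proof -
  have "\<bar>x\<bar> + \<bar>y\<bar> \<noteq> n" by (rule abs_parity) fact
  with assms(3) consider "\<bar>x\<bar> + \<bar>y\<bar> \<le> n - 1" | "\<bar>x\<bar> + \<bar>y\<bar> = n + 1" by linarith
  then show ?thesis
  proof cases
    case 1
    then have "\<bar>x\<bar> + \<bar>y\<bar> < n" by linarith
    then have "P x y" "P (x + 1) y" "P (x + 1) (y + 1)" "P x (y + 1)" by (simp_all add: P_def)
    moreover have "\<bar>x + 1\<bar> + \<bar>y\<bar> \<le> n" "\<bar>x - 1\<bar> + \<bar>y\<bar> \<le> n" "\<bar>x\<bar> + \<bar>y + 1\<bar> \<le> n" "\<bar>x\<bar> + \<bar>y - 1\<bar> \<le> n"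
      using 1 by linarith+
    ultimately show ?thesis using 1 by simp
  next
    case 2
    have "P x y \<longleftrightarrow> x > 0 \<and> y > 0" "P (x + 1) y \<longleftrightarrow> x < 0 \<and> y > 0"
      "P (x + 1) (y + 1) \<longleftrightarrow> x < 0 \<and> y < 0" "P x (y + 1) \<longleftrightarrow> x > 0 \<and> y < 0"
      unfolding P_def using 2 by linarith+
    moreover have "\<bar>x + 1\<bar> + \<bar>y\<bar> \<le> n \<longleftrightarrow> x < 0" "\<bar>x - 1\<bar> + \<bar>y\<bar> \<le> n \<longleftrightarrow> x > 0"
      "\<bar>x\<bar> + \<bar>y + 1\<bar> \<le> n \<longleftrightarrow> y < 0" "\<bar>x\<bar> + \<bar>y - 1\<bar> \<le> n \<longleftrightarrow> y > 0" "\<not> \<bar>x\<bar> + \<bar>y\<bar> \<le> n"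
      using 2 by linarith+
    moreover have "x \<noteq> 0 \<or> y \<noteq> 0" using 2 assms(4) by auto
    ultimately show ?thesis
      by (cases x "0 :: int" rule: linorder_cases; cases y "0 :: int" rule: linorder_cases)
        (simp_all only: of_bool_eq simp_thms, simp_all)
  qed
qed

fun adjacent_faces :: "face \<Rightarrow> face set" where
  "adjacent_faces (i, j) = {(i + 1, j), (i - 1, j), (i, j + 1), (i, j - 1)}"

definition other_faces :: "nat \<Rightarrow> face \<Rightarrow> face set" where
  "other_faces n c = {f. face_dist c f \<le> int n + 1 \<and> odd (face_dist c f + int n)}"

lemma aztec_faces_Suc: "aztec_faces (Suc n) c = cells n c \<union> other_faces n c" "cells n c \<inter> other_faces n c = {}"
proof -
  have "f \<in> aztec_faces (Suc n) c \<longleftrightarrow> f \<in> cells n c \<union> other_faces n c" for f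
  proof -
    have S: "int (Suc n) = int n + 1" by simp
    have "face_dist c f \<le> int n + 1 \<longleftrightarrow> face_dist c f \<le> int n" if "even (face_dist c f + int n)"
    proof -
      from that have "face_dist c f \<noteq> int n + 1" by auto
      then show ?thesis by linarith
    qed
    then show ?thesis
      unfolding aztec_faces_conv cells_def other_faces_def mem_Collect_eq Un_iff S by blast
  qed
  then show "aztec_faces (Suc n) c = cells n c \<union> other_faces n c" by blast
  show "cells n c \<inter> other_faces n c = {}" by (auto simp: cells_def other_faces_def)
qed

lemma finite_other_faces: "finite (other_faces n c)"
  using finite_aztec_faces [of "Suc n" c] unfolding aztec_faces_Suc by simp

lemma adjacent_sym: "f \<in> adjacent_faces g \<longleftrightarrow> g \<in> adjacent_faces f"
  by (cases f; cases g) auto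

lemma adjacent_to_cell:
  assumes "f \<in> cells n c" "g \<in> adjacent_faces f"
  shows "g \<in> other_faces n c"
proof -
  obtain i j a b a' b' where eq: "c = (i, j)" "f = (a, b)" "g = (a', b')" by (metis prod.exhaust)
  have "even (face_dist c f + int n)" "face_dist c f \<le> int n" using assms by (auto simp: cells_def)
  moreover have "face_dist c g = face_dist c f + 1 \<or> face_dist c g = face_dist c f - 1"
    using assms(2) by (auto simp: eq)
  ultimately show ?thesis by (auto simp: other_faces_def)
qed

lemma aztec_vertices_Suc: "aztec_vertices n c \<subseteq> aztec_vertices (Suc n) c"
  unfolding aztec_vertices_def internal_faces_def by (rule UN_mono) auto

text \<open>These are the two faces entering the gauge factor. Faces at the vertex are within
  distance \<open>n + 2\<close>, and parity rules out equality, so both belong to the larger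
  diamond.\<close>

lemma faces_at_vertex:
  assumes "(m, q) \<in> aztec_vertices (Suc n) c"
  shows "{g \<in> other_faces n c. (m, q) \<in> face_vertices g} =
    (if even (face_dist c (m, q) + int n) then {(m - 1, q), (m, q - 1)} else {(m - 1, q - 1), (m, q)})"
proof -
  obtain i j where c: "c = (i, j)" by force
  let ?F = "{(m, q), (m - 1, q), (m - 1, q - 1), (m, q - 1)}"
  have "\<exists>f\<in>?F. face_dist c f < int (Suc n)"
    using assms unfolding in_aztec_vertices .
  then have le: "face_dist c f \<le> int n + 2" if "f \<in> ?F" for f
    using that unfolding c by auto
  have mem: "f \<in> other_faces n c \<longleftrightarrow> odd (face_dist c f + int n)" if "f \<in> ?F" for f
  proof -
    have "face_dist c f \<noteq> int n + 2" if "odd (face_dist c f + int n)"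
      using that by auto
    with le [OF that] have "face_dist c f \<le> int n + 1" if "odd (face_dist c f + int n)"
      using that by linarith
    then show ?thesis unfolding other_faces_def mem_Collect_eq by blast
  qed
  define P where "P f \<longleftrightarrow> odd (face_dist c f + int n)" for f
  have "P (m - 1, q) \<longleftrightarrow> \<not> P (m, q)" "P (m, q - 1) \<longleftrightarrow> \<not> P (m, q)" "P (m - 1, q - 1) \<longleftrightarrow> P (m, q)"
    unfolding P_def c even_add parity_face_dist by auto
  then have "{g \<in> ?F. P g} = (if \<not> P (m, q) then {(m - 1, q), (m, q - 1)} else {(m - 1, q - 1), (m, q)})"
    by (cases "P (m, q)") auto
  moreover have "{g \<in> other_faces n c. (m, q) \<in> face_vertices g} = {g \<in> ?F. P g}"
    unfolding in_face_vertices P_def using mem by blast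
  ultimately show ?thesis by (simp only: P_def not_not)
qed

text \<open>The two sides are the exponents of \<open>b g\<close> on the two sides of
  \<open>prod_face_weights\<close>.\<close>

lemma card_other_face:
  assumes g: "g \<in> other_faces n c"
  shows "1 + card {v \<in> aztec_vertices n c. v \<in> face_vertices g} =
    of_bool (g \<in> aztec_faces n c) + card {f \<in> cells n c. g \<in> adjacent_faces f}"
proof -
  obtain i j a b where eq: "c = (i, j)" "g = (a, b)" by (metis prod.exhaust)
  obtain x y where xy: "a = i + x" "b = j + y" by (rule relative_coords)
  have par: "odd (x + y + int n)" "\<bar>x\<bar> + \<bar>y\<bar> \<le> int n + 1"
    using g unfolding other_faces_def eq xy face_dist_rel by auto
  have "{v \<in> aztec_vertices n c. v \<in> face_vertices g} =
      {v \<in> {(a, b), (a + 1, b), (a + 1, b + 1), (a, b + 1)}. v \<in> aztec_vertices n c}"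
    unfolding eq by auto
  also have "card \<dots> = of_bool ((a, b) \<in> aztec_vertices n c) + (of_bool ((a + 1, b) \<in> aztec_vertices n c) +
      (of_bool ((a + 1, b + 1) \<in> aztec_vertices n c) + of_bool ((a, b + 1) \<in> aztec_vertices n c)))"
    by (subst card_filter_conv_sum) simp_all
  finally have 1: "card {v \<in> aztec_vertices n c. v \<in> face_vertices g} = \<dots>" .
  have "{f \<in> cells n c. g \<in> adjacent_faces f} = {f \<in> {(a + 1, b), (a - 1, b), (a, b + 1), (a, b - 1)}. f \<in> cells n c}"
    unfolding eq adjacent_sym [of "(a, b)"] by auto
  also have "card \<dots> = of_bool ((a + 1, b) \<in> cells n c) + (of_bool ((a - 1, b) \<in> cells n c) +
      (of_bool ((a, b + 1) \<in> cells n c) + of_bool ((a, b - 1) \<in> cells n c)))"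
    by (subst card_filter_conv_sum) simp_all
  finally have 2: "card {f \<in> cells n c. g \<in> adjacent_faces f} = \<dots>" .
  have V: "(i + x', j + y') \<in> aztec_vertices n c \<longleftrightarrow> \<bar>x'\<bar> + \<bar>y'\<bar> < int n \<or> \<bar>x' - 1\<bar> + \<bar>y'\<bar> < int n \<or>
      \<bar>x' - 1\<bar> + \<bar>y' - 1\<bar> < int n \<or> \<bar>x'\<bar> + \<bar>y' - 1\<bar> < int n" for x' y'
    unfolding in_aztec_vertices eq shift_assoc bex_simps face_dist_rel by auto
  have "even (x + 1 + y + int n)" "even (x - 1 + y + int n)" "even (x + (y + 1) + int n)" "even (x + (y - 1) + int n)"
    using par by presburger+
  then have C: "(i + (x + 1), j + y) \<in> cells n c \<longleftrightarrow> \<bar>x + 1\<bar> + \<bar>y\<bar> \<le> int n"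
    "(i + (x - 1), j + y) \<in> cells n c \<longleftrightarrow> \<bar>x - 1\<bar> + \<bar>y\<bar> \<le> int n"
    "(i + x, j + (y + 1)) \<in> cells n c \<longleftrightarrow> \<bar>x\<bar> + \<bar>y + 1\<bar> \<le> int n"
    "(i + x, j + (y - 1)) \<in> cells n c \<longleftrightarrow> \<bar>x\<bar> + \<bar>y - 1\<bar> \<le> int n"
    unfolding eq in_cells by blast+
  have F: "g \<in> aztec_faces n c \<longleftrightarrow> \<bar>x\<bar> + \<bar>y\<bar> \<le> int n"
    unfolding aztec_faces_conv eq xy mem_Collect_eq face_dist_rel ..
  show ?thesis
    unfolding 1 2 F unfolding xy shift_assoc unfolding V C by (rule boundary_count) (use par in auto)
qed

fun adjacent_prod :: "(face \<Rightarrow> complex) \<Rightarrow> face \<Rightarrow> complex" where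
  "adjacent_prod b (i, j) = b (i + 1, j) * b (i - 1, j) * b (i, j + 1) * b (i, j - 1)"

fun corner_prod :: "nat \<Rightarrow> face \<Rightarrow> (face \<Rightarrow> complex) \<Rightarrow> vertex \<Rightarrow> complex" where
  "corner_prod n c b (m, q) = (if even (face_dist c (m, q) + int n) then b (m - 1, q) * b (m, q - 1)
     else b (m - 1, q - 1) * b (m, q))"

text \<open>The corner products come from inverting gauge factors, the adjacent products from
  inverting dSKP denominators. Double counting of incidences reduces the identity to one exponent
  per face.\<close>

lemma prod_face_weights:
  "(\<Prod>g\<in>other_faces n c. b g) * (\<Prod>v\<in>aztec_vertices n c. corner_prod n c b v) =
   (\<Prod>g\<in>aztec_faces n c - cells n c. b g) * (\<Prod>f\<in>cells n c. adjacent_prod b f)"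
proof -
  have "(\<Prod>v\<in>aztec_vertices n c. corner_prod n c b v) =
      (\<Prod>v\<in>aztec_vertices n c. \<Prod>g | g \<in> other_faces n c \<and> v \<in> face_vertices g. b g)"
  proof (rule prod.cong)
    fix v assume v: "v \<in> aztec_vertices n c"
    obtain m q where mq: "v = (m, q)" by force
    have v': "(m, q) \<in> aztec_vertices (Suc n) c" using v aztec_vertices_Suc mq by blast
    show "corner_prod n c b v = (\<Prod>g | g \<in> other_faces n c \<and> v \<in> face_vertices g. b g)"
      unfolding mq faces_at_vertex [OF v'] by simp
  qed simp
  also have "\<dots> = (\<Prod>g\<in>other_faces n c. \<Prod>v | v \<in> aztec_vertices n c \<and> v \<in> face_vertices g. b g)"
    by (rule prod.swap_restrict) (auto intro: finite_aztec_vertices finite_other_faces)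
  finally have 1: "(\<Prod>v\<in>aztec_vertices n c. corner_prod n c b v) =
      (\<Prod>g\<in>other_faces n c. b g ^ card {v \<in> aztec_vertices n c. v \<in> face_vertices g})"
    by simp
  have "(\<Prod>f\<in>cells n c. adjacent_prod b f) =
      (\<Prod>f\<in>cells n c. \<Prod>g | g \<in> other_faces n c \<and> g \<in> adjacent_faces f. b g)"
  proof (rule prod.cong)
    fix f assume "f \<in> cells n c"
    then have "{g. g \<in> other_faces n c \<and> g \<in> adjacent_faces f} = adjacent_faces f"
      using adjacent_to_cell by blast
    then show "adjacent_prod b f = (\<Prod>g | g \<in> other_faces n c \<and> g \<in> adjacent_faces f. b g)"
      by (cases f) (simp add: mult.assoc)
  qed simp
  also have "\<dots> = (\<Prod>g\<in>other_faces n c. \<Prod>f | f \<in> cells n c \<and> g \<in> adjacent_faces f. b g)"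
    by (rule prod.swap_restrict) (auto intro: finite_cells finite_other_faces)
  finally have 2: "(\<Prod>f\<in>cells n c. adjacent_prod b f) =
      (\<Prod>g\<in>other_faces n c. b g ^ card {f \<in> cells n c. g \<in> adjacent_faces f})"
    by simp
  have "aztec_faces n c - cells n c = {g \<in> other_faces n c. g \<in> aztec_faces n c}"
    by (auto simp: aztec_faces_conv cells_def other_faces_def)
  then have 3: "(\<Prod>g\<in>aztec_faces n c - cells n c. b g) = (\<Prod>g\<in>other_faces n c. b g ^ of_bool (g \<in> aztec_faces n c))"
    by (simp add: prod.inter_filter [OF finite_other_faces] of_bool_def if_distrib [of "\<lambda>k. _ ^ k"] cong: if_cong)
  show ?thesis
    unfolding 1 2 3 prod.distrib [symmetric]
  proof (rule prod.cong)
    fix g assume "g \<in> other_faces n c"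
    from card_other_face [OF this]
    show "b g * b g ^ card {v \<in> aztec_vertices n c. v \<in> face_vertices g} =
        b g ^ of_bool (g \<in> aztec_faces n c) * b g ^ card {f \<in> cells n c. g \<in> adjacent_faces f}"
      unfolding power_add [symmetric] power_Suc [symmetric] by (simp only: plus_1_eq_Suc)
  qed simp
qed

text \<open>The dSKP equation is invariant under inversion of all its entries: numerator and
  denominator trade places, up to the monomial of all five weights.\<close>

lemma dskp_den_inverse:
  assumes "c \<noteq> 0" "e \<noteq> 0" "w \<noteq> 0" "n \<noteq> 0" "s \<noteq> 0"
  shows "dskp_den (inverse c) (inverse e) (inverse w) (inverse n) (inverse s) =
      dskp_num c e w n s / (c * (e * w * n * s))"
proof -
  let ?P = "c * (e * w * n * s)"
  have "dskp_den (inverse c) (inverse e) (inverse w) (inverse n) (inverse s) =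
      inverse c * inverse n + inverse c * inverse s - inverse c * inverse e - inverse c * inverse w +
      inverse e * inverse w - inverse n * inverse s"
    by (simp add: dskp_den_def algebra_simps)
  moreover have "inverse c * inverse n = e * w * s / ?P" "inverse c * inverse s = e * w * n / ?P"
    "inverse c * inverse e = w * n * s / ?P" "inverse c * inverse w = e * n * s / ?P"
    "inverse e * inverse w = c * n * s / ?P" "inverse n * inverse s = c * e * w / ?P"
    using assms by (simp_all add: divide_simps)
  ultimately show ?thesis
    by (simp only: add_divide_distrib [symmetric] diff_divide_distrib [symmetric])
      (simp add: dskp_num_def algebra_simps)
qed

lemma dskp_num_inverse:
  assumes "c \<noteq> 0" "e \<noteq> 0" "w \<noteq> 0" "n \<noteq> 0" "s \<noteq> 0"
  shows "dskp_num (inverse c) (inverse e) (inverse w) (inverse n) (inverse s) =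
      dskp_den c e w n s / (c * (e * w * n * s))"
proof -
  have "inverse c * (inverse e * inverse w * inverse n * inverse s) * (c * (e * w * n * s)) = 1"
    using assms by (simp add: field_simps)
  then show ?thesis
    using dskp_den_inverse [of "inverse c" "inverse e" "inverse w" "inverse n" "inverse s"] assms
    by (simp del: inverse_mult_distrib)
qed

text \<open>Renewal is applied to \<open>b\<close> and to the inverted weights. The products
  \<open>S\<close> and \<open>G\<close> occur both times and cancel in the quotient; the remaining
  monomial in the face weights is the change of the prefactor.\<close>

lemma ratio_formula_Suc:
  assumes K: "kasteleyn_orientation (Suc n) c \<phi>"
    and nz: "\<And>f. f \<in> aztec_faces (Suc n) c \<Longrightarrow> b f \<noteq> 0"
    and num: "\<And>f. f \<in> cells n c \<Longrightarrow> num_at b f \<noteq> 0"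
    and den: "\<And>f. f \<in> cells n c \<Longrightarrow> den_at b f \<noteq> 0"
    and gauge: "\<And>v. v \<in> aztec_vertices (Suc n) c \<Longrightarrow> vertex_gauge n c b v \<noteq> 0"
  shows "ratio_formula (Suc n) c \<phi> b = ratio_formula n c \<phi> (update_weights n c b)"
    and "partition_function (Suc n) c \<phi> b = 0 \<longleftrightarrow> partition_function n c \<phi> (update_weights n c b) = 0"
proof -
  let ?b' = "update_weights n c b" and ?ib = "\<lambda>f. inverse (b f)"
  have adj: "b f \<noteq> 0" "adjacent_prod b f \<noteq> 0" if f: "f \<in> cells n c" for f
  proof -
    show "b f \<noteq> 0" using nz f by (auto simp: aztec_faces_Suc)
    have "\<And>g. g \<in> adjacent_faces f \<Longrightarrow> b g \<noteq> 0"
      using nz adjacent_to_cell [OF f] by (auto simp: aztec_faces_Suc)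
    then show "adjacent_prod b f \<noteq> 0" by (cases f) auto
  qed
  have inv: "den_at ?ib f = num_at b f / (b f * adjacent_prod b f)"
    "num_at ?ib f = den_at b f / (b f * adjacent_prod b f)" if f: "f \<in> cells n c" for f
    using adj [OF f] by (cases f; simp add: dskp_den_inverse dskp_num_inverse)+
  \<comment> \<open>The update commutes with inversion, so the smaller partition function obtained
    from the inverted weights is the numerator of the smaller ratio.\<close>
  have upd: "update_weights n c ?ib = (\<lambda>f. inverse (?b' f))"
    using inv adj num den by (auto simp: update_weights_def fun_eq_iff)
  \<comment> \<open>From \<open>1 / x - 1 / y = - (x - y) / (x * y)\<close>; this is where the sign
    -1 and the corner products arise.\<close>
  have corner: "corner_prod n c b v \<noteq> 0" "- 1 * vertex_gauge n c ?ib v = vertex_gauge n c b v / corner_prod n c b v"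
    if v: "v \<in> aztec_vertices (Suc n) c" for v
  proof -
    obtain m q where mq: "v = (m, q)" by force
    have b_nz: "b g \<noteq> 0" if "g \<in> (if even (face_dist c (m, q) + int n) then {(m - 1, q), (m, q - 1)}
        else {(m - 1, q - 1), (m, q)})" for g
      using that nz unfolding faces_at_vertex [OF v [unfolded mq], symmetric] aztec_faces_Suc by blast
    show "corner_prod n c b v \<noteq> 0" "- 1 * vertex_gauge n c ?ib v = vertex_gauge n c b v / corner_prod n c b v"
      using b_nz by (cases "even (face_dist c (m, q) + int n)"; simp add: mq field_simps)+
  qed
  define G where "G = (\<Prod>v\<in>aztec_vertices n c. vertex_gauge n c b v)"
  define Q where "Q = (\<Prod>v\<in>aztec_vertices n c. corner_prod n c b v)"
  define S where "S = (\<Prod>f\<in>cells n c. of_int (cell_sign \<phi> f) * den_at b f)"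
  define X where "X = (\<Prod>f\<in>cells n c. ?b' f)"
  define A where "A = (\<Prod>f\<in>cells n c. adjacent_prod b f)"
  define B where "B = (\<Prod>f\<in>cells n c. b f)"
  define z where "z = partition_function (Suc n) c \<phi> b"
  define z' where "z' = partition_function n c \<phi> ?b'"
  define zi where "zi = partition_function (Suc n) c \<phi> ?ib"
  define zi' where "zi' = partition_function n c \<phi> (\<lambda>f. inverse (?b' f))"
  have sign: "cell_sign \<phi> f \<noteq> 0" if "f \<in> cells n c" for f
  proof (cases f)
    case (Pair i j)
    have "(i, j) \<in> internal_faces (Suc n) c" using that by (auto simp: Pair cells_def internal_faces_def)
    from kasteleyn_face(1,2) [OF K this] show ?thesis by (auto simp: Pair)
  qed
  have ne: "G \<noteq> 0" "Q \<noteq> 0" "S \<noteq> 0" "A \<noteq> 0" "B \<noteq> 0"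
    unfolding G_def Q_def S_def A_def B_def
    using gauge corner(1) sign den adj aztec_vertices_Suc [of n c]
    by (auto simp: finite_cells finite_aztec_vertices simp del: vertex_gauge.simps corner_prod.simps)
  have eq1: "z * G = S * z'"
    using urban_renewal [OF K den gauge, of 1] by (simp add: z_def G_def S_def z'_def)
  have eq2: "zi * (G / Q) = S * (X / (B * A)) * zi'"
  proof -
    have "den_at ?ib f \<noteq> 0" if "f \<in> cells n c" for f
      using inv(1) [OF that] num [OF that] adj [OF that] by simp
    moreover have "vertex_gauge n c ?ib v \<noteq> 0" if "v \<in> aztec_vertices (Suc n) c" for v
      using corner [OF that] gauge [OF that] by (metis divide_eq_0_iff mult_zero_right)
    ultimately have "zi * (\<Prod>v\<in>aztec_vertices n c. - 1 * vertex_gauge n c ?ib v) =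
        (\<Prod>f\<in>cells n c. of_int (cell_sign \<phi> f) * den_at ?ib f) * zi'"
      unfolding zi_def zi'_def upd [symmetric] by (intro urban_renewal [OF K]) simp_all
    moreover have "(\<Prod>v\<in>aztec_vertices n c. - 1 * vertex_gauge n c ?ib v) = G / Q"
      unfolding G_def Q_def prod_dividef [symmetric]
      using corner(2) aztec_vertices_Suc by (intro prod.cong refl) blast
    moreover have "(\<Prod>f\<in>cells n c. of_int (cell_sign \<phi> f) * den_at ?ib f) = S * (X / (B * A))"
      unfolding S_def X_def B_def A_def prod.distrib [symmetric] prod_dividef [symmetric]
      using inv(1) den by (intro prod.cong refl) (simp add: update_weights_def)
    ultimately show ?thesis by simp
  qed
  show "partition_function (Suc n) c \<phi> b = 0 \<longleftrightarrow> partition_function n c \<phi> (update_weights n c b) = 0"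
    using eq1 ne by (auto simp flip: z_def z'_def)
  have "z = S * z' / G" "zi = S * X * zi' * Q / (B * A * G)"
    using eq1 eq2 ne by (simp_all add: field_simps)
  then have "zi / z = (S * X * zi' * Q / (B * A * G)) / (S * z' / G)" by (simp only:)
  \<comment> \<open>If \<open>z' = 0\<close>, both sides are 0 because division by zero yields
    zero.\<close>
  also have "\<dots> = (X * Q / (B * A)) * (zi' / z')"
    using ne by (cases "z' = 0") (simp_all add: divide_simps)
  finally have "zi / z = (X * Q / (B * A)) * (zi' / z')" .
  moreover have "(\<Prod>f\<in>aztec_faces (Suc n) c. b f) * (X * Q / (B * A)) = (\<Prod>f\<in>aztec_faces n c. ?b' f)"
  proof -
    have "(\<Prod>f\<in>aztec_faces n c. ?b' f) = (\<Prod>f\<in>aztec_faces n c - cells n c. ?b' f) * X"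
      unfolding X_def by (rule prod.subset_diff [OF cells_subset finite_aztec_faces])
    also have "(\<Prod>f\<in>aztec_faces n c - cells n c. ?b' f) = (\<Prod>f\<in>aztec_faces n c - cells n c. b f)"
      by (intro prod.cong) (auto simp: update_weights_def)
    finally have "(\<Prod>f\<in>aztec_faces n c. ?b' f) * A = (\<Prod>f\<in>aztec_faces n c - cells n c. b f) * A * X"
      by (simp add: mult_ac)
    also have "\<dots> = (\<Prod>g\<in>other_faces n c. b g) * Q * X"
      unfolding A_def Q_def prod_face_weights ..
    finally have "(\<Prod>f\<in>aztec_faces n c. ?b' f) = (\<Prod>g\<in>other_faces n c. b g) * Q * X / A"
      using ne by (simp add: eq_divide_eq)
    moreover have "(\<Prod>f\<in>aztec_faces (Suc n) c. b f) = B * (\<Prod>g\<in>other_faces n c. b g)"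
      unfolding B_def aztec_faces_Suc(1)
      by (rule prod.union_disjoint) (auto simp: finite_cells finite_other_faces aztec_faces_Suc(2))
    ultimately show ?thesis using ne by (simp add: mult_ac)
  qed
  ultimately show "ratio_formula (Suc n) c \<phi> b = ratio_formula n c \<phi> (update_weights n c b)"
    unfolding ratio_formula_def z_def [symmetric] z'_def [symmetric] zi_def [symmetric] zi'_def [symmetric]
    by (simp only: mult.assoc [symmetric])
qed


section \<open>Zariski density of the domain\<close>

text \<open>A weight that is linear in the position is fixed by every update. This one witnesses that the
  polynomials whose zeros have to be avoided are not identically zero.\<close>

fun linear_weight :: "face \<Rightarrow> complex" where
  "linear_weight (i, j) = of_int i + 1 / 2 + 2 * \<i> * of_int j"

text \<open>The shift by \<open>1 / 2\<close> makes the real part half of an odd integer.\<close>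

lemma linear_weight_nonzero: "linear_weight f \<noteq> 0"
proof (cases f)
  case (Pair i j)
  have "2 * (of_int i :: real) + 1 \<noteq> 0"
  proof
    assume "2 * (of_int i :: real) + 1 = 0"
    then have "real_of_int (2 * i + 1) = 0" by simp
    then have "2 * i + 1 = 0" by (simp only: of_int_eq_0_iff)
    then show False by presburger
  qed
  then have "Re (linear_weight f) \<noteq> 0" by (simp add: Pair)
  then show ?thesis by auto
qed

text \<open>With centre \<open>z\<close>, both opposite pairs have midpoint \<open>z\<close>, so
  only \<open>e * w - n * s\<close> survives, which is
  \<open>(z ^ 2 - 1) - (z ^ 2 + 4)\<close>.\<close>

lemma linear_weight_den: "den_at linear_weight f = - 5"
  by (cases f) (simp add: dskp_den_def algebra_simps)

lemma linear_weight_num: "num_at linear_weight f = - 5 * linear_weight f"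
  by (cases f) (simp add: dskp_num_def algebra_simps)

lemma linear_weight_gauge: "vertex_gauge n c linear_weight v \<noteq> 0"
  by (cases v) (auto simp: complex_eq_iff)

lemma update_linear_weight: "update_weights n c linear_weight = linear_weight"
  by (rule ext) (simp add: update_weights_def linear_weight_den linear_weight_num)

lemma kasteleyn_orientation_mono:
  assumes "kasteleyn_orientation (Suc n) c \<phi>"
  shows "kasteleyn_orientation n c \<phi>"
proof -
  have i: "internal_faces n c \<subseteq> internal_faces (Suc n) c"
    by (auto simp: internal_faces_def)
  then have "aztec_dedges n c \<subseteq> aztec_dedges (Suc n) c"
    unfolding aztec_dedges_def aztec_edges_def by blast
  with i assms show ?thesis
    unfolding kasteleyn_orientation_def by blast
qed

lemma face_dist_nonneg: "face_dist c f \<ge> 0"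
  by (cases c; cases f) simp

lemma face_dist_eq_0: "face_dist c f = 0 \<longleftrightarrow> f = c"
  by (cases c; cases f) auto

lemma partition_function_0: "partition_function 0 c \<phi> b = 1"
proof -
  have "internal_faces 0 c = {}"
    using face_dist_nonneg [of c] by (auto simp: internal_faces_def not_less)
  then have "matchings (aztec_edges 0 c) (aztec_vertices 0 c) = {{}}"
    by (auto simp: matchings_def aztec_edges_def aztec_vertices_def)
  then show ?thesis by (simp add: partition_function_conv dimer_sum_def)
qed

lemma ratio_formula_0: "ratio_formula 0 c \<phi> b = b c"
proof -
  have "face_dist c f \<le> 0 \<longleftrightarrow> f = c" for f
    using face_dist_nonneg [of c f] face_dist_eq_0 [of c f] by linarith
  then have "aztec_faces 0 c = {c}" by (simp add: aztec_faces_conv)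
  then show ?thesis by (simp add: ratio_formula_def partition_function_0)
qed

text \<open>The weights are their own update, so non-vanishing of the partition function passes from
  size \<open>n\<close> to size \<open>n + 1\<close>.\<close>

lemma linear_weight_in_domain:
  assumes "kasteleyn_orientation n c \<phi>"
  shows "linear_weight \<in> formula_domain n c \<phi>"
proof -
  have "partition_function n c \<phi> linear_weight \<noteq> 0"
    using assms
  proof (induction n)
    case 0
    then show ?case by (simp add: partition_function_0)
  next
    case (Suc n)
    then have "partition_function n c \<phi> linear_weight \<noteq> 0" by (blast intro: kasteleyn_orientation_mono)
    moreover have "partition_function (Suc n) c \<phi> linear_weight = 0 \<longleftrightarrow>
        partition_function n c \<phi> (update_weights n c linear_weight) = 0"
      by (rule ratio_formula_Suc) (use Suc in \<open>simp_all add: linear_weight_nonzero linear_weight_den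
        linear_weight_num linear_weight_gauge del: vertex_gauge.simps linear_weight.simps\<close>)
    ultimately show ?case by (simp add: update_linear_weight)
  qed
  then show ?thesis by (simp add: formula_domain_def linear_weight_nonzero)
qed

section \<open>Continuity and generic lines\<close>

lemma tendsto_partition_function:
  assumes "\<And>f. f \<in> aztec_faces k c \<Longrightarrow> ((\<lambda>t. x t f) \<longlongrightarrow> b f) G"
  shows "((\<lambda>t. partition_function k c \<phi> (x t)) \<longlongrightarrow> partition_function k c \<phi> b) G"
proof -
  have "((\<lambda>t. edge_weight \<phi> (x t) e) \<longlongrightarrow> edge_weight \<phi> b e) G" if e: "e \<in> aztec_edges k c" for e
    using e
  proof (rule aztec_edgeE)
    fix m q assume eq: "e = hedge m q"
    have "(m, q) \<in> aztec_faces k c" "(m, q - 1) \<in> aztec_faces k c"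
      using e unfolding eq hedge_in_aztec_edges aztec_faces_conv by (cases c; auto)+
    then show ?thesis
      unfolding eq edge_weight_def dedges_hedge by (auto intro!: tendsto_intros assms)
  next
    fix m q assume eq: "e = vedge m q"
    have "(m, q) \<in> aztec_faces k c" "(m - 1, q) \<in> aztec_faces k c"
      using e unfolding eq vedge_in_aztec_edges aztec_faces_conv by (cases c; auto)+
    then show ?thesis
      unfolding eq edge_weight_def dedges_vedge by (auto intro!: tendsto_intros assms)
  qed
  then show ?thesis
    unfolding partition_function_conv dimer_sum_def
    by (intro tendsto_sum tendsto_prod) (auto simp: matchings_def)
qed

lemma tendsto_ratio_formula:
  assumes x: "\<And>f. f \<in> aztec_faces k c \<Longrightarrow> ((\<lambda>t. x t f) \<longlongrightarrow> b f) G"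
    and b: "b \<in> formula_domain k c \<phi>"
  shows "((\<lambda>t. ratio_formula k c \<phi> (x t)) \<longlongrightarrow> ratio_formula k c \<phi> b) G"
  unfolding ratio_formula_def
  by (intro tendsto_mult tendsto_divide tendsto_prod tendsto_partition_function tendsto_inverse x)
    (use b in \<open>auto simp: formula_domain_def\<close>)

text \<open>Openness of the domain, in the form required by the hypothesis \<open>nhd\<close> of
  \<open>rational_value_unique\<close>.\<close>

lemma eventually_in_formula_domain:
  assumes x: "\<And>f. f \<in> aztec_faces k c \<Longrightarrow> ((\<lambda>t. x t f) \<longlongrightarrow> b f) G"
    and b: "b \<in> formula_domain k c \<phi>"
  shows "\<forall>\<^sub>F t in G. x t \<in> formula_domain k c \<phi>"
proof -
  have "\<forall>\<^sub>F t in G. partition_function k c \<phi> (x t) \<noteq> 0"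
    by (rule tendsto_imp_eventually_ne [OF tendsto_partition_function [OF x]])
      (use b in \<open>auto simp: formula_domain_def\<close>)
  moreover have "\<forall>\<^sub>F t in G. \<forall>f\<in>aztec_faces k c. x t f \<noteq> 0"
    unfolding eventually_ball_finite_distrib [OF finite_aztec_faces]
  proof
    fix f assume f: "f \<in> aztec_faces k c"
    show "\<forall>\<^sub>F t in G. x t f \<noteq> 0"
      by (rule tendsto_imp_eventually_ne [OF x [OF f]]) (use b f in \<open>auto simp: formula_domain_def\<close>)
  qed
  ultimately show ?thesis
    by eventually_elim (simp add: formula_domain_def)
qed

text \<open>Each expression is homogeneous in the weights, say of degree \<open>d\<close>. On the
  line it equals \<open>t ^ d\<close> times a polynomial in \<open>1 / t\<close> whose constant term
  is its nonzero value at \<open>linear_weight\<close>. Nothing is assumed about \<open>b\<close>,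
  which may itself be degenerate.\<close>

lemma eventually_generic_line:
  fixes b :: "face \<Rightarrow> complex"
  defines "x \<equiv> \<lambda>t f. b f + t * linear_weight f"
  shows "\<forall>\<^sub>F t in at 0. (\<forall>f\<in>cells n c. num_at (x t) f \<noteq> 0 \<and> den_at (x t) f \<noteq> 0) \<and>
    (\<forall>v\<in>aztec_vertices (Suc n) c. vertex_gauge n c (x t) v \<noteq> 0)"
proof -
  define y where "y s f = linear_weight f + s * b f" for s f
  have xy: "x t f = t * y (1 / t) f" if "t \<noteq> 0" for t f
    using that by (simp add: x_def y_def field_simps)
  define Y where "Y f = [:linear_weight f, b f:]" for f
  have Y: "poly (Y f) s = y s f" for f s by (simp add: Y_def y_def)
  have y0: "y 0 = linear_weight" by (simp add: y_def fun_eq_iff)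
  have line: "\<forall>\<^sub>F t in at 0. g (x t) \<noteq> 0"
    if hom: "\<And>t. t \<noteq> 0 \<Longrightarrow> g (x t) = t ^ d * g (y (1 / t))"
      and P: "\<And>s. poly P s = g (y s)" and nz: "g linear_weight \<noteq> 0"
    for g :: "(face \<Rightarrow> complex) \<Rightarrow> complex" and d and P :: "complex poly"
  proof -
    have "poly P 0 \<noteq> 0" using nz by (simp add: P y0)
    then have "P \<noteq> 0" by auto
    then have "\<forall>\<^sub>F t in at 0. poly P (1 / t) \<noteq> 0" by (rule eventually_poly_inverse_nonzero)
    moreover have "\<forall>\<^sub>F t :: complex in at 0. t \<noteq> 0" by (simp add: eventually_at_filter)
    ultimately show ?thesis by eventually_elim (simp add: hom P)
  qed
  have num: "\<forall>\<^sub>F t in at 0. num_at (x t) f \<noteq> 0" for f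
  proof (cases f)
    case (Pair i j)
    let ?C = "Y (i, j)" and ?E = "Y (i + 1, j)" and ?W = "Y (i - 1, j)" and ?N = "Y (i, j + 1)" and ?S = "Y (i, j - 1)"
    show ?thesis
    proof (rule line [where d = 3])
      show "num_at (x t) f = t ^ 3 * num_at (y (1 / t)) f" if "t \<noteq> 0" for t
        unfolding Pair num_at.simps xy [OF that] dskp_num_def by (simp add: power3_eq_cube algebra_simps)
      show "poly ((?N + ?S) * ?E * ?W - (?E + ?W) * ?N * ?S + ?C * (?N * ?S - ?E * ?W)) s = num_at (y s) f" for s
        by (simp add: Pair dskp_num_def Y)
      show "num_at linear_weight f \<noteq> 0" by (simp add: linear_weight_num linear_weight_nonzero)
    qed
  qed
  have den: "\<forall>\<^sub>F t in at 0. den_at (x t) f \<noteq> 0" for f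
  proof (cases f)
    case (Pair i j)
    let ?C = "Y (i, j)" and ?E = "Y (i + 1, j)" and ?W = "Y (i - 1, j)" and ?N = "Y (i, j + 1)" and ?S = "Y (i, j - 1)"
    show ?thesis
    proof (rule line [where d = 2])
      show "den_at (x t) f = t ^ 2 * den_at (y (1 / t)) f" if "t \<noteq> 0" for t
        unfolding Pair den_at.simps xy [OF that] dskp_den_def by (simp add: power2_eq_square algebra_simps)
      show "poly (?C * (?N + ?S - ?E - ?W) + ?E * ?W - ?N * ?S) s = den_at (y s) f" for s
        by (simp add: Pair dskp_den_def Y)
      show "den_at linear_weight f \<noteq> 0" by (simp add: linear_weight_den)
    qed
  qed
  have gauge: "\<forall>\<^sub>F t in at 0. vertex_gauge n c (x t) v \<noteq> 0" for v
  proof (cases v)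
    case (Pair m q)
    let ?P = "[:if even m then 1 else -1 :: complex:] *
      (if even (face_dist c (m, q) + int n) then Y (m - 1, q) - Y (m, q - 1) else Y (m - 1, q - 1) - Y (m, q))"
    show ?thesis
    proof (rule line [where d = 1])
      show "vertex_gauge n c (x t) v = t ^ 1 * vertex_gauge n c (y (1 / t)) v" if "t \<noteq> 0" for t
        unfolding Pair vertex_gauge.simps xy [OF that] by (simp add: algebra_simps)
      show "poly ?P s = vertex_gauge n c (y s) v" for s
        by (simp add: Pair Y)
      show "vertex_gauge n c linear_weight v \<noteq> 0" by (rule linear_weight_gauge)
    qed
  qed
  show ?thesis
    by (intro eventually_conj) (simp_all add: eventually_ball_finite_distrib finite_cells
      finite_aztec_vertices eventually_conj_iff num den gauge del: vertex_gauge.simps)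
qed


section \<open>Regularity of the update\<close>

text \<open>Homogenisation of \<open>dskp_num\<close>, of degree one in each of the five points. The
  products are nested to the right so that \<open>multihom_mult\<close> yields the degree literally
  in the form of \<open>hupdate_degree\<close>.\<close>

definition dskp_hnum ::
    "complex \<times> complex \<Rightarrow> complex \<times> complex \<Rightarrow> complex \<times> complex \<Rightarrow> complex \<times> complex \<Rightarrow> complex \<times> complex \<Rightarrow> complex" where
  "dskp_hnum c e w n s =
     snd c * (fst e * (fst w * (fst n * snd s))) + snd c * (fst e * (fst w * (snd n * fst s))) -
     snd c * (fst e * (snd w * (fst n * fst s))) - snd c * (snd e * (fst w * (fst n * fst s))) +
     fst c * (snd e * (snd w * (fst n * fst s))) - fst c * (fst e * (fst w * (snd n * snd s)))"

definition dskp_hden ::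
    "complex \<times> complex \<Rightarrow> complex \<times> complex \<Rightarrow> complex \<times> complex \<Rightarrow> complex \<times> complex \<Rightarrow> complex \<times> complex \<Rightarrow> complex" where
  "dskp_hden c e w n s =
     fst c * (snd e * (snd w * (fst n * snd s))) + fst c * (snd e * (snd w * (snd n * fst s))) -
     fst c * (fst e * (snd w * (snd n * snd s))) - fst c * (snd e * (fst w * (snd n * snd s))) +
     snd c * (fst e * (fst w * (snd n * snd s))) - snd c * (snd e * (snd w * (fst n * fst s)))"

lemma dskp_hnum_affine: "dskp_hnum (c, 1) (e, 1) (w, 1) (n, 1) (s, 1) = dskp_num c e w n s"
  by (simp add: dskp_hnum_def dskp_num_def algebra_simps)

lemma dskp_hden_affine: "dskp_hden (c, 1) (e, 1) (w, 1) (n, 1) (s, 1) = dskp_den c e w n s"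
  by (simp add: dskp_hden_def dskp_den_def algebra_simps)

fun hupdate_at :: "(face \<Rightarrow> complex \<times> complex) \<Rightarrow> face \<Rightarrow> complex \<times> complex" where
  "hupdate_at u (i, j) =
     (dskp_hnum (u (i, j)) (u (i + 1, j)) (u (i - 1, j)) (u (i, j + 1)) (u (i, j - 1)),
      dskp_hden (u (i, j)) (u (i + 1, j)) (u (i - 1, j)) (u (i, j + 1)) (u (i, j - 1)))"

definition hupdate :: "nat \<Rightarrow> face \<Rightarrow> (face \<Rightarrow> complex \<times> complex) \<Rightarrow> face \<Rightarrow> complex \<times> complex" where
  "hupdate n c u f = (if f \<in> cells n c then hupdate_at u f else u f)"

fun hupdate_degree :: "face \<Rightarrow> face \<Rightarrow> nat" where
  "hupdate_degree (i, j) g = of_bool (g = (i, j)) + (of_bool (g = (i + 1, j)) +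
     (of_bool (g = (i - 1, j)) + (of_bool (g = (i, j + 1)) + of_bool (g = (i, j - 1)))))"

lemma multihom_hupdate_at:
  assumes F: "finite F" and sub: "insert f (adjacent_faces f) \<subseteq> F"
  shows "multihom F (hupdate_degree f) (\<lambda>u. fst (hupdate_at u f))"
    and "multihom F (hupdate_degree f) (\<lambda>u. snd (hupdate_at u f))"
proof -
  obtain i j where f: "f = (i, j)" by force
  have "(i, j) \<in> F" "(i + 1, j) \<in> F" "(i - 1, j) \<in> F" "(i, j + 1) \<in> F" "(i, j - 1) \<in> F"
    using sub by (auto simp: f)
  note lin = this [THEN multihom_fst [OF F]] this [THEN multihom_snd [OF F]]
  have deg: "hupdate_degree (i, j) = (\<lambda>g. of_bool (g = (i, j)) + (of_bool (g = (i + 1, j)) +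
     (of_bool (g = (i - 1, j)) + (of_bool (g = (i, j + 1)) + of_bool (g = (i, j - 1))))))"
    by (simp add: fun_eq_iff)
  show "multihom F (hupdate_degree f) (\<lambda>u. fst (hupdate_at u f))"
    "multihom F (hupdate_degree f) (\<lambda>u. snd (hupdate_at u f))"
    unfolding f deg hupdate_at.simps fst_conv snd_conv dskp_hnum_def dskp_hden_def
    by (intro multihom_add multihom_diff multihom_mult [OF F] lin)+
qed

text \<open>\<open>D\<close> is chosen before \<open>g\<close>, so the numerator and the denominator
  of a fraction still have a common multidegree after the substitution.\<close>

lemma multihom_hupdate:
  obtains D where "\<And>g. multihom (aztec_faces n c) d g \<Longrightarrow>
    multihom (aztec_faces (Suc n) c) D (\<lambda>u. g (hupdate n c u))"
proof -
  let ?e = "\<lambda>f. if f \<in> cells n c then hupdate_degree f else (\<lambda>g. of_bool (g = f))"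
  have e: "multihom (aztec_faces (Suc n) c) (?e f) (\<lambda>u. fst (hupdate n c u f))"
    "multihom (aztec_faces (Suc n) c) (?e f) (\<lambda>u. snd (hupdate n c u f))" if f: "f \<in> aztec_faces n c" for f
  proof -
    have fS: "f \<in> aztec_faces (Suc n) c" using f by (auto simp: aztec_faces_conv)
    have "insert f (adjacent_faces f) \<subseteq> aztec_faces (Suc n) c" if "f \<in> cells n c"
      using adjacent_to_cell [OF that] fS by (auto simp: aztec_faces_Suc)
    then show "multihom (aztec_faces (Suc n) c) (?e f) (\<lambda>u. fst (hupdate n c u f))"
      "multihom (aztec_faces (Suc n) c) (?e f) (\<lambda>u. snd (hupdate n c u f))"
      using multihom_hupdate_at [OF finite_aztec_faces] multihom_fst [OF finite_aztec_faces fS]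
        multihom_snd [OF finite_aztec_faces fS]
      by (cases "f \<in> cells n c"; simp add: hupdate_def del: hupdate_at.simps hupdate_degree.simps)+
  qed
  show ?thesis by (rule that) (rule multihom_compose [OF finite_aztec_faces _ e])
qed

text \<open>The rational function of the diamond of size \<open>n + 1\<close> is the one of size \<open>n\<close> composed with
  the update, which is regular at \<open>x\<close>.\<close>

lemma rational_value_Suc:
  assumes K: "kasteleyn_orientation (Suc n) c \<phi>"
    and cell: "\<And>f. f \<in> cells n c \<Longrightarrow> \<exists>k. k \<noteq> 0 \<and>
      hupdate_at (hcoords \<circ> x) f = (k * fst (hcoords (x' f)), k * snd (hcoords (x' f)))"
    and other: "\<And>f. f \<in> aztec_faces n c - cells n c \<Longrightarrow> x' f = x f"
    and val: "rational_value (aztec_faces n c) (formula_domain n c \<phi>) (ratio_formula n c \<phi>) x' w"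
  shows "rational_value (aztec_faces (Suc n) c) (formula_domain (Suc n) c \<phi>) (ratio_formula (Suc n) c \<phi>) x w"
proof -
  let ?F = "aztec_faces n c" and ?G = "aztec_faces (Suc n) c"
  from val obtain d \<alpha> \<beta> where
    eq: "\<And>b. b \<in> formula_domain n c \<phi> \<Longrightarrow>
      multihom_eval ?F d \<beta> (Finite \<circ> b) * ratio_formula n c \<phi> b = multihom_eval ?F d \<alpha> (Finite \<circ> b)" and
    nz: "(multihom_eval ?F d \<alpha> x', multihom_eval ?F d \<beta> x') \<noteq> (0, 0)" and
    wv: "w = from_hcoords (multihom_eval ?F d \<alpha> x', multihom_eval ?F d \<beta> x')"
    unfolding rational_value_def by blast
  obtain A where A: "multihom ?F d A" "\<And>x. multihom_eval ?F d \<alpha> x = A (hcoords \<circ> x)"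
    using multihom_multihom_eval [of ?F d \<alpha>] by blast
  obtain B where B: "multihom ?F d B" "\<And>x. multihom_eval ?F d \<beta> x = B (hcoords \<circ> x)"
    using multihom_multihom_eval [of ?F d \<beta>] by blast
  obtain D where D: "multihom ?G D (\<lambda>u. A (hupdate n c u))" "multihom ?G D (\<lambda>u. B (hupdate n c u))"
    using multihom_hupdate [of n c d] A(1) B(1) by metis
  obtain \<alpha>' where \<alpha>': "\<And>x. multihom_eval ?G D \<alpha>' x = A (hupdate n c (hcoords \<circ> x))"
    using multihom_eval_of_multihom [OF D(1)] by blast
  obtain \<beta>' where \<beta>': "\<And>x. multihom_eval ?G D \<beta>' x = B (hupdate n c (hcoords \<circ> x))"
    using multihom_eval_of_multihom [OF D(2)] by blast
  have fin: "hcoords \<circ> (Finite \<circ> b) = (\<lambda>f. (b f, 1))" for b :: "face \<Rightarrow> complex" by auto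
  have "\<exists>k. \<forall>f\<in>cells n c. k f \<noteq> 0 \<and>
      hupdate_at (hcoords \<circ> x) f = (k f * fst (hcoords (x' f)), k f * snd (hcoords (x' f)))"
    using cell by (intro bchoice) blast
  then obtain k where k: "\<And>f. f \<in> cells n c \<Longrightarrow> k f \<noteq> 0"
    "\<And>f. f \<in> cells n c \<Longrightarrow> hupdate_at (hcoords \<circ> x) f = (k f * fst (hcoords (x' f)), k f * snd (hcoords (x' f)))"
    by blast
  define k' where "k' f = (if f \<in> cells n c then k f else 1)" for f
  \<comment> \<open>The common factor between evaluation at the raw output of the update at
    \<open>x\<close> and at the standard coordinates of \<open>x'\<close>. Since it is nonzero, the
    new fraction is not 0/0 at \<open>x\<close> and has the same value.\<close>
  define K0 where "K0 = (\<Prod>f\<in>?F. k' f ^ d f)"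
  have K0: "K0 \<noteq> 0" using k(1) by (auto simp: K0_def k'_def finite_aztec_faces)
  have scale: "g (hupdate n c (hcoords \<circ> x)) = K0 * g (hcoords \<circ> x')" if "multihom ?F d g" for g
    unfolding K0_def
    by (rule multihom_scale_args [OF that]) (use k(2) other in \<open>auto simp: hupdate_def k'_def\<close>)
  have generic: "B (hupdate n c (\<lambda>f. (b f, 1))) * ratio_formula (Suc n) c \<phi> b = A (hupdate n c (\<lambda>f. (b f, 1)))"
    if b: "b \<in> formula_domain (Suc n) c \<phi>"
      and cells: "\<forall>f\<in>cells n c. num_at b f \<noteq> 0 \<and> den_at b f \<noteq> 0"
      and gauge: "\<forall>v\<in>aztec_vertices (Suc n) c. vertex_gauge n c b v \<noteq> 0" for b
  proof -
    have nzb: "b f \<noteq> 0" if "f \<in> ?G" for f using b that by (simp add: formula_domain_def)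
    have zb: "partition_function (Suc n) c \<phi> b \<noteq> 0" using b by (simp add: formula_domain_def)
    have R: "ratio_formula (Suc n) c \<phi> b = ratio_formula n c \<phi> (update_weights n c b)"
      and Z: "partition_function (Suc n) c \<phi> b = 0 \<longleftrightarrow> partition_function n c \<phi> (update_weights n c b) = 0"
      by (rule ratio_formula_Suc [OF K]; use nzb cells gauge in blast)+
    have "update_weights n c b f \<noteq> 0" if "f \<in> ?F" for f
      using that cells nzb by (auto simp: update_weights_def aztec_faces_conv)
    with zb Z have dom: "update_weights n c b \<in> formula_domain n c \<phi>" by (simp add: formula_domain_def)
    let ?L = "\<Prod>f\<in>?F. (if f \<in> cells n c then den_at b f else 1) ^ d f"
    have sc: "g (hupdate n c (\<lambda>f. (b f, 1))) = ?L * g (\<lambda>f. (update_weights n c b f, 1))" if "multihom ?F d g" for g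
    proof (rule multihom_scale_args [OF that])
      fix f
      have "hupdate_at (\<lambda>f. (b f, 1)) f = (num_at b f, den_at b f)"
        by (cases f) (simp add: dskp_hnum_affine dskp_hden_affine)
      then show "fst (hupdate n c (\<lambda>f. (b f, 1)) f) =
          (if f \<in> cells n c then den_at b f else 1) * fst (update_weights n c b f, 1 :: complex)"
        "snd (hupdate n c (\<lambda>f. (b f, 1)) f) =
          (if f \<in> cells n c then den_at b f else 1) * snd (update_weights n c b f, 1)"
        using cells by (auto simp: hupdate_def update_weights_def)
    qed
    show ?thesis
      using eq [OF dom] unfolding R sc [OF A(1)] sc [OF B(1)] A(2) B(2) fin by (simp only: mult.assoc)
  qed
  have "multihom_eval ?G D \<beta>' (Finite \<circ> b) * ratio_formula (Suc n) c \<phi> b = multihom_eval ?G D \<alpha>' (Finite \<circ> b)"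
    if b: "b \<in> formula_domain (Suc n) c \<phi>" for b
  proof -
    \<comment> \<open>Renewal may fail at \<open>b\<close> itself, but not at \<open>y t\<close> for
      small nonzero \<open>t\<close>; both sides of the identity are continuous at
      \<open>b\<close>.\<close>
    define y where "y t f = b f + t * linear_weight f" for t f
    have y: "((\<lambda>t. y t f) \<longlongrightarrow> b f) (at 0)" for f
    proof -
      have "((\<lambda>t. y t f) \<longlongrightarrow> b f + 0 * linear_weight f) (at 0)"
        unfolding y_def by (intro tendsto_intros)
      then show ?thesis by simp
    qed
    let ?l = "\<lambda>b. B (hupdate n c (\<lambda>f. (b f, 1))) * ratio_formula (Suc n) c \<phi> b"
    let ?r = "\<lambda>b. A (hupdate n c (\<lambda>f. (b f, 1)))"
    have "\<forall>\<^sub>F t in at 0. y t \<in> formula_domain (Suc n) c \<phi>"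
      by (rule eventually_in_formula_domain [OF y b])
    with eventually_generic_line [of n c b, folded y_def]
    have ev: "\<forall>\<^sub>F t in at 0. ?l (y t) = ?r (y t)"
      by eventually_elim (rule generic; blast)
    have "((\<lambda>t. ?l (y t)) \<longlongrightarrow> ?l b) (at 0)"
      by (intro tendsto_mult multihom_continuous [OF D(2)] tendsto_ratio_formula b) (simp_all add: y)
    moreover have "((\<lambda>t. ?r (y t)) \<longlongrightarrow> ?r b) (at 0)"
      by (intro multihom_continuous [OF D(1)]) (simp_all add: y)
    ultimately have "?l b = ?r b"
      using tendsto_cong [OF ev] tendsto_unique [OF at_neq_bot] by blast
    then show ?thesis by (simp only: \<alpha>' \<beta>' fin)
  qed
  moreover have "multihom_eval ?G D \<alpha>' x = K0 * multihom_eval ?F d \<alpha> x'"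
    "multihom_eval ?G D \<beta>' x = K0 * multihom_eval ?F d \<beta> x'"
    by (simp_all only: \<alpha>' \<beta>' A(2) B(2) scale [OF A(1)] scale [OF B(1)])
  ultimately show ?thesis
    unfolding rational_value_def using nz K0 wv
    by (intro exI [of _ D] exI [of _ \<alpha>'] exI [of _ \<beta>']) (simp add: from_hcoords_scale)
qed


section \<open>Orthogonal circle patterns\<close>

text \<open>The coordinate on the sphere that sends the point given as first argument to infinity; the
  value at that point itself is junk.\<close>

fun coord_at :: "riemann_sphere \<Rightarrow> riemann_sphere \<Rightarrow> complex" where
  "coord_at (Finite z) (Finite y) = 1 / (y - z)"
| "coord_at (Finite z) Infty = 0"
| "coord_at Infty (Finite y) = y"
| "coord_at Infty Infty = 0"

text \<open>A number whose product with the coordinate has constant imaginary part along the circle.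
  Near \<open>z\<close> the circle leaves in its tangent direction, so its image under
  \<open>1 / (y - z)\<close> is a line in the direction of the inverse of the tangent; at infinity
  the coordinate is \<open>y\<close> and the conjugate of the direction plays this part.\<close>

fun normal_at :: "riemann_sphere \<Rightarrow> gcircle \<Rightarrow> complex" where
  "normal_at (Finite z) C = tangent_direction C z"
| "normal_at Infty C = cnj (tangent_direction C 0)"

text \<open>Inversion maps a circle through the origin to a line. Expanding the squared norms shows
  that twice the inner product of \<open>m\<close> and \<open>u\<close> is minus the squared norm of
  \<open>u\<close>.\<close>

lemma Re_div_eq:
  fixes m u :: complex
  assumes "u \<noteq> 0" "norm (u + m) = norm m"
  shows "Re (m / u) = - 1 / 2"
proof -
  have "(norm (u + m))\<^sup>2 = (norm m)\<^sup>2" using assms by simp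
  then have "Re m * Re u + Im m * Im u = - (1 / 2) * (Re u * Re u + Im u * Im u)"
    unfolding cmod_power2 by (simp add: power2_eq_square algebra_simps)
  moreover have "Re u * Re u + Im u * Im u \<noteq> 0"
    using assms(1) by (simp add: complex_eq_iff sum_squares_eq_zero_iff)
  ultimately have "Re (m / u) = - (1 / 2)"
    unfolding Re_divide power2_eq_square by (metis nonzero_mult_div_cancel_right)
  then show ?thesis by simp
qed

text \<open>In this coordinate, the circles through the point are straight lines.\<close>

lemma gcircle_line:
  assumes "proper_gcircle C" "P \<in> gcircle_points C"
  obtains \<kappa> where "\<And>Q. Q \<in> gcircle_points C \<Longrightarrow> Q \<noteq> P \<Longrightarrow> Im (normal_at P C * coord_at P Q) = \<kappa>"
proof (cases C)
  case (Circle m r)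
  with assms obtain z where z: "P = Finite z" "norm (z - m) = r" "r > 0"
    by (auto simp: dist_norm norm_minus_commute)
  have "Im (normal_at P C * coord_at P Q) = - 1 / 2" if Q: "Q \<in> gcircle_points C" "Q \<noteq> P" for Q
  proof -
    obtain y where y: "Q = Finite y" "norm (y - m) = r"
      using Q by (auto simp: Circle dist_norm norm_minus_commute)
    have "Re ((z - m) / (y - z)) = - 1 / 2"
      by (rule Re_div_eq) (use Q y z in auto)
    moreover have "normal_at P C * coord_at P Q = \<i> * ((z - m) / (y - z))"
      by (simp add: z y Circle)
    ultimately show ?thesis by (simp only: Im_i_times)
  qed
  then show ?thesis by (rule that)
next
  case (Line z0 d)
  with assms have d: "d \<noteq> 0" by simp
  show ?thesis
  proof (cases P)
    case (Finite z)
    then obtain t where z: "z = z0 + of_real t * d" using assms by (auto simp: Line)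
    have "Im (normal_at P C * coord_at P Q) = 0" if Q: "Q \<in> gcircle_points C" "Q \<noteq> P" for Q
    proof (cases Q)
      case Fin: (Finite y)
      then obtain s where y: "y = z0 + of_real s * d" using Q by (auto simp: Line)
      have "d * (1 / (y - z)) = of_real (1 / (s - t))"
      proof -
        have "y - z = d * of_real (s - t)" by (simp add: y z algebra_simps)
        then show ?thesis using d by simp
      qed
      then show ?thesis by (simp add: Finite Fin Line)
    qed (simp add: Finite)
    then show ?thesis by (rule that)
  next
    case Infty
    have "Im (normal_at P C * coord_at P Q) = Im (cnj d * z0)" if Q: "Q \<in> gcircle_points C" "Q \<noteq> P" for Q
    proof -
      obtain s where "Q = Finite (z0 + of_real s * d)" using Q by (auto simp: Line Infty)
      then show ?thesis by (simp add: Infty Line algebra_simps)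
    qed
    then show ?thesis by (rule that)
  qed
qed

lemma normal_at_nonzero:
  assumes "proper_gcircle C" "P \<in> gcircle_points C"
  shows "normal_at P C \<noteq> 0"
  using assms by (cases C; cases P) auto

text \<open>At infinity both circles are lines. Their directions are the same at every point, so
  orthogonality at the finite intersection carries over, and conjugation preserves inner
  products.\<close>

lemma normal_at_orthogonal:
  assumes "orthogonal_gcircles C D" "P \<in> gcircle_points C" "P \<in> gcircle_points D"
  shows "inner (normal_at P C) (normal_at P D) = 0"
proof (cases P)
  case (Finite z)
  with assms show ?thesis by (simp add: orthogonal_gcircles_def)
next
  case Infty
  with assms obtain z d z' d' where CD: "C = Line z d" "D = Line z' d'"
    by (cases C; cases D) auto
  from assms(1) have "inner d d' = 0"
    unfolding orthogonal_gcircles_def CD by auto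
  then show ?thesis by (simp add: Infty CD inner_complex_def)
qed

lemma orthogonal_imp_multiple:
  assumes "inner a b = 0" "a \<noteq> 0" "b \<noteq> 0"
  obtains r :: real where "r \<noteq> 0" "b = of_real r * (\<i> * a)"
proof (rule that)
  have "Re (b / a) = 0" using assms by (simp add: Re_divide inner_complex_def mult.commute)
  then have "b / a = of_real (Im (b / a)) * \<i>" by (simp add: complex_eq_iff)
  then have eq: "b = of_real (Im (b / a)) * \<i> * a" using assms(2) by (simp add: divide_eq_eq)
  then show "b = of_real (Im (b / a)) * (\<i> * a)" by (simp only: mult.assoc)
  show "Im (b / a) \<noteq> 0" using eq assms(3) by auto
qed

text \<open>Consecutive normals differ by a real multiple of \<open>\<i>\<close>, so the conditions
  fix alternately imaginary and real parts after multiplication by \<open>\<tau>0\<close>: the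
  images of \<open>e\<close>, \<open>n\<close>, \<open>w\<close>, \<open>s\<close> are consecutive
  vertices of an axis-parallel rectangle.\<close>

lemma rectangle_diagonals:
  assumes orth: "inner \<tau>0 \<tau>1 = 0" "inner \<tau>1 \<tau>2 = 0" "inner \<tau>2 \<tau>3 = 0"
    and nz: "\<tau>0 \<noteq> 0" "\<tau>1 \<noteq> 0" "\<tau>2 \<noteq> 0" "\<tau>3 \<noteq> 0"
    and line: "Im (\<tau>0 * e) = Im (\<tau>0 * n)" "Im (\<tau>1 * n) = Im (\<tau>1 * w)"
      "Im (\<tau>2 * w) = Im (\<tau>2 * s)" "Im (\<tau>3 * s) = Im (\<tau>3 * e)"
  shows "e + w = n + s"
proof -
  obtain r1 where r1: "r1 \<noteq> 0" "\<tau>1 = of_real r1 * (\<i> * \<tau>0)"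
    using orthogonal_imp_multiple orth nz by metis
  obtain r2 where r2: "r2 \<noteq> 0" "\<tau>2 = of_real r2 * (\<i> * \<tau>1)"
    using orthogonal_imp_multiple orth nz by metis
  obtain r3 where r3: "r3 \<noteq> 0" "\<tau>3 = of_real r3 * (\<i> * \<tau>2)"
    using orthogonal_imp_multiple orth nz by metis
  have \<tau>2: "\<tau>2 = of_real (- (r2 * r1)) * \<tau>0" by (simp add: r2(2) r1(2) complex_eq_iff algebra_simps)
  have \<tau>3: "\<tau>3 = of_real (- (r3 * r2 * r1)) * (\<i> * \<tau>0)" by (simp add: r3(2) \<tau>2 complex_eq_iff algebra_simps)
  have "Im (\<tau>1 * n) = r1 * Re (\<tau>0 * n)" "Im (\<tau>1 * w) = r1 * Re (\<tau>0 * w)"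
    "Im (\<tau>2 * w) = - (r2 * r1) * Im (\<tau>0 * w)" "Im (\<tau>2 * s) = - (r2 * r1) * Im (\<tau>0 * s)"
    "Im (\<tau>3 * s) = - (r3 * r2 * r1) * Re (\<tau>0 * s)" "Im (\<tau>3 * e) = - (r3 * r2 * r1) * Re (\<tau>0 * e)"
    unfolding \<tau>2 \<tau>3 r1(2) by (simp_all add: algebra_simps)
  with line r1(1) r2(1) r3(1) have "Re (\<tau>0 * n) = Re (\<tau>0 * w)" "Im (\<tau>0 * w) = Im (\<tau>0 * s)"
    "Re (\<tau>0 * s) = Re (\<tau>0 * e)"
    by simp_all
  with line(1) have "\<tau>0 * (e + w) = \<tau>0 * (n + s)"
    by (simp add: distrib_left complex_eq_iff del: times_complex.sel)
  with nz(1) show ?thesis by simp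
qed

lemma orthogonal_pattern_coord:
  assumes "orthogonal_circle_pattern p" "nondegenerate_pattern p"
  shows "coord_at (p (i, j)) (p (i + 1, j)) + coord_at (p (i, j)) (p (i - 1, j)) =
    coord_at (p (i, j)) (p (i, j + 1)) + coord_at (p (i, j)) (p (i, j - 1))"
proof -
  let ?P = "p (i, j)"
  from assms(1) obtain c where c: "circles_of_pattern p c"
    and orth: "\<And>i j. orthogonal_gcircles (c (i, j)) (c (i + 1, j))"
      "\<And>i j. orthogonal_gcircles (c (i, j)) (c (i, j + 1))"
    unfolding orthogonal_circle_pattern_def by blast
  \<comment> \<open>The circles to the north-east, north-west, south-west and south-east of
    \<open>?P\<close>; consecutive ones share the neighbour between them.\<close>
  let ?C0 = "c (i, j)" and ?C1 = "c (i - 1, j)" and ?C2 = "c (i - 1, j - 1)" and ?C3 = "c (i, j - 1)"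
  have proper: "proper_gcircle (c f)" for f using c by (cases f) (auto simp: circles_of_pattern_def)
  have on: "p (i', j') \<in> gcircle_points (c (i', j'))" "p (i' + 1, j') \<in> gcircle_points (c (i', j'))"
    "p (i' + 1, j' + 1) \<in> gcircle_points (c (i', j'))" "p (i', j' + 1) \<in> gcircle_points (c (i', j'))" for i' j'
    using c by (auto simp: circles_of_pattern_def)
  have P: "?P \<in> gcircle_points ?C0" "?P \<in> gcircle_points ?C1" "?P \<in> gcircle_points ?C2" "?P \<in> gcircle_points ?C3"
    using on(1) [of i j] on(2) [of "i - 1" j] on(3) [of "i - 1" "j - 1"] on(4) [of i "j - 1"] by simp_all
  have E: "p (i + 1, j) \<in> gcircle_points ?C0" "p (i + 1, j) \<in> gcircle_points ?C3"
    using on(2) [of i j] on(3) [of i "j - 1"] by simp_all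
  have N: "p (i, j + 1) \<in> gcircle_points ?C0" "p (i, j + 1) \<in> gcircle_points ?C1"
    using on(4) [of i j] on(3) [of "i - 1" j] by simp_all
  have W: "p (i - 1, j) \<in> gcircle_points ?C1" "p (i - 1, j) \<in> gcircle_points ?C2"
    using on(1) [of "i - 1" j] on(4) [of "i - 1" "j - 1"] by simp_all
  have S: "p (i, j - 1) \<in> gcircle_points ?C2" "p (i, j - 1) \<in> gcircle_points ?C3"
    using on(2) [of "i - 1" "j - 1"] on(1) [of i "j - 1"] by simp_all
  have nd: "p (i', j') \<noteq> p (i' + 1, j')" "p (i', j') \<noteq> p (i', j' + 1)" for i' j'
    using assms(2) unfolding nondegenerate_pattern_def by blast+
  \<comment> \<open>This keeps the neighbours away from the point where \<open>coord_at\<close> is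
    junk.\<close>
  have ne: "p (i + 1, j) \<noteq> ?P" "p (i, j + 1) \<noteq> ?P" "p (i - 1, j) \<noteq> ?P" "p (i, j - 1) \<noteq> ?P"
    using nd(1) [of i j] nd(2) [of i j] nd(1) [of "i - 1" j] nd(2) [of i "j - 1"] by simp_all
  have line: "Im (normal_at ?P C * coord_at ?P Q) = Im (normal_at ?P C * coord_at ?P Q')"
    if "proper_gcircle C" "?P \<in> gcircle_points C" "Q \<in> gcircle_points C" "Q' \<in> gcircle_points C" "Q \<noteq> ?P" "Q' \<noteq> ?P"
    for C Q Q'
    using gcircle_line [OF that(1,2)] that(3-6) by metis
  have o01: "orthogonal_gcircles ?C1 ?C0" using orth(1) [of "i - 1" j] by simp
  have o12: "orthogonal_gcircles ?C2 ?C1" using orth(2) [of "i - 1" "j - 1"] by simp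
  have o23: "orthogonal_gcircles ?C2 ?C3" using orth(1) [of "i - 1" "j - 1"] by simp
  show ?thesis
  proof (rule rectangle_diagonals [of "normal_at ?P ?C0" "normal_at ?P ?C1" "normal_at ?P ?C2" "normal_at ?P ?C3"])
    show "inner (normal_at ?P ?C0) (normal_at ?P ?C1) = 0"
      using normal_at_orthogonal [OF o01 P(2,1)] by (simp only: inner_commute)
    show "inner (normal_at ?P ?C1) (normal_at ?P ?C2) = 0"
      using normal_at_orthogonal [OF o12 P(3,2)] by (simp only: inner_commute)
    show "inner (normal_at ?P ?C2) (normal_at ?P ?C3) = 0"
      by (rule normal_at_orthogonal [OF o23 P(3,4)])
  qed (intro normal_at_nonzero line proper P E N W S ne)+
qed

text \<open>With \<open>t\<close> the coordinate of \<open>Q\<close>, the pair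
  \<open>(1 + z * t, t)\<close> represents \<open>Q\<close>, uniformly for finite points and for
  infinity, where \<open>t = 0\<close>.\<close>

lemma hcoords_coord_at:
  assumes "Q \<noteq> Finite z"
  shows "fst (hcoords Q) - z * snd (hcoords Q) \<noteq> 0"
    and "snd (hcoords Q) = coord_at (Finite z) Q * (fst (hcoords Q) - z * snd (hcoords Q))"
    and "fst (hcoords Q) = (1 + z * coord_at (Finite z) Q) * (fst (hcoords Q) - z * snd (hcoords Q))"
  using assms by (cases Q; simp add: field_simps)+

text \<open>The pair \<open>n\<close>, \<open>s\<close> has collapsed to \<open>P\<close>. Sending
  \<open>P\<close> to infinity makes dSKP affine, giving \<open>X\<close> the coordinate
  \<open>te + tw - tc\<close>. The factor \<open>k \<noteq> 0\<close> records that the update is not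
  0/0 here.\<close>

lemma dskp_of_coord:
  assumes ne: "C \<noteq> P" "E \<noteq> P" "W \<noteq> P" "X \<noteq> P"
    and eq: "coord_at P E + coord_at P W = coord_at P X + coord_at P C"
  shows "\<exists>k. k \<noteq> 0 \<and>
    dskp_hnum (hcoords C) (hcoords E) (hcoords W) (hcoords P) (hcoords P) = k * fst (hcoords X) \<and>
    dskp_hden (hcoords C) (hcoords E) (hcoords W) (hcoords P) (hcoords P) = k * snd (hcoords X)"
proof (cases P)
  case Infty
  with ne obtain c e w x where "C = Finite c" "E = Finite e" "W = Finite w" "X = Finite x"
    by (metis riemann_sphere.exhaust)
  with eq Infty show ?thesis
    \<comment> \<open>With \<open>(1, 0)\<close> for both \<open>n\<close> and \<open>s\<close>, the
      numerator is \<open>c - e - w\<close> and the denominator is -1.\<close>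
    by (intro exI [of _ "-1"]) (auto simp: dskp_hnum_def dskp_hden_def algebra_simps)
next
  case (Finite z)
  let ?\<delta> = "\<lambda>Q. fst (hcoords Q) - z * snd (hcoords Q)" and ?t = "coord_at (Finite z)"
  have hc: "?\<delta> Q \<noteq> 0" "snd (hcoords Q) = ?t Q * ?\<delta> Q" "fst (hcoords Q) = (1 + z * ?t Q) * ?\<delta> Q"
    if "Q \<noteq> P" for Q
    using hcoords_coord_at that Finite by blast+
  obtain dc de dw dx where d: "dc = ?\<delta> C" "de = ?\<delta> E" "dw = ?\<delta> W" "dx = ?\<delta> X" by blast
  obtain tc te tw tx where t: "tc = ?t C" "te = ?t E" "tw = ?t W" "tx = ?t X" by blast
  have hC: "hcoords C = ((1 + z * tc) * dc, tc * dc)" and hE: "hcoords E = ((1 + z * te) * de, te * de)"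
    and hW: "hcoords W = ((1 + z * tw) * dw, tw * dw)" and hX: "hcoords X = ((1 + z * tx) * dx, tx * dx)"
    using hc [OF ne(1)] hc [OF ne(2)] hc [OF ne(3)] hc [OF ne(4)]
    unfolding d t by (auto simp only: prod_eq_iff fst_conv snd_conv)
  have tx: "tx = te + tw - tc" using eq by (simp add: t Finite algebra_simps)
  have dne: "dc \<noteq> 0" "de \<noteq> 0" "dw \<noteq> 0" "dx \<noteq> 0" using hc ne by (simp_all add: d)
  have hP: "hcoords P = (z, 1)" by (simp add: Finite)
  have "dskp_hden (hcoords C) (hcoords E) (hcoords W) (hcoords P) (hcoords P) = - (dc * de * dw) * tx"
    unfolding hC hE hW hP tx dskp_hden_def by (simp add: algebra_simps)
  moreover have "dskp_hnum (hcoords C) (hcoords E) (hcoords W) (hcoords P) (hcoords P) =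
      - (dc * de * dw) * (1 + z * tx)"
    unfolding hC hE hW hP tx dskp_hnum_def by (simp add: algebra_simps)
  ultimately show ?thesis
    using dne by (intro exI [of _ "- (dc * de * dw) / dx"]) (simp add: hX)
qed

text \<open>The initial rows are \<open>s\<close> and \<open>s + 1\<close> for any \<open>s\<close>,
  because an update moves them to \<open>s + 1\<close> and \<open>s + 2\<close>. The parity
  hypothesis makes the cells exactly the faces carrying row \<open>s\<close>, which jump to row
  \<open>s + 2\<close>, and puts row \<open>s + 1\<close> at the centre when
  \<open>n = 0\<close>.\<close>

lemma rational_value_pattern:
  assumes pat: "orthogonal_circle_pattern p" "nondegenerate_pattern p"
  shows "kasteleyn_orientation n (i, v) \<phi> \<Longrightarrow> even (i + v + s + int n + 1) \<Longrightarrow>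
    rational_value (aztec_faces n (i, v)) (formula_domain n (i, v) \<phi>) (ratio_formula n (i, v) \<phi>)
      (\<lambda>(i', j'). p (i', s + (i' + j' - s) mod 2)) (p (i, s + int n + 1))"
proof (induction n arbitrary: s)
  case 0
  let ?F = "aztec_faces 0 (i, v)" and ?x = "\<lambda>(i', j'). p (i', s + (i' + j' - s) mod 2)"
  have F: "(i, v) \<in> ?F" by (simp add: aztec_faces_conv)
  let ?d = "\<lambda>f. of_bool (f = (i, v)) :: nat"
  obtain \<alpha> where \<alpha>: "\<And>x. multihom_eval ?F ?d \<alpha> x = fst ((hcoords \<circ> x) (i, v))"
    using multihom_eval_of_multihom [OF multihom_fst [OF finite_aztec_faces F]] by blast
  obtain \<beta> where \<beta>: "\<And>x. multihom_eval ?F ?d \<beta> x = snd ((hcoords \<circ> x) (i, v))"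
    using multihom_eval_of_multihom [OF multihom_snd [OF finite_aztec_faces F]] by blast
  have "odd (i + v + s)" using 0(2) by simp
  then have "(i + v - s) mod 2 = 1" by presburger
  then have "?x (i, v) = p (i, s + 1)" by simp
  then show ?case
    unfolding rational_value_def using hcoords_nonzero [of "p (i, s + 1)"]
    by (intro exI [of _ ?d] exI [of _ \<alpha>] exI [of _ \<beta>]) (simp add: \<alpha> \<beta> ratio_formula_0)
next
  case (Suc n)
  let ?x = "\<lambda>s (i', j'). p (i', s + (i' + j' - s) mod 2)"
  have par: "even (face_dist (i, v) (a, b) + int n) \<longleftrightarrow> even (a + b - s)" for a b
  proof -
    have "even (i + v + s + int n)" using Suc.prems(2) unfolding of_nat_Suc by presburger
    then show ?thesis unfolding even_add [of "face_dist _ _"] parity_face_dist by presburger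
  qed
  have IH: "rational_value (aztec_faces n (i, v)) (formula_domain n (i, v) \<phi>) (ratio_formula n (i, v) \<phi>)
      (?x (s + 1)) (p (i, s + 1 + int n + 1))"
  proof (rule Suc.IH [OF kasteleyn_orientation_mono [OF Suc.prems(1)]])
    show "even (i + v + (s + 1) + int n + 1)" using Suc.prems(2) unfolding of_nat_Suc by presburger
  qed
  have "rational_value (aztec_faces (Suc n) (i, v)) (formula_domain (Suc n) (i, v) \<phi>)
      (ratio_formula (Suc n) (i, v) \<phi>) (?x s) (p (i, s + 1 + int n + 1))"
  proof (rule rational_value_Suc [OF Suc.prems(1) _ _ IH])
    fix f assume f: "f \<in> cells n (i, v)"
    obtain a b where ab: "f = (a, b)" by force
    have "even (a + b - s)" using f unfolding cells_def ab mem_Collect_eq par by blast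
    then have m: "(a + b - s) mod 2 = 0" "(a + 1 + b - s) mod 2 = 1" "(a - 1 + b - s) mod 2 = 1"
      "(a + (b + 1) - s) mod 2 = 1" "(a + (b - 1) - s) mod 2 = 1" "(a + b - (s + 1)) mod 2 = 1"
      by presburger+
    have s2: "s + 1 + 1 = s + 2" by simp
    \<comment> \<open>The data have vertical period 2, so the north and south faces both carry
      \<open>p (a, s + 1)\<close>, the point to be sent to infinity.\<close>
    have x: "?x s (a, b) = p (a, s)" "?x s (a + 1, b) = p (a + 1, s + 1)" "?x s (a - 1, b) = p (a - 1, s + 1)"
      "?x s (a, b + 1) = p (a, s + 1)" "?x s (a, b - 1) = p (a, s + 1)" "?x (s + 1) (a, b) = p (a, s + 2)"
      by (simp_all only: prod.case m add_0_right s2)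
    have nd: "p (i', j') \<noteq> p (i' + 1, j')" "p (i', j') \<noteq> p (i', j' + 1)" for i' j'
      using pat(2) unfolding nondegenerate_pattern_def by blast+
    have "\<exists>k. k \<noteq> 0 \<and>
      dskp_hnum (hcoords (p (a, s))) (hcoords (p (a + 1, s + 1))) (hcoords (p (a - 1, s + 1)))
        (hcoords (p (a, s + 1))) (hcoords (p (a, s + 1))) = k * fst (hcoords (p (a, s + 2))) \<and>
      dskp_hden (hcoords (p (a, s))) (hcoords (p (a + 1, s + 1))) (hcoords (p (a - 1, s + 1)))
        (hcoords (p (a, s + 1))) (hcoords (p (a, s + 1))) = k * snd (hcoords (p (a, s + 2)))"
    proof (rule dskp_of_coord)
      show "p (a, s) \<noteq> p (a, s + 1)" by (rule nd)
      show "p (a + 1, s + 1) \<noteq> p (a, s + 1)" using nd(1) [of a "s + 1"] by simp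
      show "p (a - 1, s + 1) \<noteq> p (a, s + 1)" using nd(1) [of "a - 1" "s + 1"] by simp
      show "p (a, s + 2) \<noteq> p (a, s + 1)" using nd(2) [of a "s + 1"] by (simp add: add.assoc)
      show "coord_at (p (a, s + 1)) (p (a + 1, s + 1)) + coord_at (p (a, s + 1)) (p (a - 1, s + 1)) =
          coord_at (p (a, s + 1)) (p (a, s + 2)) + coord_at (p (a, s + 1)) (p (a, s))"
        using orthogonal_pattern_coord [OF pat, of a "s + 1"] by (simp add: add.assoc)
    qed
    then show "\<exists>k. k \<noteq> 0 \<and> hupdate_at (hcoords \<circ> ?x s) f =
        (k * fst (hcoords (?x (s + 1) f)), k * snd (hcoords (?x (s + 1) f)))"
      unfolding ab hupdate_at.simps o_apply x prod.inject .
  next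
    fix f assume f: "f \<in> aztec_faces n (i, v) - cells n (i, v)"
    obtain a b where ab: "f = (a, b)" by force
    have "odd (a + b - s)"
      using f unfolding cells_def aztec_faces_conv ab Diff_iff mem_Collect_eq par by blast
    then have "(a + b - s) mod 2 = 1" "(a + b - (s + 1)) mod 2 = 0" by presburger+
    then show "?x (s + 1) f = ?x s f" by (simp add: ab)
  qed
  then show ?case by (simp add: algebra_simps)
qed

theorem corollary6p17:
  fixes p :: "int \<times> int \<Rightarrow> riemann_sphere"
    and a :: "face \<Rightarrow> riemann_sphere"
    and i j v :: int
    and \<phi> :: "dedge \<Rightarrow> int"
  assumes "orthogonal_circle_pattern p"
    and "nondegenerate_pattern p"
    and "\<And>i j. a (i, j) = p (i, (i + j) mod 2)"
    and "j \<ge> 1"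
    and "(i + v) mod 2 = j mod 2"
    and "kasteleyn_orientation (nat (j - 1)) (i, v) \<phi>"
  shows "p (i, j) = ratio_function (nat (j - 1)) (i, v) \<phi> a"
proof (cases "j = 1")
  \<comment> \<open>Size 0, where \<open>ratio_function\<close> is the weight of the centre
    itself.\<close>
  case True
  with assms(3,5) show ?thesis by (simp add: ratio_function_def)
next
  case False
  define n where "n = nat (j - 1)"
  have n: "int n = j - 1" "n \<noteq> 0" using False assms(4) by (auto simp: n_def)
  let ?val = "rational_value (aztec_faces n (i, v)) (formula_domain n (i, v) \<phi>) (ratio_formula n (i, v) \<phi>) a"
  have a: "a = (\<lambda>(i', j'). p (i', 0 + (i' + j' - 0) mod 2))"
    using assms(3) by (auto simp: fun_eq_iff)
  have "even (i + v + 0 + int n + 1)" using assms(5) n by presburger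
  from rational_value_pattern [OF assms(1,2) assms(6) [folded n_def] this]
  have val: "?val (p (i, j))" unfolding a [symmetric] by (simp add: n)
  have "w = p (i, j)" if "?val w" for w
  \<comment> \<open>The neighbourhood needed for density is taken around
    \<open>linear_weight\<close>.\<close>
  proof (rule rational_value_unique [OF finite_aztec_faces _ that val])
    fix c :: "complex \<Rightarrow> face \<Rightarrow> complex"
    assume c: "\<And>f. f \<in> aztec_faces n (i, v) \<Longrightarrow> ((\<lambda>s. c s f) \<longlongrightarrow> linear_weight f) (at 0)"
    show "\<forall>\<^sub>F s in at 0. c s \<in> formula_domain n (i, v) \<phi>"
      by (rule eventually_in_formula_domain [OF c linear_weight_in_domain [OF assms(6) [folded n_def]]])
  qed
  with val have "(THE w. ?val w) = p (i, j)" by (rule the_equality)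
  then show ?thesis using n(2) by (simp add: ratio_function_def n_def [symmetric])
qed

end
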